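(* Let $k\in\mathbb{N}$, $F\in\mathcal{H}_k$ with $e(F)>0$, and let $\mathcal{R}$ be the $F$-removal rule. Then for every $\varepsilon>0$ there exists $T\ge0$ such that for every graphon $W$ we have $\|\Phi^TW-\mathrm{dest}(W)\|_1<\varepsilon$.
   Context: Let $(\Omega,\pi)$ be an atomless probability space with separable $\sigma$-algebra. A kernel is a bounded symmetric measurable $W:\Omega^2\to\mathbb{R}$ (up to a.e. equality); $\mathcal{W}$ is the Banach space of kernels with $\|\cdot\|_\infty$; graphons are kernels with values in $[0,1]$; $\|W\|_1=\int|W|\,d\pi^2$; $d_\square(U,W)=\sup_{S,T\subseteq\Omega}|\int_{S\times T}(U-W)\,d\pi^2|$. $\mathcal{H}_k$ is the set of graphs on $[k]$. A rule of order $k$ is a matrix $\mathcal{R}\in[0,1]^{\mathcal{H}_k\times\mathcal{H}_k}$ with row sums $1$. For a kernel $W$, $G\in\mathcal{H}_k$, distinct $a,b$, $x,y$: $t^{x,y}_{\mathrm{ind}}(G^{a,b},W)=\int\prod_{ij\in E(G)}W(x_i,x_j)\prod_{ij\notin E(G)}(1-W(x_i,x_j))\prod_{i\ne a,b}d\pi(x_i)$ with $x_a=x,x_b=y$. Velocity: $\mathfrak{V}_{\mathcal{R}}W(x,y)=\sum_{G,H}\sum_{a\ne b}\mathcal{R}_{G,H}t^{x,y}_{\mathrm{ind}}(G^{a,b},W)(\mathbb{1}[ab\in E(H)\setminus E(G)]-\mathbb{1}[ab\in E(G)\setminus E(H)])$. For a graphon $W$, the trajectory $t\mapsto\Phi^tW$,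 $t\ge0$, is the unique solution of $\frac{d}{dt}\Phi^tW=\mathfrak{V}_{\mathcal{R}}(\Phi^tW)$ in $(\mathcal{W},\|\cdot\|_\infty)$ with $\Phi^0W=W$; $\mathrm{dest}(W)$ is the graphon $S$ with $d_\square(\Phi^tW,S)\to0$ as $t\to\infty$ (it exists for removal rules). The $F$-removal rule: $\mathcal{R}_{H,H-F}=1$ for every $H\in\mathcal{H}_k$ containing $F$ as a labelled subgraph ($H-F$ is $H$ with the edges of $F$ deleted), $\mathcal{R}_{H,H}=1$ for every other $H$; all other entries $0$. *)

theory Defs
  imports "HOL-Probability.Probability"
begin

section \<open>The ground space\<close>

definition atomless :: "'a measure \<Rightarrow> bool" where
  "atomless M \<longleftrightarrow> (\<forall>A\<in>sets M. measure M A > 0 \<longrightarrow>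
     (\<exists>B\<in>sets M. B \<subseteq> A \<and> 0 < measure M B \<and> measure M B < measure M A))"

text \<open>Separability is meant with respect to the pseudometric given by the measure of the
  symmetric difference. Every countably generated \<open>\<sigma>\<close>-algebra is separable in this sense.\<close>

definition separable_sigma_algebra :: "'a measure \<Rightarrow> bool" where
  "separable_sigma_algebra M \<longleftrightarrow> (\<exists>D. countable D \<and> D \<subseteq> sets M \<and>
     (\<forall>A\<in>sets M. \<forall>e>0. \<exists>B\<in>D. measure M ((A - B) \<union> (B - A)) < e))"

section \<open>Kernels and graphons\<close>

text \<open>Elements of the space of kernels are classes modulo equality almost everywhere. They are
  handled through representatives that are measurable, symmetric and bounded everywhere on the
  space; every class has one, and each norm below depends only on the class.\<close>

definition kernel :: "'a measure \<Rightarrow> ('a \<times> 'a \<Rightarrow> real) \<Rightarrow> bool" where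
  "kernel M W \<longleftrightarrow> W \<in> borel_measurable (M \<Otimes>\<^sub>M M) \<and>
     (\<forall>x\<in>space M. \<forall>y\<in>space M. W (x, y) = W (y, x)) \<and>
     (\<exists>B. \<forall>x\<in>space M. \<forall>y\<in>space M. \<bar>W (x, y)\<bar> \<le> B)"

definition graphon :: "'a measure \<Rightarrow> ('a \<times> 'a \<Rightarrow> real) \<Rightarrow> bool" where
  "graphon M W \<longleftrightarrow> kernel M W \<and> (\<forall>x\<in>space M. \<forall>y\<in>space M. 0 \<le> W (x, y) \<and> W (x, y) \<le> 1)"

definition sup_norm :: "'a measure \<Rightarrow> ('a \<times> 'a \<Rightarrow> real) \<Rightarrow> ereal" where
  "sup_norm M W = esssup (M \<Otimes>\<^sub>M M) (\<lambda>p. ereal \<bar>W p\<bar>)"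

definition L1_norm :: "'a measure \<Rightarrow> ('a \<times> 'a \<Rightarrow> real) \<Rightarrow> real" where
  "L1_norm M W = (LINT p|(M \<Otimes>\<^sub>M M). \<bar>W p\<bar>)"

definition cut_dist :: "'a measure \<Rightarrow> ('a \<times> 'a \<Rightarrow> real) \<Rightarrow> ('a \<times> 'a \<Rightarrow> real) \<Rightarrow> real" where
  "cut_dist M U W = (SUP (S, T)\<in>sets M \<times> sets M. \<bar>LINT p:S \<times> T|(M \<Otimes>\<^sub>M M). U p - W p\<bar>)"

section \<open>Labelled graphs and rules\<close>

text \<open>A graph on \<open>[k]\<close> is given by its set of edges, an edge being a two-element subset of
  \<open>{1..k}\<close>. A rule of order \<open>k\<close> is a matrix indexed by such graphs.\<close>

type_synonym edge_set = "nat set set"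

definition labelled_graphs :: "nat \<Rightarrow> edge_set set" where
  "labelled_graphs k = Pow {e. e \<subseteq> {1..k} \<and> card e = 2}"

definition removal_rule :: "edge_set \<Rightarrow> edge_set \<Rightarrow> edge_set \<Rightarrow> real" where
  "removal_rule F G H = of_bool (H = (if F \<subseteq> G then G - F else G))"

section \<open>Velocity, trajectories and destinations\<close>

definition t_ind_rooted ::
  "'a measure \<Rightarrow> nat \<Rightarrow> edge_set \<Rightarrow> nat \<Rightarrow> nat \<Rightarrow> ('a \<times> 'a \<Rightarrow> real) \<Rightarrow> 'a \<Rightarrow> 'a \<Rightarrow> real" where
  "t_ind_rooted M k G a b W x y =
     (LINT z|(\<Pi>\<^sub>M i\<in>{1..k} - {a, b}. M).
        (let v = z(a := x, b := y) in
          \<Prod>(i, j)\<in>{(i, j). 1 \<le> i \<and> i < j \<and> j \<le> k}.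
            if {i, j} \<in> G then W (v i, v j) else 1 - W (v i, v j)))"

definition velocity ::
  "'a measure \<Rightarrow> nat \<Rightarrow> (edge_set \<Rightarrow> edge_set \<Rightarrow> real) \<Rightarrow> ('a \<times> 'a \<Rightarrow> real) \<Rightarrow> 'a \<times> 'a \<Rightarrow> real" where
  "velocity M k R W = (\<lambda>(x, y).
     \<Sum>G\<in>labelled_graphs k. \<Sum>H\<in>labelled_graphs k.
       \<Sum>(a, b)\<in>{(a, b). a \<in> {1..k} \<and> b \<in> {1..k} \<and> a \<noteq> b}.
         R G H * t_ind_rooted M k G a b W x y *
           (of_bool ({a, b} \<in> H - G) - of_bool ({a, b} \<in> G - H)))"

text \<open>The differential equation holds in the Banach space of kernels with the essential supremum
  norm: difference quotients converge in that norm (one-sidedly at time 0).\<close>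

definition is_trajectory ::
  "'a measure \<Rightarrow> nat \<Rightarrow> (edge_set \<Rightarrow> edge_set \<Rightarrow> real) \<Rightarrow> ('a \<times> 'a \<Rightarrow> real) \<Rightarrow>
    (real \<Rightarrow> 'a \<times> 'a \<Rightarrow> real) \<Rightarrow> bool" where
  "is_trajectory M k R W \<Phi> \<longleftrightarrow>
     (\<forall>t\<ge>0. kernel M (\<Phi> t)) \<and>
     (AE p in M \<Otimes>\<^sub>M M. \<Phi> 0 p = W p) \<and>
     (\<forall>t\<ge>0. ((\<lambda>s. sup_norm M (\<lambda>p. (\<Phi> s p - \<Phi> t p) / (s - t) - velocity M k R (\<Phi> t) p))
        \<longlongrightarrow> 0) (at t within {0..}))"

text \<open>As kernels are classes modulo null sets, the trajectory and the destination are unique only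
  up to equality almost everywhere; the following functions choose representatives.\<close>

definition trajectory ::
  "'a measure \<Rightarrow> nat \<Rightarrow> (edge_set \<Rightarrow> edge_set \<Rightarrow> real) \<Rightarrow> ('a \<times> 'a \<Rightarrow> real) \<Rightarrow>
    real \<Rightarrow> 'a \<times> 'a \<Rightarrow> real" where
  "trajectory M k R W = (SOME \<Phi>. is_trajectory M k R W \<Phi>)"

definition dest ::
  "'a measure \<Rightarrow> nat \<Rightarrow> (edge_set \<Rightarrow> edge_set \<Rightarrow> real) \<Rightarrow> ('a \<times> 'a \<Rightarrow> real) \<Rightarrow> 'a \<times> 'a \<Rightarrow> real" where
  "dest M k R W = (SOME S. graphon M S \<and>
     ((\<lambda>t. cut_dist M (trajectory M k R W t) S) \<longlongrightarrow> 0) at_top)"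

end

theory Submission
  imports Defs
begin

text \<open>For the removal rule the velocity is \<open>-\<close> the sum, over the ordered edges \<open>ab\<close> of \<open>F\<close>, of
  the rooted densities of \<open>F\<close>, so trajectories decrease pointwise and converge to the destination.
  The edge density falls at a rate proportional to the density of \<open>F\<close>, so the latter drops below
  any given \<open>\<delta>\<close> by a time that does not depend on the graphon. From then on the removal lemma
  gives a set \<open>A\<close> of pairs of small mass that meets every copy of \<open>F\<close>. Whenever copies of \<open>F\<close>
  are destroyed, a fixed proportion of the lost mass is lost on \<open>A\<close>, so the remaining loss is at
  most a constant times the mass of \<open>A\<close>.

  The removal lemma is obtained from a strong regularity lemma by an energy increment. Existence of
  trajectories uses Picard iteration for a clamped velocity, and uniqueness a Gronwall estimate for
  the squared \<open>L\<^sup>2\<close> distance.\<close>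

section \<open>Product spaces with two distinguished coordinates\<close>

context prob_space
begin

abbreviation (input) power_space :: "nat set \<Rightarrow> (nat \<Rightarrow> 'a) measure" where
  "power_space I \<equiv> Pi\<^sub>M I (\<lambda>_. M)"

abbreviation (input) square :: "('a \<times> 'a) measure" where
  "square \<equiv> M \<Otimes>\<^sub>M M"

lemma prob_space_power_space: "prob_space (power_space I)"
  by (intro prob_space_PiM prob_space_axioms)

lemma prob_space_square: "prob_space square"
  by (intro prob_space_pair prob_space_axioms)

lemma measurable_root_pair:
  assumes "a \<in> I" "b \<in> I"
  shows "(\<lambda>((x, y), z). z(a := x, b := y))
    \<in> square \<Otimes>\<^sub>M power_space (I - {a, b}) \<rightarrow>\<^sub>M power_space I"
  unfolding case_prod_beta'
proof (rule measurable_PiM_single')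
  fix i assume "i \<in> I"
  then show "(\<lambda>w. ((snd w)(a := fst (fst w), b := snd (fst w))) i)
      \<in> square \<Otimes>\<^sub>M power_space (I - {a, b}) \<rightarrow>\<^sub>M M"
    by (cases "i = a"; cases "i = b") (auto simp: fun_upd_def)
next
  show "(\<lambda>w. (snd w)(a := fst (fst w), b := snd (fst w)))
      \<in> space (square \<Otimes>\<^sub>M power_space (I - {a, b})) \<rightarrow> I \<rightarrow>\<^sub>E space M"
    using assms by (auto simp: space_pair_measure space_PiM PiE_def extensional_def Pi_def)
qed

lemma distr_root_pair:
  assumes "finite I" "a \<in> I" "b \<in> I" "a \<noteq> b"
  shows "distr (square \<Otimes>\<^sub>M power_space (I - {a, b})) (power_space I)
    (\<lambda>((x, y), z). z(a := x, b := y)) = power_space I"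
proof -
  let ?Q = "power_space (I - {a, b})"
  let ?f = "\<lambda>((x, y), z). z(a := x, b := y)"
  interpret P: product_sigma_finite "\<lambda>_ :: nat. M"
    by (unfold_locales)
  interpret Q: prob_space ?Q by (rule prob_space_power_space)
  interpret S: prob_space "square" by (rule prob_space_square)
  note f = measurable_root_pair[OF assms(2,3)]
  show ?thesis
  proof (rule P.PiM_eqI[OF assms(1)])
    fix A assume A: "\<And>i. i \<in> I \<Longrightarrow> A i \<in> sets M"
    have box: "Pi\<^sub>E I A \<in> sets (power_space I)"
      using A assms(1) by (intro sets_PiM_I_finite) auto
    have "?f -` Pi\<^sub>E I A \<inter> space (square \<Otimes>\<^sub>M ?Q) = (A a \<times> A b) \<times> Pi\<^sub>E (I - {a, b}) A"
      using A[THEN sets.sets_into_space] assms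
      by (auto simp: space_pair_measure space_PiM PiE_def extensional_def Pi_def split: if_splits)
    then have "emeasure (distr (square \<Otimes>\<^sub>M ?Q) (power_space I) ?f) (Pi\<^sub>E I A)
        = emeasure M (A a) * emeasure M (A b) * emeasure ?Q (Pi\<^sub>E (I - {a, b}) A)"
      using A assms by (simp add: emeasure_distr[OF f box] Q.emeasure_pair_measure_Times
          emeasure_pair_measure_Times sets_PiM_I_finite)
    also have "emeasure ?Q (Pi\<^sub>E (I - {a, b}) A) = (\<Prod>i\<in>I - {a, b}. emeasure M (A i))"
      using A assms(1) by (intro P.emeasure_PiM) auto
    also have "emeasure M (A a) * emeasure M (A b) * (\<Prod>i\<in>I - {a, b}. emeasure M (A i))
        = (\<Prod>i\<in>I. emeasure M (A i))"
    proof -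
      have "(\<Prod>i\<in>I. emeasure M (A i)) = emeasure M (A a) * (\<Prod>i\<in>I - {a}. emeasure M (A i))"
        using assms by (simp add: prod.remove)
      also have "(\<Prod>i\<in>I - {a}. emeasure M (A i))
          = emeasure M (A b) * (\<Prod>i\<in>I - {a} - {b}. emeasure M (A i))"
        using assms by (intro prod.remove) auto
      also have "I - {a} - {b} = I - {a, b}" by auto
      finally show ?thesis by (simp add: mult.assoc)
    qed
    finally show "emeasure (distr (square \<Otimes>\<^sub>M ?Q) (power_space I) ?f) (Pi\<^sub>E I A)
        = (\<Prod>i\<in>I. emeasure M (A i))" .
  qed auto
qed

lemma integrable_root_pair:
  fixes G :: "(nat \<Rightarrow> 'a) \<Rightarrow> real"
  assumes "finite I" "a \<in> I" "b \<in> I" "a \<noteq> b" "integrable (power_space I) G"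
  shows "integrable (square \<Otimes>\<^sub>M power_space (I - {a, b})) (\<lambda>((x, y), z). G (z(a := x, b := y)))"
proof -
  have "integrable (square \<Otimes>\<^sub>M power_space (I - {a, b}))
      (\<lambda>w. G ((\<lambda>((x, y), z). z(a := x, b := y)) w))"
    using assms by (intro integrable_distr[OF measurable_root_pair]) (simp_all add: distr_root_pair)
  then show ?thesis by (simp add: case_prod_beta')
qed

lemma integral_root_pair:
  fixes G :: "(nat \<Rightarrow> 'a) \<Rightarrow> real"
  assumes I: "finite I" "a \<in> I" "b \<in> I" "a \<noteq> b" and G: "integrable (power_space I) G"
  shows "(LINT z|power_space I. G z)
      = (LINT p|square. LINT z|power_space (I - {a, b}). G (z(a := fst p, b := snd p)))" (is ?A)
    and "(LINT z|power_space I. G z)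
      = (LINT z|power_space (I - {a, b}). LINT p|square. G (z(a := fst p, b := snd p)))" (is ?B)
proof -
  let ?Q = "power_space (I - {a, b})"
  interpret Q: prob_space ?Q by (rule prob_space_power_space)
  interpret S: prob_space "square" by (rule prob_space_square)
  interpret SQ: pair_prob_space "square" ?Q ..
  have "(LINT z|power_space I. G z)
      = (LINT z|distr (square \<Otimes>\<^sub>M ?Q) (power_space I) (\<lambda>((x, y), z). z(a := x, b := y)). G z)"
    by (simp add: distr_root_pair[OF I])
  also have "\<dots> = (LINT w|(square \<Otimes>\<^sub>M ?Q). G ((\<lambda>((x, y), z). z(a := x, b := y)) w))"
    by (rule integral_distr[OF measurable_root_pair])
      (use I G in \<open>auto dest: borel_measurable_integrable\<close>)
  finally have *: "(LINT z|power_space I. G z)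
      = (LINT (p, z)|(square \<Otimes>\<^sub>M ?Q). G (z(a := fst p, b := snd p)))"
    by (simp add: case_prod_beta')
  have int: "integrable (square \<Otimes>\<^sub>M ?Q) (\<lambda>(p, z). G (z(a := fst p, b := snd p)))"
    using integrable_root_pair[OF I G] by (simp add: case_prod_beta')
  show ?A unfolding * using SQ.integral_fst'[OF int] by simp
  show ?B unfolding * using SQ.integral_snd[of "\<lambda>p z. G (z(a := fst p, b := snd p))"] int by simp
qed

lemma distr_two_components:
  assumes I: "finite I" "a \<in> I" "b \<in> I" "a \<noteq> b"
  shows "distr (power_space I) square (\<lambda>z. (z a, z b)) = square"
proof -
  let ?Q = "power_space (I - {a, b})"
  interpret Q: prob_space ?Q by (rule prob_space_power_space)
  interpret S: prob_space "square" by (rule prob_space_square)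
  have meas: "(\<lambda>z. (z a, z b)) \<in> power_space I \<rightarrow>\<^sub>M square"
    using I by measurable
  have "distr (power_space I) square (\<lambda>z. (z a, z b))
    = distr (distr (square \<Otimes>\<^sub>M ?Q) (power_space I) (\<lambda>((x, y), z). z(a := x, b := y)))
        square (\<lambda>z. (z a, z b))"
    by (simp add: distr_root_pair[OF I])
  also have "\<dots> = distr (square \<Otimes>\<^sub>M ?Q) square fst"
    using I by (subst distr_distr[OF meas measurable_root_pair]) (auto simp: comp_def case_prod_beta')
  also have "\<dots> = square"
    by (simp add: Q.distr_pair_fst)
  finally show ?thesis .
qed

end

section \<open>Conditional means and energy\<close>

definition cell_mean :: "'b measure \<Rightarrow> ('b \<Rightarrow> real) \<Rightarrow> ('b \<Rightarrow> 'c) \<Rightarrow> 'c \<Rightarrow> real" where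
  "cell_mean N W q v =
    (LINT x|N. W x * of_bool (q x = v)) / measure N {x \<in> space N. q x = v}"

lemma borel_measurable_finite_valued:
  assumes "q \<in> N \<rightarrow>\<^sub>M count_space UNIV"
  shows "(\<lambda>x. g (q x) :: real) \<in> borel_measurable N"
  by (rule measurable_compose[OF assms]) simp

lemma (in finite_measure) integrable_bounded:
  fixes f :: "'a \<Rightarrow> real"
  assumes "f \<in> borel_measurable M" "\<And>x. x \<in> space M \<Longrightarrow> \<bar>f x\<bar> \<le> B"
  shows "integrable M f"
  using assms by (intro integrable_const_bound[where B = B]) (auto intro: AE_I2)

context prob_space
begin

lemma integral_in_unit_interval:
  fixes f :: "'a \<Rightarrow> real"
  assumes "f \<in> borel_measurable M" "\<And>x. x \<in> space M \<Longrightarrow> f x \<in> {0..1}"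
  shows "(LINT x|M. f x) \<in> {0..1}"
proof -
  have int: "integrable M f"
    by (rule integrable_bounded[where B = 1]) (use assms in \<open>auto simp: abs_le_iff intro: order_trans\<close>)
  have "(LINT x|M. f x) \<le> (LINT x|M. 1)"
    by (intro integral_mono int) (use assms in auto)
  moreover have "0 \<le> (LINT x|M. f x)"
    by (intro integral_nonneg_AE AE_I2) (use assms in auto)
  ultimately show ?thesis by (simp add: prob_space)
qed

lemma power2_integral_abs_le:
  fixes f :: "'a \<Rightarrow> real"
  assumes "integrable M f" "integrable M (\<lambda>x. (f x)\<^sup>2)"
  shows "(LINT x|M. \<bar>f x\<bar>)\<^sup>2 \<le> (LINT x|M. (f x)\<^sup>2)"
proof -
  let ?m = "LINT x|M. \<bar>f x\<bar>"
  have "0 \<le> (LINT x|M. (\<bar>f x\<bar> - ?m)\<^sup>2)"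
    by simp
  also have "\<dots> = (LINT x|M. (f x)\<^sup>2 - 2 * ?m * \<bar>f x\<bar> + ?m\<^sup>2)"
    by (simp add: power2_diff algebra_simps)
  also have "\<dots> = (LINT x|M. (f x)\<^sup>2) - ?m\<^sup>2"
    using assms by (simp add: prob_space power2_eq_square)
  finally show ?thesis by simp
qed

lemma integral_of_bool:
  assumes "{x \<in> space M. P x} \<in> sets M"
  shows "(LINT x|M. of_bool (P x)) = prob {x \<in> space M. P x}"
proof -
  have "(LINT x|M. of_bool (P x)) = (LINT x|M. indicator {x \<in> space M. P x} x :: real)"
    by (intro Bochner_Integration.integral_cong) (auto simp: indicator_def)
  also have "\<dots> = prob {x \<in> space M. P x}"
    using assms by (simp add: Int_absorb2)
  finally show ?thesis .
qed

lemma cell_mean_in_unit_interval: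
  assumes q: "q \<in> M \<rightarrow>\<^sub>M count_space UNIV"
    and W: "W \<in> borel_measurable M" "\<And>x. x \<in> space M \<Longrightarrow> W x \<in> {0..1}"
  shows "cell_mean M W q v \<in> {0..1}"
proof -
  have [measurable]: "{x \<in> space M. q x = v} \<in> sets M"
    using measurable_sets[OF q, of "{v}"] by (simp add: vimage_def Int_def conj_commute)
  have ind: "(LINT x|M. of_bool (q x = v)) = prob {x \<in> space M. q x = v}"
    by (rule integral_of_bool) simp
  have [measurable]: "(\<lambda>x. of_bool (q x = v) :: real) \<in> borel_measurable M"
    by (rule borel_measurable_finite_valued[OF q, where g = "\<lambda>w. of_bool (w = v)"])
  note [measurable] = W(1)
  have int: "integrable M (\<lambda>x. of_bool (q x = v) :: real)"
    by (rule integrable_bounded[where B = 1]) auto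
  have int': "integrable M (\<lambda>x. W x * of_bool (q x = v) :: real)"
    using W(2) by (intro integrable_bounded[where B = 1]) (auto simp: abs_le_iff intro: order_trans)
  have "(LINT x|M. W x * of_bool (q x = v)) \<le> prob {x \<in> space M. q x = v}"
    unfolding ind[symmetric] using W(2) by (intro integral_mono int int') (auto split: if_splits)
  moreover have "0 \<le> (LINT x|M. W x * of_bool (q x = v))"
    using W(2) by (intro integral_nonneg_AE AE_I2) auto
  ultimately show ?thesis
    by (auto simp: cell_mean_def divide_le_eq_1 zero_less_measure_iff intro: divide_nonneg_nonneg)
qed

lemma integral_times_finite_valued:
  fixes W :: "'a \<Rightarrow> real"
  assumes q: "q \<in> M \<rightarrow>\<^sub>M count_space UNIV" "finite Q" "\<And>x. x \<in> space M \<Longrightarrow> q x \<in> Q"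
    and W: "integrable M W"
  shows "(LINT x|M. W x * g (q x)) = (\<Sum>v\<in>Q. g v * (LINT x|M. W x * of_bool (q x = v)))"
proof -
  have int: "integrable M (\<lambda>x. W x * of_bool (q x = v) :: real)" for v
  proof (rule Bochner_Integration.integrable_bound[OF W])
    show "(\<lambda>x. W x * of_bool (q x = v)) \<in> borel_measurable M"
      using W borel_measurable_finite_valued[OF q(1), of "\<lambda>w. of_bool (w = v)"] by auto
  qed auto
  have "(LINT x|M. W x * g (q x)) = (LINT x|M. (\<Sum>v\<in>Q. g v * (W x * of_bool (q x = v))))"
  proof (intro Bochner_Integration.integral_cong refl)
    fix x assume "x \<in> space M"
    then have "(\<Sum>v\<in>Q. g v * (W x * of_bool (q x = v))) = (\<Sum>v\<in>Q. if q x = v then g v * W x else 0)"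
      by (intro sum.cong) auto
    also have "\<dots> = W x * g (q x)"
      using q(2,3) \<open>x \<in> space M\<close> by simp
    finally show "W x * g (q x) = (\<Sum>v\<in>Q. g v * (W x * of_bool (q x = v)))" by simp
  qed
  also have "\<dots> = (\<Sum>v\<in>Q. g v * (LINT x|M. W x * of_bool (q x = v)))"
    using int by simp
  finally show ?thesis .
qed

lemma integral_cell_mean:
  assumes q: "q \<in> M \<rightarrow>\<^sub>M count_space UNIV" "finite Q" "\<And>x. x \<in> space M \<Longrightarrow> q x \<in> Q"
    and W: "integrable M W"
  shows "(LINT x|M. W x * g (q x)) = (LINT x|M. cell_mean M W q (q x) * g (q x))"
proof -
  have cell: "{x \<in> space M. q x = v} \<in> sets M" for v
    using measurable_sets[OF q(1), of "{v}"] by (simp add: vimage_def Int_def conj_commute)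
  have ind: "(LINT x|M. of_bool (q x = v)) = prob {x \<in> space M. q x = v}" for v
    by (rule integral_of_bool[OF cell])
  have *: "cell_mean M W q v * prob {x \<in> space M. q x = v} = (LINT x|M. W x * of_bool (q x = v))" for v
  proof (cases "prob {x \<in> space M. q x = v} = 0")
    case True
    then have "AE x in M. \<not> (q x = v)"
      using cell[of v] by (subst (asm) prob_eq_0) auto
    then have "(LINT x|M. W x * of_bool (q x = v)) = 0"
      by (intro integral_eq_zero_AE) auto
    then show ?thesis using True by simp
  qed (simp add: cell_mean_def)
  have "(LINT x|M. cell_mean M W q (q x) * g (q x)) = (LINT x|M. 1 * (cell_mean M W q (q x) * g (q x)))"
    by simp
  also have "\<dots> = (\<Sum>v\<in>Q. cell_mean M W q v * g v * (LINT x|M. 1 * of_bool (q x = v)))"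
    by (rule integral_times_finite_valued[OF q, where g = "\<lambda>v. cell_mean M W q v * g v"])
      (simp, rule integrable_const)
  also have "\<dots> = (\<Sum>v\<in>Q. g v * (cell_mean M W q v * prob {x \<in> space M. q x = v}))"
    by (simp add: ind mult_ac)
  also have "\<dots> = (LINT x|M. W x * g (q x))"
    unfolding * by (rule integral_times_finite_valued[OF q W, symmetric])
  finally show ?thesis by simp
qed

lemma energy_refinement:
  assumes q: "q \<in> M \<rightarrow>\<^sub>M count_space UNIV" "finite Q" "\<And>x. x \<in> space M \<Longrightarrow> q x \<in> Q"
    and q': "q' \<in> M \<rightarrow>\<^sub>M count_space UNIV" "finite Q'" "\<And>x. x \<in> space M \<Longrightarrow> q' x \<in> Q'"
    and refines: "\<And>x. x \<in> space M \<Longrightarrow> q x = h (q' x)"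
    and W: "W \<in> borel_measurable M" "\<And>x. x \<in> space M \<Longrightarrow> W x \<in> {0..1}"
  shows "(LINT x|M. (cell_mean M W q' (q' x))\<^sup>2) = (LINT x|M. (cell_mean M W q (q x))\<^sup>2)
    + (LINT x|M. (cell_mean M W q' (q' x) - cell_mean M W q (q x))\<^sup>2)"
proof -
  let ?u = "\<lambda>x. cell_mean M W q (q x)" and ?u' = "\<lambda>x. cell_mean M W q' (q' x)"
  have W_int: "integrable M W"
    by (rule integrable_bounded[where B = 1]) (use W in \<open>auto simp: abs_le_iff intro: order_trans\<close>)
  have [measurable]: "?u \<in> borel_measurable M" "?u' \<in> borel_measurable M"
    using borel_measurable_finite_valued q(1) q'(1) by blast+
  have u01: "?u x \<in> {0..1}" and u'01: "?u' x \<in> {0..1}" for x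
    using cell_mean_in_unit_interval[OF q(1) W] cell_mean_in_unit_interval[OF q'(1) W] by auto
  have int: "integrable M (\<lambda>x. ?u x * ?u x)" "integrable M (\<lambda>x. ?u' x * ?u x)"
     "integrable M (\<lambda>x. ?u' x * ?u' x)"
    using u01 u'01 by (intro integrable_bounded[where B = 1]; auto simp: abs_mult intro!: mult_le_one)+
  have "(LINT x|M. ?u' x * ?u x) = (LINT x|M. ?u' x * cell_mean M W q (h (q' x)))"
    by (intro Bochner_Integration.integral_cong) (auto simp: refines)
  also have "\<dots> = (LINT x|M. W x * cell_mean M W q (h (q' x)))"
    by (rule integral_cell_mean[OF q' W_int, symmetric])
  also have "\<dots> = (LINT x|M. W x * ?u x)"
    by (intro Bochner_Integration.integral_cong) (auto simp: refines)
  also have "\<dots> = (LINT x|M. ?u x * ?u x)"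
    by (rule integral_cell_mean[OF q W_int])
  finally have *: "(LINT x|M. ?u' x * ?u x) = (LINT x|M. ?u x * ?u x)" .
  have "(LINT x|M. (?u' x - ?u x)\<^sup>2) = (LINT x|M. ?u' x * ?u' x - 2 * (?u' x * ?u x) + ?u x * ?u x)"
    by (simp add: power2_eq_square algebra_simps)
  also have "\<dots> = (LINT x|M. ?u' x * ?u' x) - 2 * (LINT x|M. ?u' x * ?u x) + (LINT x|M. ?u x * ?u x)"
    using int by simp
  finally show ?thesis by (simp add: * power2_eq_square)
qed

end

section \<open>Regularity\<close>

context prob_space
begin

definition colouring :: "('a \<Rightarrow> nat) \<Rightarrow> nat \<Rightarrow> bool" where
  "colouring c n \<longleftrightarrow> c \<in> M \<rightarrow>\<^sub>M count_space UNIV \<and> (\<forall>x\<in>space M. c x < n)"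

definition pair_colour :: "('a \<Rightarrow> nat) \<Rightarrow> 'a \<times> 'a \<Rightarrow> nat \<times> nat" where
  "pair_colour c p = (c (fst p), c (snd p))"

definition block_average :: "('a \<times> 'a \<Rightarrow> real) \<Rightarrow> ('a \<Rightarrow> nat) \<Rightarrow> 'a \<times> 'a \<Rightarrow> real" where
  "block_average W c p = cell_mean square W (pair_colour c) (pair_colour c p)"

definition energy :: "('a \<times> 'a \<Rightarrow> real) \<Rightarrow> ('a \<Rightarrow> nat) \<Rightarrow> real" where
  "energy W c = (LINT p|square. (block_average W c p)\<^sup>2)"

definition cut_bounded :: "real \<Rightarrow> ('a \<times> 'a \<Rightarrow> real) \<Rightarrow> bool" where
  "cut_bounded \<eta> D \<longleftrightarrow> (\<forall>S\<in>sets M. \<forall>T\<in>sets M.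
     \<bar>LINT p|square. of_bool (fst p \<in> S) * of_bool (snd p \<in> T) * D p\<bar> \<le> \<eta>)"

definition unit_valued :: "('a \<times> 'a \<Rightarrow> real) \<Rightarrow> bool" where
  "unit_valued W \<longleftrightarrow> W \<in> borel_measurable square \<and> (\<forall>p\<in>space M \<times> space M. W p \<in> {0..1})"

lemma unit_valuedD:
  assumes "unit_valued W"
  shows "W \<in> borel_measurable square" "p \<in> space square \<Longrightarrow> W p \<in> {0..1}"
    "x \<in> space M \<Longrightarrow> y \<in> space M \<Longrightarrow> W (x, y) \<in> {0..1}"
  using assms unfolding unit_valued_def space_pair_measure by blast+

lemma unit_valued_integrable:
  assumes "unit_valued W"
  shows "integrable square W"
proof -
  interpret S: prob_space "square" by (rule prob_space_square)
  show ?thesis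
    using unit_valuedD[OF assms] by (intro S.integrable_bounded[where B = 1]) (auto simp: abs_le_iff intro: order_trans)
qed

lemma pair_colour:
  assumes "colouring c n"
  shows "pair_colour c \<in> square \<rightarrow>\<^sub>M count_space UNIV"
    and "p \<in> space square \<Longrightarrow> pair_colour c p \<in> {..<n} \<times> {..<n}"
proof -
  have [measurable]: "c \<in> M \<rightarrow>\<^sub>M count_space UNIV"
    using assms by (simp add: colouring_def)
  have "(\<lambda>p. (c (fst p), c (snd p))) \<in> square \<rightarrow>\<^sub>M count_space UNIV"
    by measurable
  then show "pair_colour c \<in> square \<rightarrow>\<^sub>M count_space UNIV"
    by (simp add: pair_colour_def[abs_def])
  show "p \<in> space square \<Longrightarrow> pair_colour c p \<in> {..<n} \<times> {..<n}"
    using assms by (auto simp: pair_colour_def colouring_def space_pair_measure)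
qed

lemma cell_mean_square_in_unit_interval:
  assumes "colouring c n" "unit_valued W"
  shows "cell_mean square W (pair_colour c) v \<in> {0..1}"
proof -
  interpret S: prob_space "square" by (rule prob_space_square)
  show ?thesis
    by (rule S.cell_mean_in_unit_interval[OF pair_colour(1)[OF assms(1)] unit_valuedD(1,2)[OF assms(2)]])
qed

lemma unit_valued_block_average:
  assumes "colouring c n" "unit_valued W"
  shows "unit_valued (block_average W c)"
  unfolding unit_valued_def block_average_def
  using cell_mean_square_in_unit_interval[OF assms]
    borel_measurable_finite_valued[OF pair_colour(1)[OF assms(1)]] by blast

lemma integral_block_average:
  assumes "colouring c n" "unit_valued W"
  shows "(LINT p|square. W p * g (pair_colour c p))
    = (LINT p|square. block_average W c p * g (pair_colour c p))"
proof -
  interpret S: prob_space "square" by (rule prob_space_square)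
  show ?thesis unfolding block_average_def
    by (rule S.integral_cell_mean[OF pair_colour(1)[OF assms(1)] _ pair_colour(2)[OF assms(1)]
        unit_valued_integrable[OF assms(2)]]) auto
qed

lemma energy_in_unit_interval:
  assumes "colouring c n" "unit_valued W"
  shows "energy W c \<in> {0..1}"
proof -
  interpret S: prob_space "square" by (rule prob_space_square)
  note u = unit_valuedD[OF unit_valued_block_average[OF assms]]
  show ?thesis unfolding energy_def
    using u(1) u(2) by (intro S.integral_in_unit_interval) (auto simp: power_le_one)
qed

lemma energy_increment:
  assumes "colouring c n" "colouring c' n'" "\<And>x. x \<in> space M \<Longrightarrow> c x = h (c' x)" "unit_valued W"
  shows "energy W c' = energy W c
    + (LINT p|square. (block_average W c' p - block_average W c p)\<^sup>2)"
proof -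
  interpret S: prob_space "square" by (rule prob_space_square)
  show ?thesis
    unfolding energy_def block_average_def
    using assms(3)
    by (intro S.energy_refinement[where h = "map_prod h h", OF pair_colour(1)[OF assms(1)] _ pair_colour(2)[OF assms(1)]
        pair_colour(1)[OF assms(2)] _ pair_colour(2)[OF assms(2)] _ unit_valuedD(1,2)[OF assms(4)]])
      (auto simp: pair_colour_def space_pair_measure)
qed

lemma base_four_digit:
  fixes m n r :: nat
  shows "r < 4 \<Longrightarrow> (4 * m + r) div 4 = m" "r < 4 \<Longrightarrow> (4 * m + r) mod 4 = r"
    "m < n \<Longrightarrow> r < 4 \<Longrightarrow> 4 * m + r < n * 4"
  by presburger+

lemma two_bits:
  "2 * of_bool a + of_bool b < (4::nat)" "2 \<le> (2 * of_bool a + of_bool b :: nat) \<longleftrightarrow> a"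
  "(2 * of_bool a + of_bool b :: nat) \<in> {1, 3} \<longleftrightarrow> b"
  by (cases a; cases b; simp)+

lemma refine_irregular_colouring:
  assumes c: "colouring c n" and W: "unit_valued W" and \<eta>: "\<eta> > 0"
    and irregular: "\<not> cut_bounded \<eta> (\<lambda>p. W p - block_average W c p)"
  obtains c' h where "colouring c' (n * 4)" "\<And>x. x \<in> space M \<Longrightarrow> c x = h (c' x)"
    "energy W c' \<ge> energy W c + \<eta>\<^sup>2"
proof -
  interpret S: prob_space "square" by (rule prob_space_square)
  from irregular obtain A B where AB[measurable]: "A \<in> sets M" "B \<in> sets M"
    and big: "\<bar>LINT p|square. of_bool (fst p \<in> A) * of_bool (snd p \<in> B) * (W p - block_average W c p)\<bar> > \<eta>"
    unfolding cut_bounded_def by (auto simp: not_le)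
  have c_meas[measurable]: "c \<in> M \<rightarrow>\<^sub>M count_space UNIV"
    using c by (simp add: colouring_def)
  define c' where "c' x = 4 * c x + (2 * of_bool (x \<in> A) + of_bool (x \<in> B))" for x
  have "(\<lambda>x. (c x, x \<in> A, x \<in> B)) \<in> M \<rightarrow>\<^sub>M count_space UNIV"
    by measurable
  then have "(\<lambda>x. (\<lambda>(m, a, b). 4 * m + (2 * of_bool a + of_bool b)) (c x, x \<in> A, x \<in> B))
      \<in> M \<rightarrow>\<^sub>M count_space UNIV"
    by (rule measurable_compose) simp
  then have "c' \<in> M \<rightarrow>\<^sub>M count_space UNIV"
    unfolding c'_def by simp
  moreover have "\<forall>x\<in>space M. c' x < n * 4"
    unfolding c'_def using c base_four_digit(3) two_bits(1) by (auto simp: colouring_def)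
  ultimately have c': "colouring c' (n * 4)"
    by (simp add: colouring_def)
  have refines: "c x = (\<lambda>m. m div 4) (c' x)" for x
    unfolding c'_def base_four_digit(1)[OF two_bits(1)] ..
  have inA: "x \<in> A \<longleftrightarrow> c' x mod 4 \<ge> 2" and inB: "x \<in> B \<longleftrightarrow> c' x mod 4 \<in> {1, 3}" for x
    unfolding c'_def base_four_digit(2)[OF two_bits(1)] two_bits by simp_all
  let ?u = "block_average W c" and ?u' = "block_average W c'"
  let ?g = "\<lambda>v. of_bool (fst v mod 4 \<ge> (2::nat)) * of_bool (snd v mod 4 \<in> {1, 3 :: nat}) :: real"
  have ind: "of_bool (fst p \<in> A) * of_bool (snd p \<in> B) = ?g (pair_colour c' p)" for p
    by (simp add: pair_colour_def inA inB)
  note u = unit_valuedD[OF unit_valued_block_average[OF c W]]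
  note u' = unit_valuedD[OF unit_valued_block_average[OF c' W]]
  note Wd = unit_valuedD[OF W]
  have g_meas: "(\<lambda>p. ?g (pair_colour c' p)) \<in> borel_measurable square"
    by (rule borel_measurable_finite_valued[OF pair_colour(1)[OF c'], of ?g])
  have int: "integrable square (\<lambda>p. V p * ?g (pair_colour c' p))" if "unit_valued V" for V
  proof (rule Bochner_Integration.integrable_bound[OF unit_valued_integrable[OF that]])
    show "(\<lambda>p. V p * ?g (pair_colour c' p)) \<in> borel_measurable square"
      by (intro borel_measurable_times unit_valuedD(1)[OF that] g_meas)
  qed (auto intro!: AE_I2)
  have int_diff: "integrable square (\<lambda>p. ?u' p - ?u p)"
    by (intro Bochner_Integration.integrable_diff unit_valued_integrable
        unit_valued_block_average[OF c' W] unit_valued_block_average[OF c W])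
  have int_sq: "integrable square (\<lambda>p. (?u' p - ?u p)\<^sup>2)"
  proof (rule S.integrable_bounded[where B = 1])
    show "(\<lambda>p. (?u' p - ?u p)\<^sup>2) \<in> borel_measurable square"
      using u(1) u'(1) by measurable
    fix p assume "p \<in> space square"
    then have "\<bar>?u' p - ?u p\<bar> \<le> 1"
      using u(2)[of p] u'(2)[of p] by auto
    then show "\<bar>(?u' p - ?u p)\<^sup>2\<bar> \<le> 1"
      by (simp add: abs_square_le_1)
  qed
  have "(LINT p|square. of_bool (fst p \<in> A) * of_bool (snd p \<in> B) * (W p - ?u p))
      = (LINT p|square. W p * ?g (pair_colour c' p)) - (LINT p|square. ?u p * ?g (pair_colour c' p))"
    unfolding ind
    by (subst Bochner_Integration.integral_diff[symmetric, OF int[OF W] int[OF unit_valued_block_average[OF c W]]])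
      (simp add: algebra_simps)
  also have "(LINT p|square. W p * ?g (pair_colour c' p)) = (LINT p|square. ?u' p * ?g (pair_colour c' p))"
    by (rule integral_block_average[OF c' W])
  also have "\<dots> - (LINT p|square. ?u p * ?g (pair_colour c' p))
      = (LINT p|square. (?u' p - ?u p) * ?g (pair_colour c' p))"
    by (subst Bochner_Integration.integral_diff[symmetric,
        OF int[OF unit_valued_block_average[OF c' W]] int[OF unit_valued_block_average[OF c W]]])
      (simp add: algebra_simps)
  finally have eq: "(LINT p|square. of_bool (fst p \<in> A) * of_bool (snd p \<in> B) * (W p - ?u p))
      = (LINT p|square. (?u' p - ?u p) * ?g (pair_colour c' p))" .
  have "\<bar>LINT p|square. (?u' p - ?u p) * ?g (pair_colour c' p)\<bar>
      \<le> (LINT p|square. \<bar>(?u' p - ?u p) * ?g (pair_colour c' p)\<bar>)"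
    by (rule integral_abs_bound)
  also have "\<dots> \<le> (LINT p|square. \<bar>?u' p - ?u p\<bar>)"
  proof (rule integral_mono')
    show "integrable square (\<lambda>p. \<bar>?u' p - ?u p\<bar>)"
      using int_diff by simp
  qed (auto simp: abs_mult)
  finally have "\<eta> \<le> (LINT p|square. \<bar>?u' p - ?u p\<bar>)"
    using big eq by simp
  then have "\<eta>\<^sup>2 \<le> (LINT p|square. \<bar>?u' p - ?u p\<bar>)\<^sup>2"
    using \<eta> by (intro power_mono) auto
  also have "\<dots> \<le> (LINT p|square. (?u' p - ?u p)\<^sup>2)"
    by (rule S.power2_integral_abs_le[OF int_diff int_sq])
  finally have "energy W c' \<ge> energy W c + \<eta>\<^sup>2"
    using energy_increment[OF c c' refines W] by linarith
  then show ?thesis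
    by (rule that[OF c' refines])
qed

lemma weak_regularity_iteration:
  assumes W: "unit_valued W" and \<eta>: "\<eta> > 0"
    and c: "colouring c n" and "energy W c > 1 - real j * \<eta>\<^sup>2"
  shows "\<exists>c' h. colouring c' (n * 4 ^ j) \<and> (\<forall>x\<in>space M. c x = h (c' x))
    \<and> cut_bounded \<eta> (\<lambda>p. W p - block_average W c' p)"
  using assms(3,4)
proof (induction j arbitrary: c n)
  case 0
  then show ?case using energy_in_unit_interval[OF 0(1) W] by simp
next
  case (Suc j)
  show ?case
  proof (cases "cut_bounded \<eta> (\<lambda>p. W p - block_average W c p)")
    case True
    have "colouring c (n * 4 ^ Suc j)"
      unfolding colouring_def
    proof (intro conjI ballI)
      fix x assume "x \<in> space M"
      then have "c x < n" using Suc.prems(1) by (simp add: colouring_def)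
      also have "n \<le> n * 4 ^ Suc j" by simp
      finally show "c x < n * 4 ^ Suc j" .
    qed (use Suc.prems(1) in \<open>simp add: colouring_def\<close>)
    then show ?thesis using True by (intro exI[of _ c] exI[of _ id]) auto
  next
    case False
    from refine_irregular_colouring[OF Suc.prems(1) W \<eta> False] obtain c1 h1
      where c1: "colouring c1 (n * 4)" "\<And>x. x \<in> space M \<Longrightarrow> c x = h1 (c1 x)"
        "energy W c1 \<ge> energy W c + \<eta>\<^sup>2" by blast
    have "energy W c1 > 1 - real j * \<eta>\<^sup>2"
      using c1(3) Suc.prems(2) by (simp add: algebra_simps)
    from Suc.IH[OF c1(1) this] obtain c' h where
      "colouring c' (n * 4 * 4 ^ j)" "\<forall>x\<in>space M. c1 x = h (c' x)"
      "cut_bounded \<eta> (\<lambda>p. W p - block_average W c' p)" by blast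
    then show ?thesis
      using c1(2) by (intro exI[of _ c'] exI[of _ "h1 \<circ> h"]) (auto simp: mult.assoc)
  qed
qed

lemma weak_regularity:
  assumes "\<eta> > 0"
  obtains K :: nat where "\<And>W c n. unit_valued W \<Longrightarrow> colouring c n \<Longrightarrow>
    \<exists>c' h. colouring c' (n * K) \<and> (\<forall>x\<in>space M. c x = h (c' x))
      \<and> cut_bounded \<eta> (\<lambda>p. W p - block_average W c' p)"
proof -
  obtain j where "1 / \<eta>\<^sup>2 < real j" using reals_Archimedean2 by blast
  then have j: "1 < real j * \<eta>\<^sup>2" using assms by (simp add: field_simps)
  show ?thesis
  proof (rule that[of "4 ^ j"])
    fix W c n assume W: "unit_valued W" and c: "colouring c n"
    have "energy W c > 1 - real j * \<eta>\<^sup>2"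
      using energy_in_unit_interval[OF c W] j by simp
    from weak_regularity_iteration[OF W assms c this]
    show "\<exists>c' h. colouring c' (n * 4 ^ j) \<and> (\<forall>x\<in>space M. c x = h (c' x))
      \<and> cut_bounded \<eta> (\<lambda>p. W p - block_average W c' p)" .
  qed
qed

lemma strong_regularity:
  fixes \<phi> :: "nat \<Rightarrow> real"
  assumes \<phi>: "\<And>n. \<phi> n > 0" and \<alpha>: "\<alpha> > 0"
  obtains N :: "nat \<Rightarrow> nat" and L :: nat where
    "\<And>W. unit_valued W \<Longrightarrow> \<exists>m<L. \<exists>c c' h n'. colouring c (N m) \<and> colouring c' n'
      \<and> (\<forall>x\<in>space M. c x = h (c' x))
      \<and> (LINT p|square. (block_average W c' p - block_average W c p)\<^sup>2) \<le> \<alpha>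
      \<and> cut_bounded (\<phi> (N m)) (\<lambda>p. W p - block_average W c' p)"
proof -
  define good where "good \<eta> K \<longleftrightarrow> (\<forall>W c m. unit_valued W \<longrightarrow> colouring c m \<longrightarrow>
    (\<exists>c' h. colouring c' (m * K) \<and> (\<forall>x\<in>space M. c x = h (c' x))
      \<and> cut_bounded \<eta> (\<lambda>p. W p - block_average W c' p)))" for \<eta> and K :: nat
  have "\<exists>K. good (\<phi> n) K" for n
  proof (rule weak_regularity[OF \<phi>[of n]])
    fix K :: nat
    assume "\<And>W c m. unit_valued W \<Longrightarrow> colouring c m \<Longrightarrow>
      \<exists>c' h. colouring c' (m * K) \<and> (\<forall>x\<in>space M. c x = h (c' x))
        \<and> cut_bounded (\<phi> n) (\<lambda>p. W p - block_average W c' p)"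
    then have "good (\<phi> n) K" unfolding good_def by simp
    then show ?thesis ..
  qed
  then obtain K where good: "\<And>n. good (\<phi> n) (K n)" by metis
  have regular: "\<exists>c' h. colouring c' (m * K n) \<and> (\<forall>x\<in>space M. c x = h (c' x))
      \<and> cut_bounded (\<phi> n) (\<lambda>p. W p - block_average W c' p)"
    if "unit_valued W" "colouring c m" for n W c m
    using good[of n] that by (simp add: good_def)
  define N where "N = rec_nat 1 (\<lambda>_ n. n * K n)"
  have N0: "N 0 = 1" and NS: "N (Suc m) = N m * K (N m)" for m by (simp_all add: N_def)
  have iteration: "\<exists>m'<m + j. \<exists>c c' h n'. colouring c (N m') \<and> colouring c' n'
      \<and> (\<forall>x\<in>space M. c x = h (c' x))
      \<and> (LINT p|square. (block_average W c' p - block_average W c p)\<^sup>2) \<le> \<alpha>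
      \<and> cut_bounded (\<phi> (N m')) (\<lambda>p. W p - block_average W c' p)"
    if W: "unit_valued W" and "colouring c (N m)" "energy W c > 1 - real j * \<alpha>" for W c m j
    using that(2,3)
  proof (induction j arbitrary: m c)
    case 0
    then show ?case using energy_in_unit_interval[OF 0(1) W] by simp
  next
    case (Suc j)
    obtain c' h where c': "colouring c' (N m * K (N m))" "\<forall>x\<in>space M. c x = h (c' x)"
      "cut_bounded (\<phi> (N m)) (\<lambda>p. W p - block_average W c' p)"
      using regular[OF W Suc.prems(1), of "N m"] by blast
    show ?case
    proof (cases "(LINT p|square. (block_average W c' p - block_average W c p)\<^sup>2) \<le> \<alpha>")
      case True
      then show ?thesis using c' Suc.prems(1)
        by (intro exI[of _ m] conjI exI[of _ c] exI[of _ c'] exI[of _ h] exI[of _ "N m * K (N m)"]) simp_all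
    next
      case False
      have "energy W c' > 1 - real j * \<alpha>"
        using False Suc.prems(2) energy_increment[OF Suc.prems(1) c'(1) _ W, of h] c'(2)
        by (simp add: algebra_simps)
      from Suc.IH[OF _ this, of "Suc m"] c'(1) show ?thesis by (simp add: NS)
    qed
  qed
  obtain j where "1 / \<alpha> < real j" using reals_Archimedean2 by blast
  then have j: "1 < real j * \<alpha>" using \<alpha> by (simp add: field_simps)
  show ?thesis
  proof (rule that[of j N])
    fix W assume W: "unit_valued W"
    have c0: "colouring (\<lambda>_. 0) (N 0)" by (simp add: colouring_def N0)
    have "energy W (\<lambda>_. 0) > 1 - real j * \<alpha>"
      using energy_in_unit_interval[OF c0 W] j by simp
    from iteration[OF W c0 this] show "\<exists>m<j. \<exists>c c' h n'. colouring c (N m) \<and> colouring c' n'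
      \<and> (\<forall>x\<in>space M. c x = h (c' x))
      \<and> (LINT p|square. (block_average W c' p - block_average W c p)\<^sup>2) \<le> \<alpha>
      \<and> cut_bounded (\<phi> (N m)) (\<lambda>p. W p - block_average W c' p)" by simp
  qed
qed

end

section \<open>Counting\<close>

context prob_space
begin

lemma prod_unit_interval:
  fixes f :: "'i \<Rightarrow> real"
  assumes "\<And>i. i \<in> A \<Longrightarrow> f i \<in> {0..1}"
  shows "(\<Prod>i\<in>A. f i) \<in> {0..1}"
  using assms by (auto intro: prod_nonneg prod_le_1)

lemma cut_bounded_weights_upper:
  assumes D: "D \<in> borel_measurable square" "\<And>p. p \<in> space square \<Longrightarrow> \<bar>D p\<bar> \<le> B"
    and cut: "cut_bounded \<eta> D"
    and f: "f \<in> borel_measurable M" "\<And>x. x \<in> space M \<Longrightarrow> f x \<in> {0..1}"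
    and g: "g \<in> borel_measurable M" "\<And>x. x \<in> space M \<Longrightarrow> g x \<in> {0..1}"
  shows "(LINT p|square. f (fst p) * g (snd p) * D p) \<le> \<eta>"
proof -
  interpret S: prob_space "square" by (rule prob_space_square)
  interpret MM: pair_prob_space M M ..
  note [measurable] = D(1) f(1) g(1)
  have int: "integrable square (\<lambda>p. v (fst p) * w (snd p) * D p)"
    if [measurable]: "v \<in> borel_measurable M" "w \<in> borel_measurable M"
      and vw: "\<And>x. x \<in> space M \<Longrightarrow> v x \<in> {0..1}" "\<And>x. x \<in> space M \<Longrightarrow> w x \<in> {0..1}"
    for v w :: "'a \<Rightarrow> real"
  proof (rule S.integrable_bounded[where B = B])
    fix p assume p: "p \<in> space square"
    then have vw': "v (fst p) \<in> {0..1}" "w (snd p) \<in> {0..1}"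
      using vw by (auto simp: space_pair_measure)
    have "\<bar>v (fst p) * w (snd p) * D p\<bar> = v (fst p) * w (snd p) * \<bar>D p\<bar>"
      using vw' by (simp add: abs_mult)
    also have "\<dots> \<le> 1 * \<bar>D p\<bar>"
      using vw' by (intro mult_right_mono mult_le_one) auto
    finally show "\<bar>v (fst p) * w (snd p) * D p\<bar> \<le> B"
      using D(2)[OF p] by simp
  qed measurable
  have positive_part: "(LINT x|M. v x * h x) \<le> (LINT x|M. of_bool (h x \<ge> 0) * h x)"
    if "integrable M (\<lambda>x. v x * h x)" "integrable M (\<lambda>x. of_bool (h x \<ge> 0) * h x)"
      and v: "\<And>x. x \<in> space M \<Longrightarrow> v x \<in> {0..1}" for v h :: "'a \<Rightarrow> real"
  proof (rule integral_mono[OF that(1,2)])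
    fix x assume "x \<in> space M"
    then show "v x * h x \<le> of_bool (h x \<ge> 0) * h x"
      using v[of x] by (cases "h x \<ge> 0") (auto simp: mult_left_le_one_le mult_nonneg_nonpos)
  qed
  define h where "h y = (LINT x|M. f x * D (x, y))" for y
  have [measurable]: "h \<in> borel_measurable M"
    unfolding h_def by measurable
  let ?T = "{y \<in> space M. h y \<ge> 0}"
  have T[measurable]: "?T \<in> sets M" by measurable
  have snd_eq: "(LINT p|square. f (fst p) * w (snd p) * D p) = (LINT y|M. w y * h y)"
    and snd_int: "integrable M (\<lambda>y. w y * h y)"
    if [measurable]: "w \<in> borel_measurable M" and w: "\<And>x. x \<in> space M \<Longrightarrow> w x \<in> {0..1}" for w
  proof -
    have i: "integrable square (\<lambda>(x, y). f x * w y * D (x, y))"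
      using int[OF f(1) that(1) f(2) w] by (simp add: case_prod_beta')
    have h: "(LINT x|M. f x * w y * D (x, y)) = w y * h y" for y
      unfolding h_def by (subst integral_mult_right_zero[symmetric]) (simp add: mult_ac)
    show "(LINT p|square. f (fst p) * w (snd p) * D p) = (LINT y|M. w y * h y)"
      using MM.integral_snd[OF i] by (simp add: h case_prod_beta')
    show "integrable M (\<lambda>y. w y * h y)"
      using MM.integrable_snd[OF i] by (simp add: h)
  qed
  have "(LINT p|square. f (fst p) * g (snd p) * D p) = (LINT y|M. g y * h y)"
    by (rule snd_eq[OF g])
  also have "\<dots> \<le> (LINT y|M. of_bool (h y \<ge> 0) * h y)"
    using snd_int[OF g] snd_int[of "\<lambda>y. of_bool (h y \<ge> 0)"] g(2)
    by (intro positive_part) auto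
  also have "\<dots> = (LINT y|M. of_bool (y \<in> ?T) * h y)"
    by (intro Bochner_Integration.integral_cong) auto
  also have "\<dots> = (LINT p|square. f (fst p) * of_bool (snd p \<in> ?T) * D p)"
    by (rule snd_eq[of "\<lambda>y. of_bool (y \<in> ?T)", symmetric]) auto
  finally have 1: "(LINT p|square. f (fst p) * g (snd p) * D p)
    \<le> (LINT p|square. f (fst p) * of_bool (snd p \<in> ?T) * D p)" .
  define k where "k x = (LINT y|M. of_bool (y \<in> ?T) * D (x, y))" for x
  have [measurable]: "k \<in> borel_measurable M"
    unfolding k_def by measurable
  let ?S = "{x \<in> space M. k x \<ge> 0}"
  have S[measurable]: "?S \<in> sets M" by measurable
  have fst_eq: "(LINT p|square. w (fst p) * of_bool (snd p \<in> ?T) * D p) = (LINT x|M. w x * k x)"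
    and fst_int: "integrable M (\<lambda>x. w x * k x)"
    if [measurable]: "w \<in> borel_measurable M" and w: "\<And>x. x \<in> space M \<Longrightarrow> w x \<in> {0..1}" for w
  proof -
    have "integrable square (\<lambda>p. w (fst p) * of_bool (snd p \<in> ?T) * D p)"
      by (rule int) (use w in auto)
    then have i: "integrable square (\<lambda>(x, y). w x * of_bool (y \<in> ?T) * D (x, y))"
      by (simp add: case_prod_beta')
    have k: "(LINT y|M. w x * of_bool (y \<in> ?T) * D (x, y)) = w x * k x" for x
      unfolding k_def by (subst integral_mult_right_zero[symmetric]) (simp add: mult_ac)
    show "(LINT p|square. w (fst p) * of_bool (snd p \<in> ?T) * D p) = (LINT x|M. w x * k x)"
      using MM.integral_fst'[OF i] by (simp only: k case_prod_beta' fst_conv snd_conv prod.collapse)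
    show "integrable M (\<lambda>x. w x * k x)"
      using MM.integrable_fst'[OF i] by (simp only: k case_prod_beta' fst_conv snd_conv)
  qed
  have "(LINT p|square. f (fst p) * of_bool (snd p \<in> ?T) * D p) = (LINT x|M. f x * k x)"
    by (rule fst_eq[OF f])
  also have "\<dots> \<le> (LINT x|M. of_bool (k x \<ge> 0) * k x)"
    using fst_int[OF f] fst_int[of "\<lambda>x. of_bool (k x \<ge> 0)"] f(2)
    by (intro positive_part) auto
  also have "\<dots> = (LINT x|M. of_bool (x \<in> ?S) * k x)"
    by (intro Bochner_Integration.integral_cong) auto
  also have "\<dots> = (LINT p|square. of_bool (fst p \<in> ?S) * of_bool (snd p \<in> ?T) * D p)"
    by (rule fst_eq[of "\<lambda>x. of_bool (x \<in> ?S)", symmetric]) auto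
  also have "\<dots> \<le> \<eta>"
    using cut S T unfolding cut_bounded_def by (blast intro: abs_le_D1)
  finally show ?thesis using 1 by simp
qed

lemma cut_bounded_weights:
  assumes D: "D \<in> borel_measurable square" "\<And>p. p \<in> space square \<Longrightarrow> \<bar>D p\<bar> \<le> B"
    and cut: "cut_bounded \<eta> D"
    and f: "f \<in> borel_measurable M" "\<And>x. x \<in> space M \<Longrightarrow> f x \<in> {0..1}"
    and g: "g \<in> borel_measurable M" "\<And>x. x \<in> space M \<Longrightarrow> g x \<in> {0..1}"
  shows "\<bar>LINT p|square. f (fst p) * g (snd p) * D p\<bar> \<le> \<eta>"
proof -
  have "cut_bounded \<eta> (\<lambda>p. - D p)"
    using cut by (simp add: cut_bounded_def)
  from cut_bounded_weights_upper[OF _ _ this f g, of B] D cut_bounded_weights_upper[OF D cut f g]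
  show ?thesis by (simp add: abs_le_iff)
qed

lemma hom_product_measurable:
  assumes "E \<subseteq> I \<times> I" "\<And>e. e \<in> E \<Longrightarrow> w e \<in> borel_measurable square"
  shows "(\<lambda>z. \<Prod>e\<in>E. w e (z (fst e), z (snd e)) :: real) \<in> borel_measurable (power_space I)"
proof (rule borel_measurable_prod)
  fix e assume e: "e \<in> E"
  then have "(\<lambda>z. (z (fst e), z (snd e))) \<in> power_space I \<rightarrow>\<^sub>M square"
    using assms(1) by (intro measurable_Pair measurable_component_singleton) auto
  from measurable_compose[OF this assms(2)[OF e]]
  show "(\<lambda>z. w e (z (fst e), z (snd e))) \<in> borel_measurable (power_space I)" .
qed

lemma pair_in_square:
  assumes "z \<in> space (power_space I)" "e \<in> I \<times> I"
  shows "(z (fst e), z (snd e)) \<in> space square"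
  using assms by (auto simp: space_PiM space_pair_measure)

text \<open>With the vertices other than \<open>i\<close> and \<open>j\<close> fixed, no factor of the product depends on both
  \<open>z i\<close> and \<open>z j\<close>, so the product splits into a weight of \<open>z i\<close> and a weight of \<open>z j\<close>.\<close>

lemma edge_cut_bound:
  assumes I: "finite I" and E: "finite E" "\<And>e. e \<in> E \<Longrightarrow> e \<in> I \<times> I \<and> fst e < snd e"
    and ij: "i \<in> I" "j \<in> I" "i < j" "(i, j) \<notin> E"
    and v: "\<And>e. e \<in> E \<Longrightarrow> unit_valued (v e)"
    and D: "D \<in> borel_measurable square" "\<And>p. p \<in> space square \<Longrightarrow> \<bar>D p\<bar> \<le> B"
    and cut: "\<And>f g. f \<in> borel_measurable M \<Longrightarrow> (\<And>x. x \<in> space M \<Longrightarrow> f x \<in> {0..1}) \<Longrightarrow>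
      g \<in> borel_measurable M \<Longrightarrow> (\<And>x. x \<in> space M \<Longrightarrow> g x \<in> {0..1}) \<Longrightarrow>
      \<bar>LINT p|square. f (fst p) * g (snd p) * D p\<bar> \<le> \<eta>"
  shows "\<bar>LINT z|power_space I. D (z i, z j) * (\<Prod>e\<in>E. v e (z (fst e), z (snd e)))\<bar> \<le> \<eta>"
proof -
  let ?Q = "power_space (I - {i, j})"
  let ?G = "\<lambda>z. D (z i, z j) * (\<Prod>e\<in>E. v e (z (fst e), z (snd e)))"
  interpret P: prob_space "power_space I" by (rule prob_space_power_space)
  interpret Q: prob_space ?Q by (rule prob_space_power_space)
  have EI: "E \<subseteq> I \<times> I" using E(2) by blast
  have prod01: "(\<Prod>e\<in>E. v e (z (fst e), z (snd e))) \<in> {0..1}" if "z \<in> space (power_space I)" for z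
    using EI by (intro prod_unit_interval unit_valuedD(2)[OF v] pair_in_square[OF that]) auto
  have int: "integrable (power_space I) ?G"
  proof (rule P.integrable_bounded[where B = B])
    have "(\<lambda>z. (z i, z j)) \<in> power_space I \<rightarrow>\<^sub>M square"
      using ij by (intro measurable_Pair measurable_component_singleton) auto
    from measurable_compose[OF this D(1)]
    show "?G \<in> borel_measurable (power_space I)"
      by (intro borel_measurable_times hom_product_measurable[OF EI] unit_valuedD(1)[OF v])
    fix z assume z: "z \<in> space (power_space I)"
    have "\<bar>?G z\<bar> = \<bar>D (z i, z j)\<bar> * (\<Prod>e\<in>E. v e (z (fst e), z (snd e)))"
      using prod01[OF z] by (simp add: abs_mult)
    also have "\<dots> \<le> \<bar>D (z i, z j)\<bar>"
      using prod01[OF z] by (intro mult_left_le) auto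
    also have "\<dots> \<le> B"
      using pair_in_square[OF z, of "(i, j)"] ij by (intro D(2)) auto
    finally show "\<bar>?G z\<bar> \<le> B" .
  qed
  have inner: "\<bar>LINT p|square. ?G (z(i := fst p, j := snd p))\<bar> \<le> \<eta>" if z: "z \<in> space ?Q" for z
  proof -
    let ?Ei = "{e \<in> E. fst e = i \<or> snd e = i}" and ?Ej = "{e \<in> E. \<not> (fst e = i \<or> snd e = i)}"
    define f where "f x = (\<Prod>e\<in>?Ei. v e ((z(i := x)) (fst e), (z(i := x)) (snd e)))" for x
    define g where "g y = (\<Prod>e\<in>?Ej. v e ((z(j := y)) (fst e), (z(j := y)) (snd e)))" for y
    have not_ij: "e \<noteq> (i, j)" "e \<noteq> (j, i)" if "e \<in> E" for e
      using E(2)[OF that] ij that by auto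
    have zI: "z a \<in> space M" if "a \<in> I" "a \<noteq> i" "a \<noteq> j" for a
      using z that by (auto simp: space_PiM)
    have upd_meas: "(\<lambda>x. (z(b := x)) a) \<in> M \<rightarrow>\<^sub>M M" if "a \<in> I" "a = b \<or> a \<noteq> i \<and> a \<noteq> j" for a b
      using that zI by (cases "a = b") auto
    have Ei: "fst e \<in> I" "snd e \<in> I" "fst e = i \<or> fst e \<noteq> i \<and> fst e \<noteq> j"
      "snd e = i \<or> snd e \<noteq> i \<and> snd e \<noteq> j" if "e \<in> ?Ei" for e
      using that E(2)[of e] not_ij[of e] ij by (cases e; auto)+
    have Ej: "fst e \<in> I" "snd e \<in> I" "fst e = j \<or> fst e \<noteq> i \<and> fst e \<noteq> j"
      "snd e = j \<or> snd e \<noteq> i \<and> snd e \<noteq> j" if "e \<in> ?Ej" for e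
      using that E(2)[of e] by auto
    have f: "f \<in> borel_measurable M"
      unfolding f_def
      by (intro borel_measurable_prod measurable_compose[OF _ unit_valuedD(1)[OF v]] measurable_Pair
          upd_meas Ei) auto
    have g: "g \<in> borel_measurable M"
      unfolding g_def
      by (intro borel_measurable_prod measurable_compose[OF _ unit_valuedD(1)[OF v]] measurable_Pair
          upd_meas Ej) auto
    have f01: "f x \<in> {0..1}" if "x \<in> space M" for x
      unfolding f_def by (intro prod_unit_interval unit_valuedD(3)[OF v] measurable_space[OF upd_meas that] Ei) auto
    have g01: "g y \<in> {0..1}" if "y \<in> space M" for y
      unfolding g_def by (intro prod_unit_interval unit_valuedD(3)[OF v] measurable_space[OF upd_meas that] Ej) auto
    have G_split: "?G (z(i := x, j := y)) = f x * g y * D (x, y)" for x y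
    proof -
      let ?z = "z(i := x, j := y)"
      have "(\<Prod>e\<in>E. v e (?z (fst e), ?z (snd e)))
          = (\<Prod>e\<in>?Ei. v e (?z (fst e), ?z (snd e))) * (\<Prod>e\<in>?Ej. v e (?z (fst e), ?z (snd e)))"
        using E(1) by (subst prod.union_disjoint[symmetric]) (auto intro!: prod.cong)
      also have "(\<Prod>e\<in>?Ei. v e (?z (fst e), ?z (snd e))) = f x"
        unfolding f_def
      proof (intro prod.cong refl)
        fix e assume "e \<in> ?Ei"
        from Ei(3,4)[OF this] show "v e (?z (fst e), ?z (snd e))
            = v e ((z(i := x)) (fst e), (z(i := x)) (snd e))"
          using ij(3) by auto
      qed
      also have "(\<Prod>e\<in>?Ej. v e (?z (fst e), ?z (snd e))) = g y"
        unfolding g_def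
      proof (intro prod.cong refl)
        fix e assume "e \<in> ?Ej"
        then show "v e (?z (fst e), ?z (snd e))
            = v e ((z(j := y)) (fst e), (z(j := y)) (snd e))"
          by auto
      qed
      finally have prod_eq: "(\<Prod>e\<in>E. v e (?z (fst e), ?z (snd e))) = f x * g y" .
      have "?z i = x" "?z j = y"
        using ij(3) by auto
      then show ?thesis
        unfolding prod_eq by (simp only: mult_ac)
    qed
    show ?thesis
      using cut[OF f f01 g g01] unfolding G_split by simp
  qed
  have "\<bar>LINT z|power_space I. ?G z\<bar> = \<bar>LINT z|?Q. LINT p|square. ?G (z(i := fst p, j := snd p))\<bar>"
    using integral_root_pair(2)[OF I ij(1,2) _ int] ij(3) by simp
  also have "\<dots> \<le> (LINT z|?Q. \<bar>LINT p|square. ?G (z(i := fst p, j := snd p))\<bar>)"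
    by (rule integral_abs_bound)
  also have "\<dots> \<le> (LINT z|?Q. \<eta>)"
  proof (rule integral_mono')
    show "0 \<le> \<eta>"
      using cut[of "\<lambda>_. 0" "\<lambda>_. 0"] by simp
  qed (use inner in auto)
  also have "\<dots> = \<eta>" by (simp add: Q.prob_space)
  finally show ?thesis .
qed

lemma counting_lemma:
  fixes \<eta> :: real
  assumes I: "finite I" and E: "finite E" "\<And>e. e \<in> E \<Longrightarrow> e \<in> I \<times> I \<and> fst e < snd e"
    and w: "\<And>e. e \<in> E \<Longrightarrow> unit_valued (w e)" and u: "\<And>e. e \<in> E \<Longrightarrow> unit_valued (u e)"
    and cut: "\<And>e f g. e \<in> E \<Longrightarrow> f \<in> borel_measurable M \<Longrightarrow> (\<And>x. x \<in> space M \<Longrightarrow> f x \<in> {0..1}) \<Longrightarrow>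
      g \<in> borel_measurable M \<Longrightarrow> (\<And>x. x \<in> space M \<Longrightarrow> g x \<in> {0..1}) \<Longrightarrow>
      \<bar>LINT p|square. f (fst p) * g (snd p) * (w e p - u e p)\<bar> \<le> \<eta>"
  shows "\<bar>(LINT z|power_space I. (\<Prod>e\<in>E. w e (z (fst e), z (snd e))))
    - (LINT z|power_space I. (\<Prod>e\<in>E. u e (z (fst e), z (snd e))))\<bar> \<le> card E * \<eta>"
proof -
  interpret P: prob_space "power_space I" by (rule prob_space_power_space)
  have EI: "E \<subseteq> I \<times> I" using E(2) by blast
  have "\<bar>(LINT z|power_space I. (\<Prod>e\<in>E. (if e \<in> A then w e else u e) (z (fst e), z (snd e))))
    - (LINT z|power_space I. (\<Prod>e\<in>E. u e (z (fst e), z (snd e))))\<bar> \<le> card A * \<eta>" if "A \<subseteq> E" for A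
    using finite_subset[OF that E(1)] that
  proof (induction A rule: finite_induct)
    case empty
    then show ?case by simp
  next
    case (insert e0 A)
    let ?v = "\<lambda>A e. if e \<in> A then w e else u e"
    let ?\<Pi> = "\<lambda>A z. \<Prod>e\<in>E. ?v A e (z (fst e), z (snd e))"
    obtain i j where e0: "e0 = (i, j)" by (cases e0)
    have ij: "i \<in> I" "j \<in> I" "i < j" "e0 \<in> E"
      using insert.prems E(2)[of e0] e0 by auto
    have v: "unit_valued (?v A e)" if "e \<in> E" for e A
      using w u that by simp
    have int: "integrable (power_space I) (?\<Pi> A)" for A
    proof (rule P.integrable_bounded[where B = 1])
      show "?\<Pi> A \<in> borel_measurable (power_space I)"
        by (intro hom_product_measurable[OF EI] unit_valuedD(1)[OF v])
      fix z assume "z \<in> space (power_space I)"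
      then have "?\<Pi> A z \<in> {0..1}"
        using EI by (intro prod_unit_interval unit_valuedD(2)[OF v] pair_in_square) auto
      then show "\<bar>?\<Pi> A z\<bar> \<le> 1" by simp
    qed
    have "?\<Pi> (insert e0 A) z - ?\<Pi> A z
        = (w e0 (z i, z j) - u e0 (z i, z j)) * (\<Prod>e\<in>E - {e0}. ?v A e (z (fst e), z (snd e)))" for z
    proof -
      have remove: "?\<Pi> B z = ?v B e0 (z (fst e0), z (snd e0))
          * (\<Prod>e\<in>E - {e0}. ?v B e (z (fst e), z (snd e)))" for B
        using E(1) ij(4) by (rule prod.remove)
      have rest: "(\<Prod>e\<in>E - {e0}. ?v (insert e0 A) e (z (fst e), z (snd e)))
          = (\<Prod>e\<in>E - {e0}. ?v A e (z (fst e), z (snd e)))"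
        by (intro prod.cong) auto
      show ?thesis
        unfolding remove[of "insert e0 A"] remove[of A] rest
        using insert.hyps(2) by (simp add: e0 left_diff_distrib)
    qed
    then have "(LINT z|power_space I. ?\<Pi> (insert e0 A) z) - (LINT z|power_space I. ?\<Pi> A z)
        = (LINT z|power_space I. (w e0 (z i, z j) - u e0 (z i, z j))
            * (\<Prod>e\<in>E - {e0}. ?v A e (z (fst e), z (snd e))))"
      by (subst Bochner_Integration.integral_diff[symmetric, OF int int]) simp
    also have "\<bar>\<dots>\<bar> \<le> \<eta>"
    proof (rule edge_cut_bound[OF I, where D = "\<lambda>p. w e0 p - u e0 p" and B = 1])
      show "(\<lambda>p. w e0 p - u e0 p) \<in> borel_measurable square"
        by (intro borel_measurable_diff unit_valuedD(1) w u ij)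
      show "\<bar>w e0 p - u e0 p\<bar> \<le> 1" if "p \<in> space square" for p
        using unit_valuedD(2)[OF w[OF ij(4)] that] unit_valuedD(2)[OF u[OF ij(4)] that] by auto
    qed (use E ij e0 v cut in auto)
    finally have "\<bar>(LINT z|power_space I. ?\<Pi> (insert e0 A) z) - (LINT z|power_space I. ?\<Pi> A z)\<bar> \<le> \<eta>" .
    moreover have "card (insert e0 A) = Suc (card A)"
      using insert.hyps by simp
    ultimately show ?case
      using insert.IH insert.prems by (simp add: algebra_simps)
  qed
  from this[of E] show ?thesis by simp
qed

end

section \<open>The removal lemma\<close>

context prob_space
begin

definition hom_density :: "nat set \<Rightarrow> (nat \<times> nat) set \<Rightarrow> ('a \<times> 'a \<Rightarrow> real) \<Rightarrow> real" where
  "hom_density I E W = (LINT z|power_space I. (\<Prod>e\<in>E. W (z (fst e), z (snd e))))"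

lemma integral_fst_snd:
  fixes f :: "'a \<Rightarrow> real"
  assumes "f \<in> borel_measurable M" "\<And>x. x \<in> space M \<Longrightarrow> \<bar>f x\<bar> \<le> B"
  shows "(LINT p|square. f (fst p)) = (LINT x|M. f x)"
    and "(LINT p|square. f (snd p)) = (LINT x|M. f x)"
proof -
  interpret S: prob_space "square" by (rule prob_space_square)
  interpret MM: pair_prob_space M M ..
  note [measurable] = assms(1)
  have "integrable square (\<lambda>(x, y). f x)" "integrable square (\<lambda>(x, y). f y)"
    using assms by (intro S.integrable_bounded[where B = B]; auto simp: space_pair_measure)+
  from MM.integral_fst'[OF this(1)] MM.integral_snd[OF this(2)]
  show "(LINT p|square. f (fst p)) = (LINT x|M. f x)"
    "(LINT p|square. f (snd p)) = (LINT x|M. f x)"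
    by (simp_all add: prob_space case_prod_beta')
qed

lemma colour_class_measurable:
  assumes "colouring c n"
  shows "(\<lambda>x. of_bool (P (c x)) :: real) \<in> borel_measurable M"
  by (rule borel_measurable_finite_valued[where g = "\<lambda>i. of_bool (P i)"])
    (use assms in \<open>simp add: colouring_def\<close>)

definition class_measure :: "('a \<Rightarrow> nat) \<Rightarrow> nat \<Rightarrow> real" where
  "class_measure c i = (LINT x|M. of_bool (c x = i))"

definition deviation ::
  "('a \<times> 'a \<Rightarrow> real) \<Rightarrow> ('a \<Rightarrow> nat) \<Rightarrow> ('a \<Rightarrow> nat) \<Rightarrow> 'a \<times> 'a \<Rightarrow> real" where
  "deviation W c c' p = (block_average W c' p - block_average W c p)\<^sup>2"

definition bad_block ::
  "('a \<times> 'a \<Rightarrow> real) \<Rightarrow> ('a \<Rightarrow> nat) \<Rightarrow> ('a \<Rightarrow> nat) \<Rightarrow> real \<Rightarrow> real \<Rightarrow> real \<Rightarrow> nat \<times> nat \<Rightarrow> bool" where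
  "bad_block W c c' s \<beta> \<gamma> v \<longleftrightarrow> class_measure c (fst v) < s \<or> class_measure c (snd v) < s
    \<or> cell_mean square W (pair_colour c) v < \<beta>
    \<or> \<gamma> * (LINT p|square. 1 * of_bool (pair_colour c p = v))
      < (LINT p|square. deviation W c c' p * of_bool (pair_colour c p = v))"

lemma deviation:
  assumes "colouring c n" "colouring c' n'" "unit_valued W"
  shows "deviation W c c' \<in> borel_measurable square"
    and "p \<in> space square \<Longrightarrow> deviation W c c' p \<in> {0..1}"
proof -
  note u = unit_valuedD[OF unit_valued_block_average[OF assms(1,3)]]
  note u' = unit_valuedD[OF unit_valued_block_average[OF assms(2,3)]]
  show "deviation W c c' \<in> borel_measurable square"
    unfolding deviation_def[abs_def] using u(1) u'(1) by measurable
  assume "p \<in> space square"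
  then have "\<bar>block_average W c' p - block_average W c p\<bar> \<le> 1"
    using u(2)[of p] u'(2)[of p] by auto
  then show "deviation W c c' p \<in> {0..1}"
    by (simp add: deviation_def abs_square_le_1)
qed

lemma bad_blocks_light:
  assumes c: "colouring c n" and c': "colouring c' n'" and W: "unit_valued W"
    and pos: "\<beta> > 0" "\<gamma> > 0"
    and close: "(LINT p|square. deviation W c c' p) \<le> \<gamma> * \<beta>"
  shows "(LINT p|square. of_bool (bad_block W c c' (\<beta> / Suc n) \<beta> \<gamma> (pair_colour c p)) * W p) \<le> 4 * \<beta>"
proof -
  interpret S: prob_space "square" by (rule prob_space_square)
  let ?s = "\<beta> / Suc n"
  let ?small = "\<lambda>i. class_measure c i < ?s"
  let ?sparse = "\<lambda>v. cell_mean square W (pair_colour c) v < \<beta>"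
  let ?rough = "\<lambda>v. \<gamma> * (LINT p|square. 1 * of_bool (pair_colour c p = v))
      < (LINT p|square. deviation W c c' p * of_bool (pair_colour c p = v))"
  note Wd = unit_valuedD[OF W]
  note dev = deviation[OF c c' W]
  have pc_meas: "(\<lambda>p. of_bool (P (pair_colour c p)) :: real) \<in> borel_measurable square" for P
    by (rule borel_measurable_finite_valued[OF pair_colour(1)[OF c], of "\<lambda>v. of_bool (P v)"])
  have int: "integrable square (\<lambda>p. V p * of_bool (P (pair_colour c p)))"
    if "V \<in> borel_measurable square" "\<And>p. p \<in> space square \<Longrightarrow> V p \<in> {0..1}" for V :: "'a \<times> 'a \<Rightarrow> real" and P
  proof (rule S.integrable_bounded[where B = 1])
    show "(\<lambda>p. V p * of_bool (P (pair_colour c p))) \<in> borel_measurable square"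
      by (intro borel_measurable_times that pc_meas)
  qed (use that(2) in \<open>auto simp: abs_mult\<close>)
  have small: "(LINT x|M. of_bool (?small (c x))) \<le> \<beta>"
  proof -
    have "(LINT x|M. 1 * of_bool (?small (c x)) :: real)
        = (\<Sum>i<n. of_bool (?small i) * (LINT x|M. 1 * of_bool (c x = i)))"
      by (rule integral_times_finite_valued[where q = c and W = "\<lambda>_. 1" and g = "\<lambda>i. of_bool (?small i)"])
        (use c in \<open>auto simp: colouring_def intro: integrable_const\<close>)
    also have "\<dots> \<le> (\<Sum>i<n. ?s)"
      using pos by (intro sum_mono) (auto simp: class_measure_def)
    also have "\<dots> \<le> \<beta>"
      using pos by (simp add: field_simps)
    finally show ?thesis by simp
  qed
  have small_fst: "(LINT p|square. 1 * of_bool (?small (fst (pair_colour c p)))) \<le> \<beta>"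
    using small integral_fst_snd(1)[OF colour_class_measurable[OF c], of ?small 1]
    by (simp add: pair_colour_def)
  have small_snd: "(LINT p|square. 1 * of_bool (?small (snd (pair_colour c p)))) \<le> \<beta>"
    using small integral_fst_snd(2)[OF colour_class_measurable[OF c], of ?small 1]
    by (simp add: pair_colour_def)
  have sparse: "(LINT p|square. W p * of_bool (?sparse (pair_colour c p))) \<le> \<beta>"
  proof -
    have "(LINT p|square. W p * of_bool (?sparse (pair_colour c p)))
        = (LINT p|square. block_average W c p * of_bool (?sparse (pair_colour c p)))"
      by (rule integral_block_average[OF c W])
    also have "\<dots> \<le> (LINT p|square. \<beta>)"
      by (rule integral_mono') (use pos in \<open>auto simp: block_average_def\<close>)
    finally show ?thesis by (simp add: S.prob_space)
  qed
  have rough: "(LINT p|square. 1 * of_bool (?rough (pair_colour c p))) \<le> \<beta>"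
  proof -
    let ?Q = "{..<n} \<times> {..<n}"
    have "\<gamma> * (LINT p|square. 1 * of_bool (?rough (pair_colour c p)))
        = \<gamma> * (\<Sum>v\<in>?Q. of_bool (?rough v) * (LINT p|square. 1 * of_bool (pair_colour c p = v)))"
      by (subst S.integral_times_finite_valued[where Q = ?Q and q = "pair_colour c" and W = "\<lambda>_. 1"
            and g = "\<lambda>v. of_bool (?rough v)"])
        (use pair_colour[OF c] in \<open>auto intro: S.integrable_const\<close>)
    also have "\<dots> = (\<Sum>v\<in>?Q. of_bool (?rough v) * (\<gamma> * (LINT p|square. 1 * of_bool (pair_colour c p = v))))"
      by (simp only: sum_distrib_left mult.left_commute)
    also have "\<dots> \<le> (\<Sum>v\<in>?Q. of_bool (?rough v)
        * (LINT p|square. deviation W c c' p * of_bool (pair_colour c p = v)))"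
      by (intro sum_mono) auto
    also have "\<dots> = (LINT p|square. deviation W c c' p * of_bool (?rough (pair_colour c p)))"
      by (subst S.integral_times_finite_valued[where Q = ?Q and q = "pair_colour c"
            and g = "\<lambda>v. of_bool (?rough v)"])
        (use pair_colour[OF c] int[OF dev, of "\<lambda>_. True"] in auto)
    also have "\<dots> \<le> (LINT p|square. deviation W c c' p)"
      using int[OF dev, of "\<lambda>_. True"] dev(2) by (intro integral_mono int[OF dev]) auto
    also note close
    finally show ?thesis using pos by simp
  qed
  let ?one = "\<lambda>_. 1 :: real"
  let ?f1 = "\<lambda>p. 1 * of_bool (?small (fst (pair_colour c p))) :: real"
  let ?f2 = "\<lambda>p. 1 * of_bool (?small (snd (pair_colour c p))) :: real"
  let ?f3 = "\<lambda>p. W p * of_bool (?sparse (pair_colour c p))"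
  let ?f4 = "\<lambda>p. 1 * of_bool (?rough (pair_colour c p)) :: real"
  have i1: "integrable square ?f1" by (rule int[of ?one "\<lambda>v. ?small (fst v)"]) auto
  have i2: "integrable square ?f2" by (rule int[of ?one "\<lambda>v. ?small (snd v)"]) auto
  have i3: "integrable square ?f3" by (rule int[OF Wd(1,2)])
  have i4: "integrable square ?f4" by (rule int[of ?one ?rough]) auto
  have "(LINT p|square. of_bool (bad_block W c c' ?s \<beta> \<gamma> (pair_colour c p)) * W p)
      \<le> (LINT p|square. ?f1 p + ?f2 p + ?f3 p + ?f4 p)"
  proof (rule integral_mono')
    show "integrable square (\<lambda>p. ?f1 p + ?f2 p + ?f3 p + ?f4 p)"
      by (intro Bochner_Integration.integrable_add i1 i2 i3 i4)
    fix p assume "p \<in> space square"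
    with Wd(2)[of p] show "of_bool (bad_block W c c' ?s \<beta> \<gamma> (pair_colour c p)) * W p
        \<le> ?f1 p + ?f2 p + ?f3 p + ?f4 p" "0 \<le> ?f1 p + ?f2 p + ?f3 p + ?f4 p"
      unfolding bad_block_def by auto
  qed
  also have "\<dots> = (LINT p|square. ?f1 p) + (LINT p|square. ?f2 p)
      + (LINT p|square. ?f3 p) + (LINT p|square. ?f4 p)"
    by (simp only: Bochner_Integration.integral_add i1 i2 i3 i4 Bochner_Integration.integrable_add)
  finally show ?thesis
    using small_fst small_snd sparse rough by linarith
qed

lemma integral_colour_pattern:
  assumes I: "finite I" and c: "colouring c n" and X: "X \<subseteq> I"
  shows "(LINT z|power_space I. of_bool (\<forall>l\<in>X. c (z l) = \<kappa> l)) = (\<Prod>l\<in>X. class_measure c (\<kappa> l))"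
proof -
  interpret P: product_sigma_finite "\<lambda>_ :: nat. M" by unfold_locales
  let ?f = "\<lambda>l x. (if l \<in> X then of_bool (c x = \<kappa> l) else 1) :: real"
  have "(LINT z|power_space I. of_bool (\<forall>l\<in>X. c (z l) = \<kappa> l)) = (LINT z|power_space I. (\<Prod>l\<in>I. ?f l (z l)))"
  proof (intro Bochner_Integration.integral_cong refl)
    fix z
    show "of_bool (\<forall>l\<in>X. c (z l) = \<kappa> l) = (\<Prod>l\<in>I. ?f l (z l))"
    proof (cases "\<forall>l\<in>X. c (z l) = \<kappa> l")
      case False
      then obtain l where "l \<in> X" "c (z l) \<noteq> \<kappa> l" by blast
      then have "\<exists>l\<in>I. ?f l (z l) = 0" using X by auto
      then have "(\<Prod>l\<in>I. ?f l (z l)) = 0" using I by (simp add: prod_zero_iff)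
      then show ?thesis using False by simp
    qed (simp add: prod.neutral)
  qed
  also have "\<dots> = (\<Prod>l\<in>I. LINT x|M. ?f l x)"
  proof (rule P.product_integral_prod[OF I])
    fix l
    show "integrable M (?f l)"
      using colour_class_measurable[OF c, of "\<lambda>i. i = \<kappa> l"]
      by (intro integrable_bounded[where B = 1]) auto
  qed
  also have "\<dots> = (\<Prod>l\<in>I. if l \<in> X then class_measure c (\<kappa> l) else 1)"
    by (intro prod.cong) (auto simp: class_measure_def prob_space)
  also have "\<dots> = (\<Prod>l\<in>X. class_measure c (\<kappa> l))"
    using I X by (simp add: prod.If_cases Int_absorb1)
  finally show ?thesis .
qed

lemma good_pattern_count:
  fixes \<beta> \<gamma> \<eta> s :: real
  assumes I: "finite I" and E: "finite E" "\<And>e. e \<in> E \<Longrightarrow> e \<in> I \<times> I \<and> fst e < snd e"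
    and c: "colouring c n" and c': "colouring c' n'" and W: "unit_valued W"
    and pos: "0 < \<beta>" "\<beta> \<le> 1" "0 < \<gamma>" "8 * card E * \<gamma> \<le> \<beta>\<^sup>2" "0 < s" "s \<le> 1"
    and cut: "cut_bounded \<eta> (\<lambda>p. W p - block_average W c' p)"
    and z0: "z0 \<in> space (power_space I)"
    and good: "\<And>e. e \<in> E \<Longrightarrow> \<not> bad_block W c c' s \<beta> \<gamma> (pair_colour c (z0 (fst e), z0 (snd e)))"
  shows "(\<beta> / 2) ^ card E * s ^ card I / 2 - card E * \<eta> \<le> hom_density I E W"
proof -
  interpret S: prob_space "square" by (rule prob_space_square)
  interpret P: prob_space "power_space I" by (rule prob_space_power_space)
  let ?U = "block_average W c'" and ?V = "block_average W c" and ?D = "deviation W c c'"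
  define \<kappa> where "\<kappa> l = c (z0 l)" for l
  define X where "X = fst ` E \<union> snd ` E"
  define K where "K z = (of_bool (\<forall>l\<in>X. c (z l) = \<kappa> l) :: real)" for z :: "nat \<Rightarrow> 'a"
  define block where "block e p = (of_bool (pair_colour c p = (\<kappa> (fst e), \<kappa> (snd e))) :: real)"
    for e :: "nat \<times> nat" and p :: "'a \<times> 'a"
  have EI: "E \<subseteq> I \<times> I" using E(2) by blast
  have XI: "X \<subseteq> I" using EI by (auto simp: X_def)
  note Wd = unit_valuedD[OF W]
  have U: "unit_valued ?U" by (rule unit_valued_block_average[OF c' W])
  note dev = deviation[OF c c' W]
  have block_meas: "block e \<in> borel_measurable square" for e
    unfolding block_def[abs_def]
    by (rule borel_measurable_finite_valued[OF pair_colour(1)[OF c], of "\<lambda>v. of_bool (v = _)"])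
  have block_unit: "unit_valued (\<lambda>p. block e p * Y p)" if "unit_valued Y" for Y e
  proof -
    have "block e p \<in> {0..1}" for p by (simp add: block_def)
    then show ?thesis
      using that block_meas[of e] unfolding unit_valued_def by (auto intro!: mult_le_one)
  qed
  have K_meas: "K \<in> borel_measurable (power_space I)"
  proof -
    have "(\<lambda>z. c (z l)) \<in> power_space I \<rightarrow>\<^sub>M count_space UNIV" if "l \<in> X" for l
      using that XI c by (intro measurable_compose[OF measurable_component_singleton]) (auto simp: colouring_def)
    moreover have "finite X" using E(1) by (simp add: X_def)
    ultimately show ?thesis unfolding K_def by measurable
  qed
  have K01: "K z \<in> {0..1}" for z by (simp add: K_def)
  have K_int: "integrable (power_space I) K"
    using K_meas K01 by (intro P.integrable_bounded[where B = 1]) auto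
  have pair_meas: "(\<lambda>z. (z (fst e), z (snd e))) \<in> power_space I \<rightarrow>\<^sub>M square" if "e \<in> E" for e
    using that EI by (intro measurable_Pair measurable_component_singleton) auto
  have prod_K: "(\<Prod>e\<in>E. block e (z (fst e), z (snd e))) = K z" for z
    unfolding K_def
  proof (cases "\<forall>l\<in>X. c (z l) = \<kappa> l")
    case False
    then have "\<exists>e\<in>E. block e (z (fst e), z (snd e)) = 0"
      by (auto simp: X_def block_def pair_colour_def)
    then have "(\<Prod>e\<in>E. block e (z (fst e), z (snd e))) = 0"
      using E(1) by (simp add: prod_zero_iff)
    then show "(\<Prod>e\<in>E. block e (z (fst e), z (snd e))) = of_bool (\<forall>l\<in>X. c (z l) = \<kappa> l)"
      by (simp only: False of_bool_eq)
  qed (auto simp: X_def block_def pair_colour_def intro!: prod.neutral)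
  define G where "G e z = K z * ?D (z (fst e), z (snd e))" for e and z :: "nat \<Rightarrow> 'a"
  have G_int: "integrable (power_space I) (G e)" if e: "e \<in> E" for e
  proof (rule P.integrable_bounded[where B = 1])
    show "G e \<in> borel_measurable (power_space I)"
      unfolding G_def by (intro borel_measurable_times K_meas measurable_compose[OF pair_meas[OF e] dev(1)])
    fix z assume "z \<in> space (power_space I)"
    then have "?D (z (fst e), z (snd e)) \<in> {0..1}"
      using e EI by (intro dev(2) pair_in_square) auto
    then show "\<bar>G e z\<bar> \<le> 1"
      using K01[of z] by (auto simp: G_def abs_mult intro: mult_le_one)
  qed
  have rough_edge: "(LINT z|power_space I. G e z) \<le> \<gamma> * (LINT z|power_space I. K z)" if e: "e \<in> E" for e
  proof -
    obtain i j where ij: "e = (i, j)" by (cases e)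
    have ijI: "i \<in> I" "j \<in> I" "i \<noteq> j" "i \<in> X" "j \<in> X"
      using e E(2)[OF e] ij by (auto simp: X_def image_iff intro: bexI[OF _ e])
    let ?Q = "power_space (I - {i, j})"
    interpret Q: prob_space ?Q by (rule prob_space_power_space)
    interpret SQ: pair_prob_space "square" ?Q ..
    let ?K0 = "\<lambda>z. of_bool (\<forall>l\<in>X - {i, j}. c (z l) = \<kappa> l) :: real"
    have K_split: "K (z(i := fst p, j := snd p)) = ?K0 z * block e p" for z p
      using ijI by (auto simp: K_def block_def pair_colour_def ij)
    have G_split: "G e (z(i := fst p, j := snd p)) = ?K0 z * (?D p * block e p)" for z p
      unfolding G_def K_split using ijI(3) by (simp add: ij)
    have e_good: "(LINT p|square. ?D p * block e p) \<le> \<gamma> * (LINT p|square. block e p)"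
      using good[OF e] unfolding bad_block_def by (simp add: pair_colour_def block_def \<kappa>_def ij not_less)
    have "integrable (square \<Otimes>\<^sub>M ?Q) (\<lambda>(p, z). G e (z(i := fst p, j := snd p)))"
      "integrable (square \<Otimes>\<^sub>M ?Q) (\<lambda>(p, z). K (z(i := fst p, j := snd p)))"
      using integrable_root_pair[OF I ijI(1-3) G_int[OF e]] integrable_root_pair[OF I ijI(1-3) K_int]
      by (simp_all add: case_prod_beta')
    note ints = this[THEN SQ.integrable_snd]
    have "(LINT z|power_space I. G e z)
        = (LINT z|?Q. LINT p|square. G e (z(i := fst p, j := snd p)))"
      by (rule integral_root_pair(2)[OF I ijI(1-3) G_int[OF e]])
    also have "\<dots> \<le> (LINT z|?Q. \<gamma> * (LINT p|square. K (z(i := fst p, j := snd p))))"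
    proof (rule integral_mono)
      show "(LINT p|square. G e (z(i := fst p, j := snd p)))
          \<le> \<gamma> * (LINT p|square. K (z(i := fst p, j := snd p)))" for z
        unfolding G_split K_split using e_good by simp
    qed (use ints in \<open>auto intro: integrable_mult_right\<close>)
    also have "\<dots> = \<gamma> * (LINT z|power_space I. K z)"
      using integral_root_pair(2)[OF I ijI(1-3) K_int] by simp
    finally show ?thesis .
  qed
  have V_good: "?V p \<ge> \<beta>" if "e \<in> E" "block e p = 1" for e p
  proof -
    have pc: "pair_colour c p = pair_colour c (z0 (fst e), z0 (snd e))"
      using that(2) by (simp add: block_def pair_colour_def \<kappa>_def split: if_splits)
    show ?thesis
      using good[OF that(1)] unfolding bad_block_def block_average_def pc by simp
  qed
  have pointwise: "(\<beta> / 2) ^ card E * (K z - (\<Sum>e\<in>E. 4 / \<beta>\<^sup>2 * G e z))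
      \<le> (\<Prod>e\<in>E. block e (z (fst e), z (snd e)) * ?U (z (fst e), z (snd e)))"
    if z: "z \<in> space (power_space I)" for z
  proof -
    have U01: "?U (z (fst e), z (snd e)) \<in> {0..1}" if "e \<in> E" for e
      using that EI by (intro unit_valuedD(2)[OF U] pair_in_square[OF z]) auto
    have nonneg: "0 \<le> (\<Prod>e\<in>E. ?U (z (fst e), z (snd e)))"
      using U01 by (intro prod_nonneg) auto
    have G0: "0 \<le> 4 / \<beta>\<^sup>2 * G e z" for e
      by (simp add: G_def K_def deviation_def)
    have eq: "(\<Prod>e\<in>E. block e (z (fst e), z (snd e)) * ?U (z (fst e), z (snd e)))
        = K z * (\<Prod>e\<in>E. ?U (z (fst e), z (snd e)))"
      by (simp add: prod.distrib prod_K)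
    show ?thesis
    proof (cases "K z = 0")
      case True
      then show ?thesis unfolding eq by (simp add: G_def)
    next
      case False
      then have K1: "K z = 1" by (auto simp: K_def)
      have block1: "block e (z (fst e), z (snd e)) = 1" if "e \<in> E" for e
        using K1 that by (auto simp: K_def X_def block_def pair_colour_def split: if_splits)
      show ?thesis
      proof (cases "\<forall>e\<in>E. ?U (z (fst e), z (snd e)) \<ge> \<beta> / 2")
        case True
        have "(\<beta> / 2) ^ card E * (K z - (\<Sum>e\<in>E. 4 / \<beta>\<^sup>2 * G e z)) \<le> (\<beta> / 2) ^ card E * 1"
          using pos(1) K1 sum_nonneg[of E "\<lambda>e. 4 / \<beta>\<^sup>2 * G e z"] G0 by (intro mult_left_mono) auto
        also have "\<dots> = (\<Prod>e\<in>E. \<beta> / 2)" by simp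
        also have "\<dots> \<le> (\<Prod>e\<in>E. ?U (z (fst e), z (snd e)))"
          using True pos(1) by (intro prod_mono) auto
        finally show ?thesis unfolding eq K1 by simp
      next
        case False
        then obtain e where e: "e \<in> E" "?U (z (fst e), z (snd e)) < \<beta> / 2" by auto
        have "\<beta> / 2 \<le> ?V (z (fst e), z (snd e)) - ?U (z (fst e), z (snd e))"
          using V_good[OF e(1) block1[OF e(1)]] e(2) by linarith
        then have "(\<beta> / 2)\<^sup>2 \<le> (?V (z (fst e), z (snd e)) - ?U (z (fst e), z (snd e)))\<^sup>2"
          using pos(1) by (intro power_mono) auto
        then have "1 \<le> 4 / \<beta>\<^sup>2 * G e z"
          using pos(1) by (simp add: G_def K1 deviation_def power2_commute field_simps)
        also have "\<dots> \<le> (\<Sum>e\<in>E. 4 / \<beta>\<^sup>2 * G e z)"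
          using E(1) e(1) G0 by (intro member_le_sum) auto
        finally have "(\<beta> / 2) ^ card E * (K z - (\<Sum>e\<in>E. 4 / \<beta>\<^sup>2 * G e z)) \<le> 0"
          using pos(1) K1 by (intro mult_nonneg_nonpos) auto
        also have "0 \<le> K z * (\<Prod>e\<in>E. ?U (z (fst e), z (snd e)))"
          using nonneg K1 by simp
        finally show ?thesis unfolding eq .
      qed
    qed
  qed
  have U_int: "integrable (power_space I) (\<lambda>z. \<Prod>e\<in>E. block e (z (fst e), z (snd e)) * Y (z (fst e), z (snd e)))"
    if "unit_valued Y" for Y
  proof (rule P.integrable_bounded[where B = 1])
    note b = block_unit[OF that]
    show "(\<lambda>z. \<Prod>e\<in>E. block e (z (fst e), z (snd e)) * Y (z (fst e), z (snd e))) \<in> borel_measurable (power_space I)"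
      by (rule hom_product_measurable[OF EI unit_valuedD(1)[OF b]])
    fix z assume z: "z \<in> space (power_space I)"
    have "(\<Prod>e\<in>E. block e (z (fst e), z (snd e)) * Y (z (fst e), z (snd e))) \<in> {0..1}"
      using EI by (intro prod_unit_interval unit_valuedD(2)[OF b] pair_in_square[OF z]) auto
    then show "\<bar>\<Prod>e\<in>E. block e (z (fst e), z (snd e)) * Y (z (fst e), z (snd e))\<bar> \<le> 1" by simp
  qed
  have K_lower: "s ^ card I \<le> (LINT z|power_space I. K z)"
  proof -
    have "s ^ card I \<le> s ^ card X"
      using pos(5,6) card_mono[OF I XI] by (intro power_decreasing) auto
    also have "\<dots> = (\<Prod>l\<in>X. s)" by simp
    also have "\<dots> \<le> (\<Prod>l\<in>X. class_measure c (\<kappa> l))"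
    proof (intro prod_mono conjI)
      fix l assume "l \<in> X"
      then obtain e where e: "e \<in> E" "l = fst e \<or> l = snd e" by (auto simp: X_def)
      then show "s \<le> class_measure c (\<kappa> l)"
        using good[OF e(1)] by (auto simp: bad_block_def pair_colour_def \<kappa>_def)
    qed (use pos in simp)
    also have "\<dots> = (LINT z|power_space I. K z)"
      unfolding K_def by (rule integral_colour_pattern[OF I c XI, symmetric])
    finally show ?thesis .
  qed
  have "8 * card E * \<gamma> / \<beta>\<^sup>2 \<le> 1"
    using pos by (simp add: divide_le_eq_1)
  then have half: "1 / 2 \<le> 1 - card E * (4 / \<beta>\<^sup>2 * \<gamma>)"
    by simp
  have "(\<beta> / 2) ^ card E * s ^ card I / 2 \<le> (\<beta> / 2) ^ card E * (LINT z|power_space I. K z) * (1 / 2)"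
    using K_lower pos by simp
  also have "\<dots> \<le> (\<beta> / 2) ^ card E * (LINT z|power_space I. K z) * (1 - card E * (4 / \<beta>\<^sup>2 * \<gamma>))"
    using pos order_trans[OF _ K_lower, of 0]
    by (intro mult_left_mono[OF half] mult_nonneg_nonneg) simp_all
  also have "\<dots> = (\<beta> / 2) ^ card E * ((LINT z|power_space I. K z)
      - (\<Sum>e\<in>E. 4 / \<beta>\<^sup>2 * (\<gamma> * (LINT z|power_space I. K z))))"
    by (simp add: algebra_simps)
  also have "\<dots> \<le> (\<beta> / 2) ^ card E * ((LINT z|power_space I. K z)
      - (\<Sum>e\<in>E. 4 / \<beta>\<^sup>2 * (LINT z|power_space I. G e z)))"
    using pos(1) by (intro mult_left_mono diff_left_mono sum_mono rough_edge) auto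
  also have "\<dots> = (LINT z|power_space I. (\<beta> / 2) ^ card E * (K z - (\<Sum>e\<in>E. 4 / \<beta>\<^sup>2 * G e z)))"
    using K_int G_int by simp
  also have "\<dots> \<le> (LINT z|power_space I. (\<Prod>e\<in>E. block e (z (fst e), z (snd e)) * ?U (z (fst e), z (snd e))))"
    using K_int G_int by (intro integral_mono U_int[OF U] pointwise) auto
  also have "\<dots> \<le> (LINT z|power_space I. (\<Prod>e\<in>E. block e (z (fst e), z (snd e)) * W (z (fst e), z (snd e)))) + card E * \<eta>"
  proof -
    have "\<bar>(LINT z|power_space I. (\<Prod>e\<in>E. (\<lambda>p. block e p * W p) (z (fst e), z (snd e))))
      - (LINT z|power_space I. (\<Prod>e\<in>E. (\<lambda>p. block e p * ?U p) (z (fst e), z (snd e))))\<bar> \<le> card E * \<eta>"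
    proof (rule counting_lemma[OF I E, where w = "\<lambda>e p. block e p * W p" and u = "\<lambda>e p. block e p * ?U p"])
      fix e f g
      assume f: "f \<in> borel_measurable M" "\<And>x. x \<in> space M \<Longrightarrow> f x \<in> {0..1::real}"
        and g: "g \<in> borel_measurable M" "\<And>x. x \<in> space M \<Longrightarrow> g x \<in> {0..1::real}"
      let ?f = "\<lambda>x. f x * of_bool (c x = \<kappa> (fst e))" and ?g = "\<lambda>x. g x * of_bool (c x = \<kappa> (snd e))"
      have "\<bar>LINT p|square. ?f (fst p) * ?g (snd p) * (W p - ?U p)\<bar> \<le> \<eta>"
      proof (rule cut_bounded_weights[OF _ _ cut, where B = 1])
        show "(\<lambda>p. W p - ?U p) \<in> borel_measurable square"
          by (intro borel_measurable_diff Wd(1) unit_valuedD(1)[OF U])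
        show "\<bar>W p - ?U p\<bar> \<le> 1" if "p \<in> space square" for p
          using Wd(2)[OF that] unit_valuedD(2)[OF U that] by auto
        show "?f \<in> borel_measurable M" "?g \<in> borel_measurable M"
          by (intro borel_measurable_times f g colour_class_measurable[OF c, of "\<lambda>i. i = _"])+
      qed (use f g in auto)
      moreover have "?f (fst p) * ?g (snd p) * (W p - ?U p)
          = f (fst p) * g (snd p) * (block e p * W p - block e p * ?U p)" for p
        by (simp add: block_def pair_colour_def algebra_simps)
      ultimately show "\<bar>LINT p|square. f (fst p) * g (snd p) * (block e p * W p - block e p * ?U p)\<bar> \<le> \<eta>"
        by simp
    qed (use block_unit[OF W] block_unit[OF U] in auto)
    then show ?thesis by simp
  qed
  also have "(LINT z|power_space I. (\<Prod>e\<in>E. block e (z (fst e), z (snd e)) * W (z (fst e), z (snd e)))) \<le> hom_density I E W"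
    unfolding hom_density_def
  proof (rule integral_mono[OF U_int[OF W]])
    have W01: "W (z (fst e), z (snd e)) \<in> {0..1}" if "z \<in> space (power_space I)" "e \<in> E" for z e
      using that EI by (intro Wd(2) pair_in_square) auto
    show "integrable (power_space I) (\<lambda>z. \<Prod>e\<in>E. W (z (fst e), z (snd e)))"
    proof (rule P.integrable_bounded[where B = 1])
      show "(\<lambda>z. \<Prod>e\<in>E. W (z (fst e), z (snd e))) \<in> borel_measurable (power_space I)"
        by (rule hom_product_measurable[OF EI Wd(1)])
      show "\<bar>\<Prod>e\<in>E. W (z (fst e), z (snd e))\<bar> \<le> 1" if "z \<in> space (power_space I)" for z
        using prod_unit_interval[of E "\<lambda>e. W (z (fst e), z (snd e))"] W01[OF that] by auto
    qed
    fix z assume z: "z \<in> space (power_space I)"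
    show "(\<Prod>e\<in>E. block e (z (fst e), z (snd e)) * W (z (fst e), z (snd e)))
        \<le> (\<Prod>e\<in>E. W (z (fst e), z (snd e)))"
      using W01[OF z] by (intro prod_mono) (auto simp: block_def)
  qed
  finally show ?thesis by simp
qed

lemma graphon_removal_lemma:
  assumes I: "finite I" and E: "finite E" "\<And>e. e \<in> E \<Longrightarrow> e \<in> I \<times> I \<and> fst e < snd e"
    and \<epsilon>: "\<epsilon> > 0"
  obtains \<delta> where "\<delta> > 0" "\<And>W. unit_valued W \<Longrightarrow> hom_density I E W < \<delta> \<Longrightarrow>
    \<exists>A\<in>sets square. (LINT p|square. of_bool (p \<in> A) * W p) \<le> \<epsilon>
      \<and> (\<forall>z\<in>space (power_space I). \<exists>e\<in>E. (z (fst e), z (snd e)) \<in> A)"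
proof -
  define \<beta> where "\<beta> = min 1 (\<epsilon> / 4)"
  have \<beta>: "0 < \<beta>" "\<beta> \<le> 1" "4 * \<beta> \<le> \<epsilon>" using \<epsilon> by (auto simp: \<beta>_def)
  define \<gamma> where "\<gamma> = \<beta>\<^sup>2 / (8 * Suc (card E))"
  have \<gamma>: "0 < \<gamma>" "8 * card E * \<gamma> \<le> \<beta>\<^sup>2"
    using \<beta>(1) by (auto simp: \<gamma>_def field_simps)
  define X where "X n = (\<beta> / 2) ^ card E * (\<beta> / Suc n) ^ card I / 2" for n :: nat
  have X_pos: "X n > 0" for n using \<beta>(1) by (simp add: X_def)
  define \<phi> where "\<phi> n = X n / (2 * Suc (card E))" for n
  have \<phi>_pos: "\<phi> n > 0" for n using X_pos[of n] by (simp add: \<phi>_def)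
  have \<phi>_small: "X n / 2 \<le> X n - card E * \<phi> n" for n
    using X_pos[of n] by (simp add: \<phi>_def field_simps)
  have \<alpha>: "\<gamma> * \<beta> > 0" using \<gamma> \<beta> by simp
  show ?thesis
  proof (rule strong_regularity[of \<phi>, OF \<phi>_pos \<alpha>])
    fix N :: "nat \<Rightarrow> nat" and L :: nat
    assume reg: "\<And>W. unit_valued W \<Longrightarrow> \<exists>m<L. \<exists>c c' h n'. colouring c (N m) \<and> colouring c' n'
      \<and> (\<forall>x\<in>space M. c x = h (c' x))
      \<and> (LINT p|square. (block_average W c' p - block_average W c p)\<^sup>2) \<le> \<gamma> * \<beta>
      \<and> cut_bounded (\<phi> (N m)) (\<lambda>p. W p - block_average W c' p)"
    define \<delta> where "\<delta> = Min (insert 1 ((\<lambda>m. X (N m) / 2) ` {..<L}))"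
    show ?thesis
    proof (rule that[of \<delta>])
      show "\<delta> > 0" unfolding \<delta>_def using X_pos by (subst Min_gr_iff) auto
      fix W assume W: "unit_valued W" and small: "hom_density I E W < \<delta>"
      obtain m c c' n' where m: "m < L" and c: "colouring c (N m)" and c': "colouring c' n'"
        and close: "(LINT p|square. deviation W c c' p) \<le> \<gamma> * \<beta>"
        and cut: "cut_bounded (\<phi> (N m)) (\<lambda>p. W p - block_average W c' p)"
        using reg[OF W] unfolding deviation_def by blast
      let ?bad = "bad_block W c c' (\<beta> / Suc (N m)) \<beta> \<gamma>"
      let ?A = "{p \<in> space square. ?bad (pair_colour c p)}"
      have "pair_colour c -` {v. ?bad v} \<inter> space square \<in> sets square"
        by (rule measurable_sets[OF pair_colour(1)[OF c]]) simp
      also have "pair_colour c -` {v. ?bad v} \<inter> space square = ?A" by auto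
      finally have A: "?A \<in> sets square" .
      have "(LINT p|square. of_bool (p \<in> ?A) * W p)
          = (LINT p|square. of_bool (?bad (pair_colour c p)) * W p)"
        by (intro Bochner_Integration.integral_cong) auto
      also have "\<dots> \<le> \<epsilon>"
        using bad_blocks_light[OF c c' W \<beta>(1) \<gamma>(1) close] \<beta>(3) by linarith
      finally have light: "(LINT p|square. of_bool (p \<in> ?A) * W p) \<le> \<epsilon>" .
      have "\<exists>e\<in>E. (z (fst e), z (snd e)) \<in> ?A" if z: "z \<in> space (power_space I)" for z
      proof (rule ccontr)
        assume *: "\<not> (\<exists>e\<in>E. (z (fst e), z (snd e)) \<in> ?A)"
        have good: "\<not> ?bad (pair_colour c (z (fst e), z (snd e)))" if "e \<in> E" for e
          using * that pair_in_square[OF z, of e] E(2)[OF that] by auto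
        have "X (N m) - card E * \<phi> (N m) \<le> hom_density I E W"
          unfolding X_def
          by (rule good_pattern_count[OF I E c c' W \<beta>(1,2) \<gamma> _ _ cut z good])
            (use \<beta>(1,2) in \<open>auto simp: field_simps\<close>)
        moreover have "\<delta> \<le> X (N m) / 2"
          unfolding \<delta>_def using m by (intro Min_le) auto
        ultimately show False
          using small \<phi>_small[of "N m"] by linarith
      qed
      then show "\<exists>A\<in>sets square. (LINT p|square. of_bool (p \<in> A) * W p) \<le> \<epsilon>
        \<and> (\<forall>z\<in>space (power_space I). \<exists>e\<in>E. (z (fst e), z (snd e)) \<in> A)"
        using A light by blast
    qed
  qed
qed

end

section \<open>The velocity of the removal rule\<close>

locale removal_process = prob_space M for M :: "'a measure" +
  fixes k :: nat and F :: edge_set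
  assumes F: "F \<in> labelled_graphs k"
begin

definition edges :: "(nat \<times> nat) set" where
  "edges = {(i, j). 1 \<le> i \<and> i < j \<and> j \<le> k \<and> {i, j} \<in> F}"

definition arcs :: "(nat \<times> nat) set" where
  "arcs = {(a, b). a \<in> {1..k} \<and> b \<in> {1..k} \<and> a \<noteq> b \<and> {a, b} \<in> F}"

definition rooted_density :: "('a \<times> 'a \<Rightarrow> real) \<Rightarrow> nat \<times> nat \<Rightarrow> 'a \<times> 'a \<Rightarrow> real" where
  "rooted_density U ab p = (LINT z|power_space ({1..k} - {fst ab, snd ab}).
     (let v = z(fst ab := fst p, snd ab := snd p) in \<Prod>e\<in>edges. U (v (fst e), v (snd e))))"

definition drift :: "('a \<times> 'a \<Rightarrow> real) \<Rightarrow> 'a \<times> 'a \<Rightarrow> real" where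
  "drift U p = (\<Sum>ab\<in>arcs. rooted_density U ab p)"

lemma edgeD: "e \<in> edges \<Longrightarrow> e \<in> {1..k} \<times> {1..k} \<and> fst e < snd e"
  by (auto simp: edges_def)

lemma finite_edges: "finite edges"
  by (rule finite_subset[of _ "{1..k} \<times> {1..k}"]) (auto simp: edges_def)

lemma finite_arcs: "finite arcs"
  by (rule finite_subset[of _ "{1..k} \<times> {1..k}"]) (auto simp: arcs_def)

lemma arcD: "ab \<in> arcs \<Longrightarrow> fst ab \<in> {1..k} \<and> snd ab \<in> {1..k} \<and> fst ab \<noteq> snd ab"
  by (auto simp: arcs_def)

lemma finite_labelled_graphs: "finite (labelled_graphs k)"
proof -
  have "labelled_graphs k \<subseteq> Pow (Pow {1..k})" by (auto simp: labelled_graphs_def)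
  then show ?thesis by (rule finite_subset) simp
qed

lemma sum_extensions:
  fixes w :: "nat \<times> nat \<Rightarrow> real"
  defines "T \<equiv> {(i, j). 1 \<le> i \<and> i < j \<and> j \<le> k}"
  shows "(\<Sum>G\<in>{G \<in> labelled_graphs k. F \<subseteq> G}. \<Prod>e\<in>T. if {fst e, snd e} \<in> G then w e else 1 - w e)
    = (\<Prod>e\<in>edges. w e)"
proof -
  have T: "finite T"
    by (rule finite_subset[of _ "{1..k} \<times> {1..k}"]) (auto simp: T_def)
  have edges_T: "edges \<subseteq> T" by (auto simp: edges_def T_def)
  let ?A = "T - edges"
  let ?\<epsilon> = "\<lambda>e :: nat \<times> nat. {fst e, snd e}"
  have \<epsilon>_inj: "e = e'" if "e \<in> T" "e' \<in> T" "?\<epsilon> e = ?\<epsilon> e'" for e e'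
    using that by (auto simp: T_def doubleton_eq_iff)
  have \<epsilon>_edges: "?\<epsilon> e \<in> F \<longleftrightarrow> e \<in> edges" if "e \<in> T" for e
    using that by (auto simp: T_def edges_def)
  have \<epsilon>_surj: "\<exists>e\<in>T. s = ?\<epsilon> e" if s: "s \<subseteq> {1..k}" "card s = 2" for s
  proof -
    obtain a b where ab: "s = {a, b}" "a \<noteq> b"
      using s(2) by (auto simp: card_2_iff)
    then have "a \<in> {1..k}" "b \<in> {1..k}" using s(1) by auto
    then have "(min a b, max a b) \<in> T" "s = ?\<epsilon> (min a b, max a b)"
      using ab by (auto simp: T_def min_def max_def)
    then show ?thesis by blast
  qed
  have "(\<Prod>e\<in>edges. w e) = (\<Prod>e\<in>edges. w e) * (\<Prod>e\<in>?A. w e + (1 - w e))"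
    by simp
  also have "\<dots> = (\<Sum>X\<in>Pow ?A. (\<Prod>e\<in>edges. w e) * ((\<Prod>e\<in>X. w e) * (\<Prod>e\<in>?A - X. 1 - w e)))"
    using T by (subst prod_add) (auto simp: sum_distrib_left)
  also have "\<dots> = (\<Sum>X\<in>Pow ?A. \<Prod>e\<in>T. if e \<in> edges \<union> X then w e else 1 - w e)"
  proof (intro sum.cong refl)
    fix X assume "X \<in> Pow ?A"
    then have X: "X \<subseteq> T" "X \<inter> edges = {}" by auto
    then have fin: "finite X" "finite edges" using T edges_T finite_subset by blast+
    have "(\<Prod>e\<in>T. if e \<in> edges \<union> X then w e else 1 - w e)
        = (\<Prod>e\<in>T \<inter> (edges \<union> X). w e) * (\<Prod>e\<in>T \<inter> - (edges \<union> X). 1 - w e)"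
      by (subst prod.If_cases[OF T]) (simp only: Collect_mem_eq)
    also have "T \<inter> (edges \<union> X) = edges \<union> X" using X edges_T by auto
    also have "T \<inter> - (edges \<union> X) = ?A - X" by auto
    also have "(\<Prod>e\<in>edges \<union> X. w e) = (\<Prod>e\<in>edges. w e) * (\<Prod>e\<in>X. w e)"
      using X fin by (intro prod.union_disjoint) auto
    finally show "(\<Prod>e\<in>edges. w e) * ((\<Prod>e\<in>X. w e) * (\<Prod>e\<in>?A - X. 1 - w e))
        = (\<Prod>e\<in>T. if e \<in> edges \<union> X then w e else 1 - w e)" by (simp add: mult.assoc)
  qed
  also have "\<dots> = (\<Sum>G\<in>{G \<in> labelled_graphs k. F \<subseteq> G}. \<Prod>e\<in>T. if ?\<epsilon> e \<in> G then w e else 1 - w e)"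
  proof (rule sum.reindex_bij_witness[where j = "\<lambda>X. ?\<epsilon> ` (edges \<union> X)" and i = "\<lambda>G. {e \<in> ?A. ?\<epsilon> e \<in> G}"])
    fix X assume "X \<in> Pow ?A"
    then have X: "X \<subseteq> T" "X \<inter> edges = {}" by auto
    have mem: "?\<epsilon> e \<in> ?\<epsilon> ` (edges \<union> X) \<longleftrightarrow> e \<in> edges \<union> X" if "e \<in> T" for e
    proof
      assume "?\<epsilon> e \<in> ?\<epsilon> ` (edges \<union> X)"
      then obtain e' where "e' \<in> edges \<union> X" "?\<epsilon> e = ?\<epsilon> e'" by blast
      with \<epsilon>_inj[OF that, of e'] X edges_T show "e \<in> edges \<union> X" by blast
    qed blast
    show "{e \<in> ?A. ?\<epsilon> e \<in> ?\<epsilon> ` (edges \<union> X)} = X"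
      using mem X by blast
    have "?\<epsilon> e \<subseteq> {1..k} \<and> card (?\<epsilon> e) = 2" if "e \<in> T" for e
      using that by (auto simp: T_def)
    then have "?\<epsilon> ` (edges \<union> X) \<in> labelled_graphs k"
      using X edges_T unfolding labelled_graphs_def by blast
    moreover have "F \<subseteq> ?\<epsilon> ` (edges \<union> X)"
    proof
      fix s assume s: "s \<in> F"
      then have "s \<subseteq> {1..k}" "card s = 2" using F by (auto simp: labelled_graphs_def)
      from \<epsilon>_surj[OF this] obtain e where "e \<in> T" "s = ?\<epsilon> e" by blast
      then show "s \<in> ?\<epsilon> ` (edges \<union> X)" using s \<epsilon>_edges by blast
    qed
    ultimately show "?\<epsilon> ` (edges \<union> X) \<in> {G \<in> labelled_graphs k. F \<subseteq> G}" by blast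
    show "(\<Prod>e\<in>T. if ?\<epsilon> e \<in> ?\<epsilon> ` (edges \<union> X) then w e else 1 - w e)
        = (\<Prod>e\<in>T. if e \<in> edges \<union> X then w e else 1 - w e)"
      using mem by (intro prod.cong) auto
  next
    fix G assume G: "G \<in> {G \<in> labelled_graphs k. F \<subseteq> G}"
    show "{e \<in> ?A. ?\<epsilon> e \<in> G} \<in> Pow ?A" by blast
    show "?\<epsilon> ` (edges \<union> {e \<in> ?A. ?\<epsilon> e \<in> G}) = G"
    proof (intro equalityI subsetI)
      fix s assume "s \<in> ?\<epsilon> ` (edges \<union> {e \<in> ?A. ?\<epsilon> e \<in> G})"
      then show "s \<in> G" using G \<epsilon>_edges edges_T by blast
    next
      fix s assume s: "s \<in> G"
      then have "s \<subseteq> {1..k}" "card s = 2" using G by (auto simp: labelled_graphs_def)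
      from \<epsilon>_surj[OF this] obtain e where "e \<in> T" "s = ?\<epsilon> e" by blast
      then show "s \<in> ?\<epsilon> ` (edges \<union> {e \<in> ?A. ?\<epsilon> e \<in> G})" using s by blast
    qed
  qed
  finally show ?thesis by simp
qed

lemma root_vector_in_space:
  assumes "ab \<in> arcs" "z \<in> space (power_space ({1..k} - {fst ab, snd ab}))" "p \<in> space square" "i \<in> {1..k}"
  shows "(z(fst ab := fst p, snd ab := snd p)) i \<in> space M"
proof -
  have "z i \<in> space M" if "i \<noteq> fst ab" "i \<noteq> snd ab"
    using that assms(2,4) by (auto simp: space_PiM PiE_iff)
  moreover have "fst p \<in> space M" "snd p \<in> space M"
    using assms(3) by (auto simp: space_pair_measure)
  ultimately show ?thesis by (cases "i = snd ab"; cases "i = fst ab") auto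
qed

lemma hom_product_rooted_measurable:
  assumes ab: "ab \<in> arcs" and p: "p \<in> space square"
    and w: "\<And>e. e \<in> E \<Longrightarrow> w e \<in> borel_measurable square" and E: "E \<subseteq> {1..k} \<times> {1..k}"
  shows "(\<lambda>z. let v = z(fst ab := fst p, snd ab := snd p) in \<Prod>e\<in>E. w e (v (fst e), v (snd e)) :: real)
    \<in> borel_measurable (power_space ({1..k} - {fst ab, snd ab}))"
proof -
  have "(\<lambda>z. (p, z)) \<in> power_space ({1..k} - {fst ab, snd ab})
      \<rightarrow>\<^sub>M square \<Otimes>\<^sub>M power_space ({1..k} - {fst ab, snd ab})"
    using p by (intro measurable_Pair) auto
  from measurable_compose[OF this measurable_root_pair] arcD[OF ab]
  have "(\<lambda>z. z(fst ab := fst p, snd ab := snd p))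
      \<in> power_space ({1..k} - {fst ab, snd ab}) \<rightarrow>\<^sub>M power_space {1..k}"
    by (simp add: case_prod_beta')
  from measurable_compose[OF this hom_product_measurable[OF E w]]
  show ?thesis unfolding Let_def .
qed

lemma velocity_removal_rule:
  assumes U: "U \<in> borel_measurable square" "\<And>p. p \<in> space square \<Longrightarrow> \<bar>U p\<bar> \<le> B"
    and p: "p \<in> space square"
  shows "velocity M k (removal_rule F) U p = - drift U p"
proof -
  obtain x y where xy: "p = (x, y)" by (cases p)
  let ?T = "{(i, j). 1 \<le> i \<and> i < j \<and> j \<le> k}"
  let ?P = "{(a, b). a \<in> {1..k} \<and> b \<in> {1..k} \<and> a \<noteq> b}"
  let ?t = "\<lambda>G ab. t_ind_rooted M k G (fst ab) (snd ab) U x y"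
  have finP: "finite ?P"
    by (rule finite_subset[of _ "{1..k} \<times> {1..k}"]) auto
  have finT: "finite ?T"
    by (rule finite_subset[of _ "{1..k} \<times> {1..k}"]) auto
  define H where "H G = (if F \<subseteq> G then G - F else G)" for G
  have H: "H G \<in> labelled_graphs k" if "G \<in> labelled_graphs k" for G
    using that by (auto simp: H_def labelled_graphs_def)
  have "velocity M k (removal_rule F) U p = (\<Sum>G\<in>labelled_graphs k. \<Sum>H'\<in>labelled_graphs k.
      if H' = H G then (\<Sum>ab\<in>?P. ?t G ab * (of_bool ({fst ab, snd ab} \<in> H G - G) - of_bool ({fst ab, snd ab} \<in> G - H G))) else 0)"
    unfolding velocity_def xy prod.case
    by (intro sum.cong refl) (auto simp: removal_rule_def H_def case_prod_beta')
  also have "\<dots> = (\<Sum>G\<in>labelled_graphs k.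
      (\<Sum>ab\<in>?P. ?t G ab * (of_bool ({fst ab, snd ab} \<in> H G - G) - of_bool ({fst ab, snd ab} \<in> G - H G))))"
    using finite_labelled_graphs H by (intro sum.cong refl) simp
  also have "\<dots> = (\<Sum>G\<in>labelled_graphs k. if F \<subseteq> G then - (\<Sum>ab\<in>arcs. ?t G ab) else 0)"
  proof (intro sum.cong refl)
    fix G
    have "(\<Sum>ab\<in>?P. ?t G ab * (of_bool ({fst ab, snd ab} \<in> H G - G) - of_bool ({fst ab, snd ab} \<in> G - H G)))
        = (\<Sum>ab\<in>?P. if ab \<in> arcs then (if F \<subseteq> G then - ?t G ab else 0) else 0)"
      by (intro sum.cong refl) (auto simp: H_def arcs_def)
    also have "\<dots> = (\<Sum>ab\<in>?P \<inter> arcs. (if F \<subseteq> G then - ?t G ab else 0))"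
      using finP by (rule sum.inter_restrict[symmetric])
    also have "?P \<inter> arcs = arcs" by (auto simp: arcs_def)
    finally show "(\<Sum>ab\<in>?P. ?t G ab * (of_bool ({fst ab, snd ab} \<in> H G - G) - of_bool ({fst ab, snd ab} \<in> G - H G)))
        = (if F \<subseteq> G then - (\<Sum>ab\<in>arcs. ?t G ab) else 0)"
      by (simp add: sum_negf)
  qed
  also have "\<dots> = (\<Sum>G\<in>{G \<in> labelled_graphs k. F \<subseteq> G}. - (\<Sum>ab\<in>arcs. ?t G ab))"
    using finite_labelled_graphs by (rule sum.inter_filter[symmetric])
  also have "\<dots> = - (\<Sum>ab\<in>arcs. \<Sum>G\<in>{G \<in> labelled_graphs k. F \<subseteq> G}. ?t G ab)"
    by (subst sum.swap) (simp add: sum_negf)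
  also have "(\<Sum>ab\<in>arcs. \<Sum>G\<in>{G \<in> labelled_graphs k. F \<subseteq> G}. ?t G ab) = drift U p"
    unfolding drift_def
  proof (intro sum.cong refl)
    fix ab assume ab: "ab \<in> arcs"
    let ?Q = "power_space ({1..k} - {fst ab, snd ab})"
    interpret Q: prob_space ?Q by (rule prob_space_power_space)
    let ?v = "\<lambda>z. z(fst ab := x, snd ab := y)"
    let ?f = "\<lambda>G z. let v = ?v z in \<Prod>e\<in>?T. if {fst e, snd e} \<in> G then U (v (fst e), v (snd e)) else 1 - U (v (fst e), v (snd e))"
    have int: "integrable ?Q (?f G)" for G
    proof (rule Q.integrable_bounded[where B = "\<Prod>e\<in>?T. 1 + B"])
      have "(\<lambda>z. let v = z(fst ab := fst p, snd ab := snd p) in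
          \<Prod>e\<in>?T. (\<lambda>q. if {fst e, snd e} \<in> G then U q else 1 - U q) (v (fst e), v (snd e))) \<in> borel_measurable ?Q"
        by (rule hom_product_rooted_measurable[OF ab p]) (use U(1) in auto)
      then show "?f G \<in> borel_measurable ?Q" by (simp add: xy)
      fix z assume z: "z \<in> space ?Q"
      have "\<bar>U (?v z (fst e), ?v z (snd e))\<bar> \<le> B" if "e \<in> ?T" for e
        using that root_vector_in_space[OF ab z p, of "fst e"] root_vector_in_space[OF ab z p, of "snd e"]
        by (intro U(2)) (auto simp: space_pair_measure xy)
      then show "\<bar>?f G z\<bar> \<le> (\<Prod>e\<in>?T. 1 + B)"
        unfolding Let_def abs_prod by (intro prod_mono) (fastforce simp: abs_le_iff)
    qed
    have "(\<Sum>G\<in>{G \<in> labelled_graphs k. F \<subseteq> G}. ?t G ab)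
        = (\<Sum>G\<in>{G \<in> labelled_graphs k. F \<subseteq> G}. LINT z|?Q. ?f G z)"
      unfolding t_ind_rooted_def case_prod_beta' ..
    also have "\<dots> = (LINT z|?Q. (\<Sum>G\<in>{G \<in> labelled_graphs k. F \<subseteq> G}. ?f G z))"
      using int by (intro Bochner_Integration.integral_sum[symmetric])
    also have "\<dots> = rooted_density U ab p"
      unfolding rooted_density_def Let_def xy fst_conv snd_conv sum_extensions ..
    finally show "(\<Sum>G\<in>{G \<in> labelled_graphs k. F \<subseteq> G}. ?t G ab) = rooted_density U ab p" .
  qed
  finally show ?thesis .
qed

abbreviation (input) rooted_product ::
  "('a \<times> 'a \<Rightarrow> real) \<Rightarrow> nat \<times> nat \<Rightarrow> 'a \<times> 'a \<Rightarrow> (nat \<Rightarrow> 'a) \<Rightarrow> real" where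
  "rooted_product U ab p z \<equiv>
     (let v = z(fst ab := fst p, snd ab := snd p) in \<Prod>e\<in>edges. U (v (fst e), v (snd e)))"

abbreviation (input) root_complement :: "nat \<times> nat \<Rightarrow> (nat \<Rightarrow> 'a) measure" where
  "root_complement ab \<equiv> power_space ({1..k} - {fst ab, snd ab})"

lemma edges_subset: "edges \<subseteq> {1..k} \<times> {1..k}"
  using edgeD by blast

lemma rooted_pair_in_square:
  assumes "ab \<in> arcs" "z \<in> space (root_complement ab)" "p \<in> space square" "e \<in> edges"
  shows "((z(fst ab := fst p, snd ab := snd p)) (fst e), (z(fst ab := fst p, snd ab := snd p)) (snd e))
    \<in> space square"
  using root_vector_in_space[OF assms(1-3), of "fst e"] root_vector_in_space[OF assms(1-3), of "snd e"]
    edgeD[OF assms(4)] by (auto simp: space_pair_measure)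

lemma rooted_product_measurable:
  assumes "ab \<in> arcs" "p \<in> space square" "U \<in> borel_measurable square"
  shows "rooted_product U ab p \<in> borel_measurable (root_complement ab)"
  using hom_product_rooted_measurable[OF assms(1,2), of edges "\<lambda>_. U"] assms(3) edges_subset by auto

lemma rooted_product_unit:
  assumes "ab \<in> arcs" "p \<in> space square" "unit_valued U" "z \<in> space (root_complement ab)"
  shows "rooted_product U ab p z \<in> {0..1}"
  unfolding Let_def
  by (intro prod_unit_interval unit_valuedD(2)[OF assms(3)] rooted_pair_in_square[OF assms(1,4,2)])

lemma integrable_rooted_product:
  assumes "ab \<in> arcs" "p \<in> space square" "unit_valued U"
  shows "integrable (root_complement ab) (rooted_product U ab p)"
proof -
  interpret Q: prob_space "root_complement ab" by (rule prob_space_power_space)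
  show ?thesis
  proof (rule Q.integrable_bounded[where B = 1])
    show "rooted_product U ab p \<in> borel_measurable (root_complement ab)"
      by (rule rooted_product_measurable[OF assms(1,2) unit_valuedD(1)[OF assms(3)]])
    show "\<bar>rooted_product U ab p z\<bar> \<le> 1" if "z \<in> space (root_complement ab)" for z
      using rooted_product_unit[OF assms that] by simp
  qed
qed

lemma drift_measurable_parametric:
  assumes U: "U \<in> borel_measurable (N \<Otimes>\<^sub>M square)"
  shows "(\<lambda>w. drift (\<lambda>q. U (fst w, q)) (snd w)) \<in> borel_measurable (N \<Otimes>\<^sub>M square)"
  unfolding drift_def rooted_density_def
proof (rule borel_measurable_sum)
  fix ab assume ab: "ab \<in> arcs"
  let ?Q = "root_complement ab"
  interpret Q: prob_space ?Q by (rule prob_space_power_space)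
  let ?v = "\<lambda>wz. (snd wz)(fst ab := fst (snd (fst wz)), snd ab := snd (snd (fst wz)))"
  have "(\<lambda>wz. (snd (fst wz), snd wz)) \<in> (N \<Otimes>\<^sub>M square) \<Otimes>\<^sub>M ?Q \<rightarrow>\<^sub>M square \<Otimes>\<^sub>M ?Q"
    by measurable
  from measurable_compose[OF this measurable_root_pair] arcD[OF ab]
  have v: "?v \<in> (N \<Otimes>\<^sub>M square) \<Otimes>\<^sub>M ?Q \<rightarrow>\<^sub>M power_space {1..k}"
    by (simp add: case_prod_beta')
  have "(\<lambda>wz. \<Prod>e\<in>edges. U (fst (fst wz), (?v wz (fst e), ?v wz (snd e))))
      \<in> borel_measurable ((N \<Otimes>\<^sub>M square) \<Otimes>\<^sub>M ?Q)"
  proof (rule borel_measurable_prod)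
    fix e assume e: "e \<in> edges"
    have "(\<lambda>wz. ?v wz i) \<in> (N \<Otimes>\<^sub>M square) \<Otimes>\<^sub>M ?Q \<rightarrow>\<^sub>M M" if "i \<in> {1..k}" for i
      by (rule measurable_compose[OF v measurable_component_singleton[OF that]])
    with edgeD[OF e]
    have "(\<lambda>wz. (fst (fst wz), (?v wz (fst e), ?v wz (snd e))))
        \<in> (N \<Otimes>\<^sub>M square) \<Otimes>\<^sub>M ?Q \<rightarrow>\<^sub>M N \<Otimes>\<^sub>M square"
      by (intro measurable_Pair) (auto simp: mem_Times_iff)
    from measurable_compose[OF this U]
    show "(\<lambda>wz. U (fst (fst wz), (?v wz (fst e), ?v wz (snd e))))
        \<in> borel_measurable ((N \<Otimes>\<^sub>M square) \<Otimes>\<^sub>M ?Q)" .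
  qed
  then show "(\<lambda>w. LINT z|?Q. rooted_product (\<lambda>q. U (fst w, q)) ab (snd w) z)
      \<in> borel_measurable (N \<Otimes>\<^sub>M square)"
    unfolding Let_def by (intro Q.borel_measurable_lebesgue_integral) (simp add: case_prod_beta')
qed

lemma drift_measurable:
  assumes "U \<in> borel_measurable square"
  shows "drift U \<in> borel_measurable square"
proof -
  have "(\<lambda>w. U (snd w)) \<in> borel_measurable (count_space {()} \<Otimes>\<^sub>M square)"
    by (rule measurable_compose[OF measurable_snd assms])
  from drift_measurable_parametric[OF this]
  have "(\<lambda>w. drift U (snd w)) \<in> borel_measurable (count_space {()} \<Otimes>\<^sub>M square)" by simp
  moreover have "(\<lambda>p. ((), p)) \<in> square \<rightarrow>\<^sub>M count_space {()} \<Otimes>\<^sub>M square"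
    by (intro measurable_Pair) auto
  ultimately have "(\<lambda>p. drift U (snd ((), p))) \<in> borel_measurable square"
    by (rule measurable_compose[rotated])
  then show ?thesis by simp
qed

lemma drift_bounds:
  assumes "unit_valued U" "p \<in> space square"
  shows "0 \<le> drift U p" "drift U p \<le> card arcs"
proof -
  have "rooted_density U ab p \<in> {0..1}" if ab: "ab \<in> arcs" for ab
  proof -
    interpret Q: prob_space "root_complement ab" by (rule prob_space_power_space)
    show ?thesis unfolding rooted_density_def
      by (rule Q.integral_in_unit_interval[OF rooted_product_measurable[OF ab assms(2) unit_valuedD(1)[OF assms(1)]]
          rooted_product_unit[OF ab assms(2,1)]])
  qed
  then show "0 \<le> drift U p" "drift U p \<le> card arcs"
    unfolding drift_def by (auto intro!: sum_nonneg sum_bounded_above[of _ _ 1, simplified])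
qed

lemma drift_lipschitz:
  fixes d :: real
  assumes U: "unit_valued U" and U': "unit_valued U'" and p: "p \<in> space square"
    and d: "\<And>q. q \<in> space square \<Longrightarrow> \<bar>U q - U' q\<bar> \<le> d"
  shows "\<bar>drift U p - drift U' p\<bar> \<le> card arcs * (card edges * d)"
proof -
  have "\<bar>rooted_density U ab p - rooted_density U' ab p\<bar> \<le> card edges * d" if ab: "ab \<in> arcs" for ab
  proof -
    interpret Q: prob_space "root_complement ab" by (rule prob_space_power_space)
    have pointwise: "\<bar>rooted_product U ab p z - rooted_product U' ab p z\<bar> \<le> card edges * d"
      if z: "z \<in> space (root_complement ab)" for z
    proof -
      note sq = rooted_pair_in_square[OF ab z p]
      let ?q = "\<lambda>e. ((z(fst ab := fst p, snd ab := snd p)) (fst e), (z(fst ab := fst p, snd ab := snd p)) (snd e))"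
      have "\<bar>(\<Prod>e\<in>edges. U (?q e)) - (\<Prod>e\<in>edges. U' (?q e))\<bar> \<le> (\<Sum>e\<in>edges. \<bar>U (?q e) - U' (?q e)\<bar>)"
        unfolding real_norm_def[symmetric]
      proof (rule norm_prod_diff)
        fix e assume e: "e \<in> edges"
        have "U (?q e) \<in> {0..1}" "U' (?q e) \<in> {0..1}"
          by (rule unit_valuedD(2)[OF U sq[OF e]], rule unit_valuedD(2)[OF U' sq[OF e]])
        then show "norm (U (?q e)) \<le> 1" "norm (U' (?q e)) \<le> 1"
          unfolding real_norm_def atLeastAtMost_iff abs_le_iff by linarith+
      qed
      also have "\<dots> \<le> card edges * d"
        by (rule sum_bounded_above[OF d[OF sq]])
      finally show ?thesis
        unfolding Let_def .
    qed
    have diff: "rooted_density U ab p - rooted_density U' ab p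
        = (LINT z|root_complement ab. rooted_product U ab p z - rooted_product U' ab p z)"
      unfolding rooted_density_def
      by (rule Bochner_Integration.integral_diff[OF integrable_rooted_product[OF ab p U]
          integrable_rooted_product[OF ab p U'], symmetric])
    have "\<bar>rooted_density U ab p - rooted_density U' ab p\<bar>
        \<le> (LINT z|root_complement ab. \<bar>rooted_product U ab p z - rooted_product U' ab p z\<bar>)"
      unfolding diff by (rule integral_abs_bound)
    also have "\<dots> \<le> card edges * d"
    proof (rule Q.integral_le_const)
      show "integrable (root_complement ab) (\<lambda>z. \<bar>rooted_product U ab p z - rooted_product U' ab p z\<bar>)"
        by (intro integrable_abs Bochner_Integration.integrable_diff integrable_rooted_product ab p U U')
      show "AE z in root_complement ab. \<bar>rooted_product U ab p z - rooted_product U' ab p z\<bar> \<le> card edges * d"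
        by (rule AE_I2) (rule pointwise)
    qed
    finally show ?thesis .
  qed
  note each = this
  have "\<bar>drift U p - drift U' p\<bar> = \<bar>\<Sum>ab\<in>arcs. rooted_density U ab p - rooted_density U' ab p\<bar>"
    unfolding drift_def by (simp add: sum_subtractf)
  also have "\<dots> \<le> (\<Sum>ab\<in>arcs. \<bar>rooted_density U ab p - rooted_density U' ab p\<bar>)"
    by (rule sum_abs)
  also have "\<dots> \<le> card arcs * (card edges * d)"
    by (rule sum_bounded_above[OF each])
  finally show ?thesis .
qed

lemma drift_tendsto:
  assumes U: "\<And>n. unit_valued (U n)" and V: "unit_valued V" and p: "p \<in> space square"
    and lim: "\<And>q. q \<in> space square \<Longrightarrow> (\<lambda>n. U n q) \<longlonglongrightarrow> V q"
  shows "(\<lambda>n. drift (U n) p) \<longlonglongrightarrow> drift V p"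
  unfolding drift_def
proof (rule tendsto_sum)
  fix ab assume ab: "ab \<in> arcs"
  interpret Q: prob_space "root_complement ab" by (rule prob_space_power_space)
  show "(\<lambda>n. rooted_density (U n) ab p) \<longlonglongrightarrow> rooted_density V ab p"
    unfolding rooted_density_def
  proof (rule integral_dominated_convergence[where w = "\<lambda>_. 1"])
    show "rooted_product V ab p \<in> borel_measurable (root_complement ab)"
      by (rule rooted_product_measurable[OF ab p unit_valuedD(1)[OF V]])
    show "rooted_product (U n) ab p \<in> borel_measurable (root_complement ab)" for n
      by (rule rooted_product_measurable[OF ab p unit_valuedD(1)[OF U]])
    show "AE z in root_complement ab. (\<lambda>n. rooted_product (U n) ab p z) \<longlonglongrightarrow> rooted_product V ab p z"
      unfolding Let_def by (intro AE_I2 tendsto_prod lim rooted_pair_in_square[OF ab _ p])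
    show "AE z in root_complement ab. norm (rooted_product (U n) ab p z) \<le> 1" for n
      using rooted_product_unit[OF ab p U[of n]] by (intro AE_I2) auto
    show "integrable (root_complement ab) (\<lambda>_. 1 :: real)"
      by (rule Q.integrable_const)
  qed
qed

lemma drift_swap: "drift U (y, x) = drift U (x, y)"
proof -
  have *: "rooted_density U (b, a) (y, x) = rooted_density U (a, b) (x, y)" if "a \<noteq> b" for a b
    using that by (simp add: rooted_density_def insert_commute fun_upd_twist)
  show ?thesis unfolding drift_def
    by (rule sum.reindex_bij_witness[where i = prod.swap and j = prod.swap])
      (auto simp: arcs_def insert_commute *)
qed

text \<open>The pair \<open>{a, b}\<close> is itself an edge of \<open>F\<close>, so the rooted density contains the factor \<open>U p\<close>.\<close>

lemma drift_eq_0: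
  assumes sym: "\<And>x y. x \<in> space M \<Longrightarrow> y \<in> space M \<Longrightarrow> U (x, y) = U (y, x)"
    and p: "p \<in> space square" and zero: "U p = 0"
  shows "drift U p = 0"
  unfolding drift_def
proof (rule sum.neutral, rule ballI)
  fix ab assume ab: "ab \<in> arcs"
  obtain a b where ab_eq: "ab = (a, b)" by (cases ab)
  obtain x y where p_eq: "p = (x, y)" by (cases p)
  have xy: "x \<in> space M" "y \<in> space M" using p by (auto simp: p_eq space_pair_measure)
  have ne: "a \<noteq> b" using ab by (simp add: ab_eq arcs_def)
  have "rooted_product U ab p z = 0" for z
  proof (cases "a < b")
    case True
    then have "(a, b) \<in> edges" using ab by (auto simp: ab_eq arcs_def edges_def)
    moreover have "U ((z(a := x, b := y)) a, (z(a := x, b := y)) b) = 0" using ne zero p_eq by simp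
    ultimately show ?thesis
      unfolding Let_def using finite_edges by (intro prod_zero bexI[of _ "(a, b)"]) (auto simp: ab_eq p_eq)
  next
    case False
    then have "(b, a) \<in> edges" using ab by (auto simp: ab_eq arcs_def edges_def insert_commute)
    moreover have "U ((z(a := x, b := y)) b, (z(a := x, b := y)) a) = 0" using ne zero p_eq sym[OF xy] by simp
    ultimately show ?thesis
      unfolding Let_def using finite_edges by (intro prod_zero bexI[of _ "(b, a)"]) (auto simp: ab_eq p_eq)
  qed
  then show "rooted_density U ab p = 0" unfolding rooted_density_def by simp
qed

lemma drift_duality:
  assumes U: "U \<in> borel_measurable square" "\<And>p. p \<in> space square \<Longrightarrow> \<bar>U p\<bar> \<le> B"
    and f: "f \<in> borel_measurable square" "\<And>p. p \<in> space square \<Longrightarrow> \<bar>f p\<bar> \<le> C"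
  shows "(LINT p|square. f p * drift U p) = (\<Sum>ab\<in>arcs. LINT z|power_space {1..k}.
      f (z (fst ab), z (snd ab)) * (\<Prod>e\<in>edges. U (z (fst e), z (snd e))))"
    and "integrable square (\<lambda>p. f p * drift U p)"
    and "ab \<in> arcs \<Longrightarrow> integrable (power_space {1..k})
      (\<lambda>z. f (z (fst ab), z (snd ab)) * (\<Prod>e\<in>edges. U (z (fst e), z (snd e))))"
proof -
  interpret P: prob_space "power_space {1..k}" by (rule prob_space_power_space)
  interpret S: prob_space "square" by (rule prob_space_square)
  let ?G = "\<lambda>ab z. f (z (fst ab), z (snd ab)) * (\<Prod>e\<in>edges. U (z (fst e), z (snd e)))"
  obtain z0 where "z0 \<in> space square" using S.not_empty by blast
  then have BC: "0 \<le> B" "0 \<le> C" using U(2)[of z0] f(2)[of z0] by linarith+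
  have int: "integrable (power_space {1..k}) (?G ab)" if ab: "ab \<in> arcs" for ab
  proof (rule P.integrable_bounded[where B = "C * B ^ card edges"])
    have "(\<lambda>z. (z (fst ab), z (snd ab))) \<in> power_space {1..k} \<rightarrow>\<^sub>M square"
      using arcD[OF ab] by (intro measurable_Pair measurable_component_singleton) auto
    from measurable_compose[OF this f(1)]
    show "?G ab \<in> borel_measurable (power_space {1..k})"
      by (intro borel_measurable_times hom_product_measurable[OF edges_subset] U(1))
    fix z assume z: "z \<in> space (power_space {1..k})"
    have "\<bar>\<Prod>e\<in>edges. U (z (fst e), z (snd e))\<bar> \<le> (\<Prod>e\<in>edges. B)"
      unfolding abs_prod using edges_subset
      by (intro prod_mono conjI U(2) pair_in_square[OF z]) auto
    moreover have "\<bar>f (z (fst ab), z (snd ab))\<bar> \<le> C"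
      using arcD[OF ab] by (intro f(2) pair_in_square[OF z]) (auto simp: mem_Times_iff)
    ultimately show "\<bar>?G ab z\<bar> \<le> C * B ^ card edges"
      unfolding abs_mult using BC by (intro mult_mono) auto
  qed
  then show "ab \<in> arcs \<Longrightarrow> integrable (power_space {1..k}) (?G ab)" .
  have each: "integrable square (\<lambda>p. f p * rooted_density U ab p)
      \<and> (LINT p|square. f p * rooted_density U ab p) = (LINT z|power_space {1..k}. ?G ab z)"
    if ab: "ab \<in> arcs" for ab
  proof -
    let ?Q = "root_complement ab"
    interpret Q: prob_space ?Q by (rule prob_space_power_space)
    interpret SQ: pair_prob_space "square" ?Q ..
    note r = arcD[OF ab]
    have G: "?G ab (z(fst ab := fst p, snd ab := snd p)) = f p * rooted_product U ab p z" for z p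
      using r by (simp add: Let_def)
    have inner: "(LINT z|?Q. ?G ab (z(fst ab := fst p, snd ab := snd p))) = f p * rooted_density U ab p" for p
      unfolding G rooted_density_def by simp
    have "integrable (square \<Otimes>\<^sub>M ?Q) (\<lambda>(p, z). ?G ab (z(fst ab := fst p, snd ab := snd p)))"
      using integrable_root_pair[OF _ _ _ _ int[OF ab], of "fst ab" "snd ab"] r by (simp add: case_prod_beta')
    from SQ.integrable_fst'[OF this]
    have "integrable square (\<lambda>p. f p * rooted_density U ab p)"
      by (simp only: inner case_prod_conv)
    moreover have "(LINT p|square. f p * rooted_density U ab p) = (LINT z|power_space {1..k}. ?G ab z)"
      using integral_root_pair(1)[OF _ _ _ _ int[OF ab], of "fst ab" "snd ab"] r by (simp only: inner) simp
    ultimately show ?thesis by blast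
  qed
  have eq: "f p * drift U p = (\<Sum>ab\<in>arcs. f p * rooted_density U ab p)" for p
    by (simp add: drift_def sum_distrib_left)
  show "integrable square (\<lambda>p. f p * drift U p)"
    unfolding eq using each by (intro Bochner_Integration.integrable_sum) blast
  show "(LINT p|square. f p * drift U p) = (\<Sum>ab\<in>arcs. LINT z|power_space {1..k}. ?G ab z)"
    unfolding eq using each by (subst Bochner_Integration.integral_sum) auto
qed

end

section \<open>Existence of trajectories\<close>

context removal_process
begin

definition clamp_unit :: "real \<Rightarrow> real" where
  "clamp_unit r = max 0 (min 1 r)"

lemma clamp_unit_lipschitz: "\<bar>clamp_unit r - clamp_unit s\<bar> \<le> \<bar>r - s\<bar>"
  by (auto simp: clamp_unit_def)

lemma clamp_unit_range: "clamp_unit r \<in> {0..1}"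
  by (auto simp: clamp_unit_def)

lemma clamp_unit_id: "r \<in> {0..1} \<Longrightarrow> clamp_unit r = r"
  by (auto simp: clamp_unit_def)

lemma clamp_unit_measurable [measurable]: "clamp_unit \<in> borel_measurable borel"
  unfolding clamp_unit_def[abs_def] by measurable

lemma tendsto_clamp_unit: "(f \<longlongrightarrow> r) G \<Longrightarrow> ((\<lambda>x. clamp_unit (f x)) \<longlongrightarrow> clamp_unit r) G"
  unfolding clamp_unit_def by (intro tendsto_intros)

definition clamped_rate :: "(real \<times> ('a \<times> 'a) \<Rightarrow> real) \<Rightarrow> real \<Rightarrow> 'a \<times> 'a \<Rightarrow> real" where
  "clamped_rate u s = drift (\<lambda>q. clamp_unit (u (s, q)))"

text \<open>Clamping makes the right-hand side globally Lipschitz, so the Picard iteration converges for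
  all times; the limit turns out to stay in the unit interval, where the clamp is inactive.\<close>

primrec picard :: "('a \<times> 'a \<Rightarrow> real) \<Rightarrow> nat \<Rightarrow> real \<times> ('a \<times> 'a) \<Rightarrow> real" where
  "picard W 0 = (\<lambda>w. W (snd w))"
| "picard W (Suc n) = (\<lambda>w. W (snd w)
     - (LINT s|lborel. indicator {0..fst w} s * clamped_rate (picard W n) s (snd w)))"

lemma clamped_rate_measurable:
  assumes "u \<in> borel_measurable (lborel \<Otimes>\<^sub>M square)"
  shows "(\<lambda>w. clamped_rate u (fst w) (snd w)) \<in> borel_measurable (lborel \<Otimes>\<^sub>M square)"
  unfolding clamped_rate_def
  by (rule drift_measurable_parametric[where U = "\<lambda>w. clamp_unit (u w)"])
    (rule measurable_compose[OF assms clamp_unit_measurable])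

lemma unit_valued_clamped_section:
  assumes "u \<in> borel_measurable (lborel \<Otimes>\<^sub>M square)"
  shows "unit_valued (\<lambda>q. clamp_unit (u (s, q)))"
proof -
  have "(\<lambda>q. (s, q)) \<in> square \<rightarrow>\<^sub>M lborel \<Otimes>\<^sub>M square"
    by (intro measurable_Pair) auto
  from measurable_compose[OF measurable_compose[OF this assms] clamp_unit_measurable]
  show ?thesis unfolding unit_valued_def using clamp_unit_range by blast
qed

lemma clamped_rate_bounds:
  assumes "u \<in> borel_measurable (lborel \<Otimes>\<^sub>M square)" "p \<in> space square"
  shows "0 \<le> clamped_rate u s p" "clamped_rate u s p \<le> card arcs"
  unfolding clamped_rate_def by (rule drift_bounds[OF unit_valued_clamped_section[OF assms(1)] assms(2)])+

lemma clamped_rate_section_measurable: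
  assumes "u \<in> borel_measurable (lborel \<Otimes>\<^sub>M square)" "p \<in> space square"
  shows "(\<lambda>s. clamped_rate u s p) \<in> borel_measurable lborel"
proof -
  have "(\<lambda>s. (s, p)) \<in> lborel \<rightarrow>\<^sub>M lborel \<Otimes>\<^sub>M square"
    using assms(2) by (intro measurable_Pair) auto
  from measurable_compose[OF this clamped_rate_measurable[OF assms(1)]] show ?thesis by simp
qed

lemma integrable_indicator_times_bounded:
  fixes f :: "real \<Rightarrow> real"
  assumes "f \<in> borel_measurable lborel" "\<And>s. s \<in> A \<Longrightarrow> \<bar>f s\<bar> \<le> C" "A \<in> sets lborel" "emeasure lborel A < \<infinity>"
  shows "integrable lborel (\<lambda>s. indicator A s * f s)"
proof (rule Bochner_Integration.integrable_bound)
  show "integrable lborel (\<lambda>s. indicator A s * C)"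
    using assms(3,4) by (intro integrable_mult_left integrable_real_indicator)
  show "(\<lambda>s. indicator A s * f s) \<in> borel_measurable lborel"
    using assms(1,3) by (intro borel_measurable_times borel_measurable_indicator)
  show "AE s in lborel. norm (indicator A s * f s) \<le> norm (indicator A s * C)"
    using assms(2) by (intro AE_I2) (force split: split_indicator)
qed

lemma integrable_clamped_rate:
  assumes "u \<in> borel_measurable (lborel \<Otimes>\<^sub>M square)" "p \<in> space square"
    "A \<in> sets lborel" "emeasure lborel A < \<infinity>"
  shows "integrable lborel (\<lambda>s. indicator A s * clamped_rate u s p)"
  by (rule integrable_indicator_times_bounded[where C = "card arcs",
      OF clamped_rate_section_measurable[OF assms(1,2)] _ assms(3,4)])
    (use clamped_rate_bounds[OF assms(1,2)] in simp)

lemma emeasure_Icc_finite: "emeasure lborel {a..b :: real} < \<infinity>"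
  by (simp add: emeasure_lborel_Icc_eq)

lemma picard_measurable:
  assumes W: "W \<in> borel_measurable square"
  shows "picard W n \<in> borel_measurable (lborel \<Otimes>\<^sub>M square)"
proof (induction n)
  case 0
  show ?case using measurable_compose[OF measurable_snd W] by simp
next
  case (Suc n)
  let ?L = "lborel :: real measure"
  let ?T = "?L \<Otimes>\<^sub>M square"
  have "(\<lambda>ws. (snd ws, snd (fst ws))) \<in> ?T \<Otimes>\<^sub>M ?L \<rightarrow>\<^sub>M ?T"
    by measurable
  from measurable_compose[OF this clamped_rate_measurable[OF Suc]]
  have rate: "(\<lambda>ws. clamped_rate (picard W n) (snd ws) (snd (fst ws))) \<in> borel_measurable (?T \<Otimes>\<^sub>M ?L)"
    by simp
  have [measurable]: "(\<lambda>ws. snd ws) \<in> borel_measurable (?T \<Otimes>\<^sub>M ?L)"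
    "(\<lambda>ws. fst (fst ws)) \<in> borel_measurable (?T \<Otimes>\<^sub>M ?L)"
    using measurable_snd[of ?T ?L] measurable_compose[OF measurable_fst measurable_fst, of ?T ?L]
    by auto
  have "(\<lambda>ws. if 0 \<le> snd ws \<and> snd ws \<le> fst (fst ws) then 1 else 0 :: real) \<in> borel_measurable (?T \<Otimes>\<^sub>M ?L)"
    by measurable
  also have "(\<lambda>ws. if 0 \<le> snd ws \<and> snd ws \<le> fst (fst ws) then 1 else 0 :: real)
      = (\<lambda>ws. indicator {0..fst (fst ws)} (snd ws))"
    by (auto simp: indicator_def)
  finally have "(\<lambda>ws. indicator {0..fst (fst ws)} (snd ws) * clamped_rate (picard W n) (snd ws) (snd (fst ws)))
      \<in> borel_measurable (?T \<Otimes>\<^sub>M ?L)"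
    using rate by (intro borel_measurable_times)
  then have "(\<lambda>w. LINT s|lborel. indicator {0..fst w} s * clamped_rate (picard W n) s (snd w)) \<in> borel_measurable ?T"
    by (intro lborel.borel_measurable_lebesgue_integral) (simp add: case_prod_beta')
  moreover have "(\<lambda>w. W (snd w)) \<in> borel_measurable ?T"
    by (rule measurable_compose[OF measurable_snd W])
  ultimately show ?case by simp
qed

definition lipschitz_const :: real where
  "lipschitz_const = card arcs * card edges"

lemma picard_increment:
  assumes W: "W \<in> borel_measurable square" and t: "t \<ge> 0" and p: "p \<in> space square"
  shows "\<bar>picard W (Suc n) (t, p) - picard W n (t, p)\<bar>
    \<le> card arcs * lipschitz_const ^ n * (t ^ Suc n / fact (Suc n))"
  using t p
proof (induction n arbitrary: t p)
  case 0
  note m = picard_measurable[OF W, of 0]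
  have int: "integrable lborel (\<lambda>s. indicator {0..t} s * clamped_rate (picard W 0) s p)"
    by (rule integrable_clamped_rate[OF m 0(2) _ emeasure_Icc_finite]) simp
  have "(LINT s|lborel. indicator {0..t} s * clamped_rate (picard W 0) s p)
      \<le> (LINT s|lborel. indicator {0..t} s * real (card arcs))"
    using clamped_rate_bounds[OF m 0(2)]
    by (intro integral_mono int integrable_mult_left integrable_real_indicator emeasure_Icc_finite)
      (auto split: split_indicator)
  moreover have "0 \<le> (LINT s|lborel. indicator {0..t} s * clamped_rate (picard W 0) s p)"
    using clamped_rate_bounds[OF m 0(2)] by (intro integral_nonneg_AE AE_I2) auto
  ultimately show ?case using 0(1) by (simp add: mult.commute)
next
  case (Suc n)
  let ?c = "card arcs * lipschitz_const ^ n"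
  let ?r = "\<lambda>m s. clamped_rate (picard W m) s p"
  note m = picard_measurable[OF W]
  have int: "integrable lborel (\<lambda>s. indicator {0..t} s * ?r m s)" for m
    by (rule integrable_clamped_rate[OF m Suc.prems(2) _ emeasure_Icc_finite]) simp
  have rate: "\<bar>?r (Suc n) s - ?r n s\<bar> \<le> lipschitz_const * (?c * (s ^ Suc n / fact (Suc n)))" if "s \<ge> 0" for s
  proof -
    have "\<bar>?r (Suc n) s - ?r n s\<bar> \<le> card arcs * (card edges * (?c * (s ^ Suc n / fact (Suc n))))"
      unfolding clamped_rate_def
      by (rule drift_lipschitz[OF unit_valued_clamped_section[OF m] unit_valued_clamped_section[OF m] Suc.prems(2)])
        (rule order_trans[OF clamp_unit_lipschitz Suc.IH[OF that]])
    then show ?thesis by (simp only: lipschitz_const_def mult.assoc of_nat_mult)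
  qed
  have "picard W (Suc (Suc n)) (t, p) - picard W (Suc n) (t, p)
      = (LINT s|lborel. indicator {0..t} s * ?r n s) - (LINT s|lborel. indicator {0..t} s * ?r (Suc n) s)"
    by simp
  also have "\<dots> = (LINT s|lborel. indicator {0..t} s * ?r n s - indicator {0..t} s * ?r (Suc n) s)"
    by (rule Bochner_Integration.integral_diff[OF int int, symmetric])
  finally have eq: "picard W (Suc (Suc n)) (t, p) - picard W (Suc n) (t, p) = \<dots>" .
  have "integrable lborel (\<lambda>s. indicator {0..t} s * s ^ Suc n)"
  proof (rule integrable_indicator_times_bounded[where C = "t ^ Suc n"])
    show "\<bar>s ^ Suc n\<bar> \<le> t ^ Suc n" if "s \<in> {0..t}" for s
      using that power_mono[of s t "Suc n"] by (auto simp: abs_mult power_abs)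
  qed (auto simp: emeasure_lborel_Icc_eq)
  then have pow: "integrable lborel (\<lambda>s. s ^ Suc n * indicator {0..t} s)"
    "(LINT s|lborel. s ^ Suc n * indicator {0..t} s) = t ^ Suc (Suc n) / Suc (Suc n)"
    using integral_power[OF Suc.prems(1), of "Suc n"] by (simp_all add: mult.commute)
  have "\<bar>picard W (Suc (Suc n)) (t, p) - picard W (Suc n) (t, p)\<bar>
      \<le> (LINT s|lborel. \<bar>indicator {0..t} s * ?r n s - indicator {0..t} s * ?r (Suc n) s\<bar>)"
    unfolding eq by (rule integral_abs_bound)
  also have "\<dots> \<le> (LINT s|lborel. lipschitz_const * ?c / fact (Suc n) * (s ^ Suc n * indicator {0..t} s))"
  proof (rule integral_mono)
    show "integrable lborel (\<lambda>s. \<bar>indicator {0..t} s * ?r n s - indicator {0..t} s * ?r (Suc n) s\<bar>)"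
      by (intro integrable_abs Bochner_Integration.integrable_diff int)
    show "integrable lborel (\<lambda>s. lipschitz_const * ?c / fact (Suc n) * (s ^ Suc n * indicator {0..t} s))"
      by (intro integrable_mult_right pow(1))
    fix s
    show "\<bar>indicator {0..t} s * ?r n s - indicator {0..t} s * ?r (Suc n) s\<bar>
        \<le> lipschitz_const * ?c / fact (Suc n) * (s ^ Suc n * indicator {0..t} s)"
      using rate[of s] by (auto simp: abs_minus_commute mult_ac split: split_indicator)
  qed
  also have "\<dots> = lipschitz_const * ?c / fact (Suc n) * (t ^ Suc (Suc n) / Suc (Suc n))"
    by (simp only: integral_mult_right_zero pow(2))
  also have "\<dots> = card arcs * lipschitz_const ^ Suc n * (t ^ Suc (Suc n) / fact (Suc (Suc n)))"
    by (simp add: fact_Suc mult_ac)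
  finally show ?case .
qed

definition clamped_flow :: "('a \<times> 'a \<Rightarrow> real) \<Rightarrow> real \<times> ('a \<times> 'a) \<Rightarrow> real" where
  "clamped_flow W w = lim (\<lambda>n. picard W n w)"

lemma clamped_flow_measurable:
  assumes W: "W \<in> borel_measurable square"
  shows "clamped_flow W \<in> borel_measurable (lborel \<Otimes>\<^sub>M square)"
  unfolding clamped_flow_def[abs_def]
  by (rule borel_measurable_lim_metric) (rule picard_measurable[OF W])

lemma picard_tendsto:
  assumes W: "W \<in> borel_measurable square" and t: "t \<ge> 0" and p: "p \<in> space square"
  shows "(\<lambda>n. picard W n (t, p)) \<longlonglongrightarrow> clamped_flow W (t, p)"
proof -
  let ?x = "lipschitz_const * t"
  have L: "lipschitz_const \<ge> 0" by (simp add: lipschitz_const_def)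
  have "summable (\<lambda>n. picard W (Suc n) (t, p) - picard W n (t, p))"
  proof (rule summable_comparison_test')
    show "summable (\<lambda>n. card arcs * t * (inverse (fact n) * ?x ^ n))"
      by (intro summable_mult summable_exp)
    fix n :: nat
    have "\<bar>picard W (Suc n) (t, p) - picard W n (t, p)\<bar>
        \<le> card arcs * lipschitz_const ^ n * (t ^ Suc n / fact (Suc n))"
      by (rule picard_increment[OF assms])
    also have "\<dots> \<le> card arcs * lipschitz_const ^ n * (t ^ Suc n / fact n)"
      using t L by (intro mult_left_mono divide_left_mono fact_mono mult_pos_pos) auto
    also have "\<dots> = card arcs * t * (inverse (fact n) * ?x ^ n)"
      by (simp add: power_mult_distrib field_simps)
    finally show "norm (picard W (Suc n) (t, p) - picard W n (t, p)) \<le> card arcs * t * (inverse (fact n) * ?x ^ n)"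
      by simp
  qed
  then have "convergent (\<lambda>n. \<Sum>i<n. picard W (Suc i) (t, p) - picard W i (t, p))"
    by (simp add: summable_iff_convergent)
  then have "convergent (\<lambda>n. (picard W n (t, p) - picard W 0 (t, p)) + picard W 0 (t, p))"
    unfolding sum_lessThan_telescope[of "\<lambda>n. picard W n (t, p)"] by (intro convergent_add convergent_const)
  then have "convergent (\<lambda>n. picard W n (t, p))"
    by simp
  then show ?thesis
    unfolding clamped_flow_def by (simp add: convergent_LIMSEQ_iff)
qed

lemma clamped_flow_integral_equation:
  assumes W: "W \<in> borel_measurable square" and t: "t \<ge> 0" and p: "p \<in> space square"
  shows "clamped_flow W (t, p)
    = W p - (LINT s|lborel. indicator {0..t} s * clamped_rate (clamped_flow W) s p)"
proof (rule LIMSEQ_unique)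
  show "(\<lambda>n. picard W (Suc n) (t, p)) \<longlonglongrightarrow> clamped_flow W (t, p)"
    using picard_tendsto[OF assms] by (rule LIMSEQ_Suc)
  note m = picard_measurable[OF W] and m' = clamped_flow_measurable[OF W]
  have "(\<lambda>n. LINT s|lborel. indicator {0..t} s * clamped_rate (picard W n) s p)
      \<longlonglongrightarrow> (LINT s|lborel. indicator {0..t} s * clamped_rate (clamped_flow W) s p)"
  proof (rule integral_dominated_convergence[where w = "\<lambda>s. indicator {0..t} s * real (card arcs)"])
    show "(\<lambda>s. indicator {0..t} s * clamped_rate (clamped_flow W) s p) \<in> borel_measurable lborel"
      by (intro borel_measurable_times clamped_rate_section_measurable[OF m' p]) auto
    show "(\<lambda>s. indicator {0..t} s * clamped_rate (picard W n) s p) \<in> borel_measurable lborel" for n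
      by (intro borel_measurable_times clamped_rate_section_measurable[OF m p]) auto
    show "integrable lborel (\<lambda>s. indicator {0..t} s * real (card arcs))"
      by (intro integrable_mult_left integrable_real_indicator emeasure_Icc_finite) simp
    show "AE s in lborel. norm (indicator {0..t} s * clamped_rate (picard W n) s p)
        \<le> indicator {0..t} s * real (card arcs)" for n
      using clamped_rate_bounds[OF m[of n] p] by (intro AE_I2) (auto split: split_indicator)
    show "AE s in lborel. (\<lambda>n. indicator {0..t} s * clamped_rate (picard W n) s p)
        \<longlonglongrightarrow> indicator {0..t} s * clamped_rate (clamped_flow W) s p"
    proof (rule AE_I2)
      fix s
      show "(\<lambda>n. indicator {0..t} s * clamped_rate (picard W n) s p)
        \<longlonglongrightarrow> indicator {0..t} s * clamped_rate (clamped_flow W) s p"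
      proof (cases "s \<in> {0..t}")
        case True
        have "(\<lambda>n. clamped_rate (picard W n) s p) \<longlonglongrightarrow> clamped_rate (clamped_flow W) s p"
          unfolding clamped_rate_def
          using True by (intro drift_tendsto unit_valued_clamped_section m m' p tendsto_clamp_unit picard_tendsto[OF W]) auto
        then show ?thesis by (rule tendsto_mult_left)
      qed simp
    qed
  qed
  then show "(\<lambda>n. picard W (Suc n) (t, p))
      \<longlonglongrightarrow> W p - (LINT s|lborel. indicator {0..t} s * clamped_rate (clamped_flow W) s p)"
    by (simp add: tendsto_diff)
qed

lemma kernel_sup_norm_le:
  assumes "f \<in> borel_measurable square" "AE p in square. \<bar>f p\<bar> \<le> c"
  shows "sup_norm M f \<le> ereal c"
  unfolding sup_norm_def using assms by (intro esssup_I) auto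

lemma clamped_flow_increment:
  assumes W: "W \<in> borel_measurable square" and ab: "0 \<le> a" "a \<le> b" and p: "p \<in> space square"
  shows "clamped_flow W (a, p) - clamped_flow W (b, p)
    = (LINT s|lborel. indicator {a<..b} s * clamped_rate (clamped_flow W) s p)"
proof -
  let ?r = "\<lambda>s. clamped_rate (clamped_flow W) s p"
  have int: "integrable lborel (\<lambda>s. indicator {0..t} s * ?r s)" for t
    by (rule integrable_clamped_rate[OF clamped_flow_measurable[OF W] p _ emeasure_Icc_finite]) simp
  have "clamped_flow W (a, p) - clamped_flow W (b, p)
      = (LINT s|lborel. indicator {0..b} s * ?r s) - (LINT s|lborel. indicator {0..a} s * ?r s)"
    using clamped_flow_integral_equation[OF W _ p] ab by simp
  also have "\<dots> = (LINT s|lborel. indicator {0..b} s * ?r s - indicator {0..a} s * ?r s)"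
    by (rule Bochner_Integration.integral_diff[OF int int, symmetric])
  also have "\<dots> = (LINT s|lborel. indicator {a<..b} s * ?r s)"
    using ab by (intro Bochner_Integration.integral_cong refl) (auto split: split_indicator)
  finally show ?thesis .
qed

lemma emeasure_Ioc_finite: "emeasure lborel {a<..b :: real} < \<infinity>"
  by (cases "a \<le> b") auto

lemma integral_Ioc_const:
  assumes "a \<le> (b :: real)"
  shows "integrable lborel (\<lambda>s. indicator {a<..b} s * (c :: real))"
    and "(LINT s|lborel. indicator {a<..b} s * c) = (b - a) * c"
  using assms emeasure_Ioc_finite[of a b]
  by (auto intro!: integrable_mult_left integrable_real_indicator)

lemma clamped_flow_antimono:
  fixes a b :: real
  assumes W: "W \<in> borel_measurable square" and ab: "0 \<le> a" "a \<le> b" and p: "p \<in> space square"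
  shows "clamped_flow W (b, p) \<le> clamped_flow W (a, p)"
    and "clamped_flow W (a, p) - clamped_flow W (b, p) \<le> card arcs * (b - a)"
proof -
  let ?r = "\<lambda>s. clamped_rate (clamped_flow W) s p"
  note bounds = clamped_rate_bounds[OF clamped_flow_measurable[OF W] p]
  have "0 \<le> (LINT s|lborel. indicator {a<..b} s * ?r s)"
    using bounds by (intro integral_nonneg_AE AE_I2) auto
  then show "clamped_flow W (b, p) \<le> clamped_flow W (a, p)"
    using clamped_flow_increment[OF assms] by linarith
  have "(LINT s|lborel. indicator {a<..b} s * ?r s) \<le> (LINT s|lborel. indicator {a<..b} s * real (card arcs))"
    using bounds
    by (intro integral_mono integral_Ioc_const(1)[OF ab(2)]
        integrable_clamped_rate[OF clamped_flow_measurable[OF W] p _ emeasure_Ioc_finite])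
      (auto split: split_indicator)
  then show "clamped_flow W (a, p) - clamped_flow W (b, p) \<le> card arcs * (b - a)"
    unfolding integral_Ioc_const(2)[OF ab(2)] clamped_flow_increment[OF assms]
    by (simp only: mult.commute)
qed

lemma picard_swap:
  assumes "\<And>x y. x \<in> space M \<Longrightarrow> y \<in> space M \<Longrightarrow> W (x, y) = W (y, x)"
    and "x \<in> space M" "y \<in> space M"
  shows "picard W n (t, (x, y)) = picard W n (t, (y, x))"
  using assms(1)[OF assms(2,3)] by (cases n) (simp_all add: clamped_rate_def drift_swap[of _ x y])

lemma removal_flow_exists:
  assumes "graphon M W"
  obtains u :: "real \<Rightarrow> 'a \<times> 'a \<Rightarrow> real" and K :: real
  where "\<And>t. 0 \<le> t \<Longrightarrow> graphon M (u t)"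
    and "\<And>p. p \<in> space square \<Longrightarrow> u 0 p = W p"
    and "\<And>s t p. 0 \<le> s \<Longrightarrow> s \<le> t \<Longrightarrow> p \<in> space square \<Longrightarrow> u t p \<le> u s p"
    and "\<And>s t p. 0 \<le> s \<Longrightarrow> 0 \<le> t \<Longrightarrow> p \<in> space square \<Longrightarrow>
      \<bar>u s p - u t p + (s - t) * drift (u t) p\<bar> \<le> K * (s - t)\<^sup>2"
proof -
  have W: "W \<in> borel_measurable square"
    and W_sym: "\<And>x y. x \<in> space M \<Longrightarrow> y \<in> space M \<Longrightarrow> W (x, y) = W (y, x)"
    and W01: "\<And>p. p \<in> space square \<Longrightarrow> W p \<in> {0..1}"
    using assms by (auto simp: graphon_def kernel_def space_pair_measure)
  define u where "u t p = clamped_flow W (t, p)" for t p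
  note meas = clamped_flow_measurable[OF W]
  let ?r = "clamped_rate (clamped_flow W)"
  have u0: "u 0 p = W p" if p: "p \<in> space square" for p
  proof -
    have "AE s in lborel. indicator {0..0} s * ?r s p = 0"
      using AE_lborel_singleton[of "0::real"] by eventually_elim (auto split: split_indicator)
    then have "(LINT s|lborel. indicator {0..0} s * ?r s p) = 0"
      by (rule integral_eq_zero_AE)
    then show ?thesis
      unfolding u_def using clamped_flow_integral_equation[OF W order_refl p] by simp
  qed
  have u_mono: "u t p \<le> u s p" if "0 \<le> s" "s \<le> t" "p \<in> space square" for s t p
    unfolding u_def by (rule clamped_flow_antimono(1)[OF W that])
  have u_lip: "\<bar>u s p - u t p\<bar> \<le> card arcs * \<bar>s - t\<bar>" if "0 \<le> s" "0 \<le> t" "p \<in> space square" for s t :: real and p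
    using clamped_flow_antimono[OF W that(1) _ that(3)] clamped_flow_antimono[OF W that(2) _ that(3)]
    unfolding u_def by (cases "s \<le> t") auto
  have u_sym: "u t (x, y) = u t (y, x)" if "x \<in> space M" "y \<in> space M" for t x y
    unfolding u_def clamped_flow_def using picard_swap[of W x y, OF W_sym that] by simp
  have rate_0: "?r s p = 0" if "u s p \<le> 0" "p \<in> space square" for s p
    unfolding clamped_rate_def
    by (rule drift_eq_0[OF _ that(2)])
      (use that(1) u_sym in \<open>auto simp: u_def clamp_unit_def\<close>)
  have u_cont: "continuous_on {0..t} (\<lambda>s. u s p)" if "p \<in> space square" for t p
  proof (rule continuous_onI)
    fix s and e :: real
    assume s: "s \<in> {0..t}" and e: "e > 0"
    show "\<exists>d>0. \<forall>s'\<in>{0..t}. dist s' s < d \<longrightarrow> dist (u s' p) (u s p) \<le> e"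
    proof (intro exI[of _ "e / Suc (card arcs)"] conjI ballI impI)
      fix s' assume s': "s' \<in> {0..t}" "dist s' s < e / Suc (card arcs)"
      have "\<bar>u s' p - u s p\<bar> \<le> card arcs * \<bar>s' - s\<bar>"
        using s s' that by (intro u_lip) auto
      also have "\<dots> \<le> Suc (card arcs) * \<bar>s' - s\<bar>"
        by (intro mult_right_mono) auto
      also have "\<dots> \<le> e"
        using s'(2) by (simp add: dist_real_def field_simps)
      finally show "dist (u s' p) (u s p) \<le> e" by (simp add: dist_real_def)
    qed (use e in auto)
  qed
  have u_nonneg: "0 \<le> u t p" if t: "0 \<le> t" and p: "p \<in> space square" for t p
  proof (rule ccontr)
    assume neg: "\<not> 0 \<le> u t p"
    have "\<exists>s\<ge>0. s \<le> t \<and> u s p = u t p / 2"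
      using neg u0[OF p] W01[OF p] t by (intro IVT2' u_cont[OF p]) auto
    then obtain s where s: "0 \<le> s" "s \<le> t" "u s p = u t p / 2" by blast
    have "u s p - u t p = (LINT r|lborel. indicator {s<..t} r * ?r r p)"
      unfolding u_def by (rule clamped_flow_increment[OF W s(1,2) p])
    also have "\<dots> = (LINT r|(lborel :: real measure). 0)"
    proof (intro Bochner_Integration.integral_cong refl)
      fix r
      show "indicator {s<..t} r * ?r r p = 0"
      proof (cases "r \<in> {s<..t}")
        case True
        then have "u r p \<le> u s p" using s p by (intro u_mono) auto
        then show ?thesis using rate_0[OF _ p] s(3) neg by simp
      qed simp
    qed
    finally show False using s(3) neg by simp
  qed
  have u01: "u t p \<in> {0..1}" if "0 \<le> t" "p \<in> space square" for t p
    using u_nonneg[OF that] u_mono[OF order_refl that] u0[OF that(2)] W01[OF that(2)] by auto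
  have u_meas: "u t \<in> borel_measurable square" for t
  proof -
    have "(\<lambda>q. (t, q)) \<in> square \<rightarrow>\<^sub>M lborel \<Otimes>\<^sub>M square"
      by (intro measurable_Pair) auto
    from measurable_compose[OF this meas] show ?thesis by (simp add: u_def[abs_def])
  qed
  have u_unit: "unit_valued (u t)" if "0 \<le> t" for t
    using u_meas u01[OF that] by (auto simp: unit_valued_def space_pair_measure)
  have graphon: "graphon M (u t)" if "0 \<le> t" for t
    unfolding graphon_def kernel_def
  proof (intro conjI ballI exI[of _ 1])
    fix x y assume xy: "x \<in> space M" "y \<in> space M"
    then have "u t (x, y) \<in> {0..1}" using u01[OF that] by (simp add: space_pair_measure)
    then show "0 \<le> u t (x, y)" "u t (x, y) \<le> 1" "\<bar>u t (x, y)\<bar> \<le> 1" by auto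
  qed (use u_meas u_sym in auto)
  have rate_eq: "?r s p = drift (u s) p" if s: "0 \<le> s" and p: "p \<in> space square" for s p
  proof -
    have "\<bar>?r s p - drift (u s) p\<bar> \<le> real (card arcs) * (real (card edges) * 0)"
      unfolding clamped_rate_def
      by (rule drift_lipschitz[OF unit_valued_clamped_section[OF meas] u_unit[OF s] p])
        (use u01[OF s] in \<open>simp add: clamp_unit_id u_def\<close>)
    then show ?thesis by simp
  qed
  let ?K = "lipschitz_const * card arcs"
  have step: "\<bar>u a p - u b p - (b - a) * drift (u c) p\<bar> \<le> ?K * (b - a)\<^sup>2"
    if ab: "0 \<le> a" "a \<le> b" "a \<le> c" "c \<le> b" and p: "p \<in> space square" for a b c p
  proof -
    have int: "integrable lborel (\<lambda>s. indicator {a<..b} s * ?r s p)"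
      by (rule integrable_clamped_rate[OF meas p _ emeasure_Ioc_finite]) simp
    note const = integral_Ioc_const[OF ab(2)]
    have "u a p - u b p - (b - a) * drift (u c) p
        = (LINT s|lborel. indicator {a<..b} s * ?r s p) - (LINT s|lborel. indicator {a<..b} s * drift (u c) p)"
      unfolding u_def const(2) clamped_flow_increment[OF W ab(1,2) p] ..
    also have "\<dots> = (LINT s|lborel. indicator {a<..b} s * ?r s p - indicator {a<..b} s * drift (u c) p)"
      by (rule Bochner_Integration.integral_diff[OF int const(1), symmetric])
    finally have eq: "u a p - u b p - (b - a) * drift (u c) p
        = (LINT s|lborel. indicator {a<..b} s * ?r s p - indicator {a<..b} s * drift (u c) p)" .
    have "\<bar>u a p - u b p - (b - a) * drift (u c) p\<bar>
        \<le> (LINT s|lborel. \<bar>indicator {a<..b} s * ?r s p - indicator {a<..b} s * drift (u c) p\<bar>)"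
      unfolding eq by (rule integral_abs_bound)
    also have "\<dots> \<le> (LINT s|lborel. indicator {a<..b} s * (?K * (b - a)))"
    proof (rule integral_mono)
      show "integrable lborel (\<lambda>s. \<bar>indicator {a<..b} s * ?r s p - indicator {a<..b} s * drift (u c) p\<bar>)"
        by (intro integrable_abs Bochner_Integration.integrable_diff int const)
      show "integrable lborel (\<lambda>s. indicator {a<..b} s * (?K * (b - a)))"
        by (rule const(1))
      fix s
      show "\<bar>indicator {a<..b} s * ?r s p - indicator {a<..b} s * drift (u c) p\<bar>
          \<le> indicator {a<..b} s * (?K * (b - a))"
      proof (cases "s \<in> {a<..b}")
        case True
        then have s: "0 \<le> s" "0 \<le> c" "\<bar>s - c\<bar> \<le> b - a" using ab by auto
        have "\<bar>drift (u s) p - drift (u c) p\<bar> \<le> card arcs * (card edges * (card arcs * (b - a)))"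
        proof (rule drift_lipschitz[OF u_unit[OF s(1)] u_unit[OF s(2)] p])
          fix q assume "q \<in> space square"
          from u_lip[OF s(1,2) this] s(3) show "\<bar>u s q - u c q\<bar> \<le> card arcs * (b - a)"
            by (meson mult_left_mono of_nat_0_le_iff order_trans)
        qed
        then show ?thesis
          using True rate_eq[OF s(1) p] by (simp add: lipschitz_const_def mult_ac)
      qed simp
    qed
    also have "\<dots> = ?K * (b - a)\<^sup>2"
      unfolding const(2) by (simp add: power2_eq_square mult_ac)
    finally show ?thesis .
  qed
  have second_order: "\<bar>u s p - u t p + (s - t) * drift (u t) p\<bar> \<le> ?K * (s - t)\<^sup>2"
    if "0 \<le> s" "0 \<le> t" "p \<in> space square" for s t p
  proof (cases "s \<le> t")
    case True
    with step[of s t t p] that show ?thesis by (simp add: power2_commute[of s t] algebra_simps)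
  next
    case False
    with step[of t s t p] that have "\<bar>- (u s p - u t p + (s - t) * drift (u t) p)\<bar> \<le> ?K * (s - t)\<^sup>2"
      by (simp add: algebra_simps)
    then show ?thesis by (simp only: abs_minus_cancel)
  qed
  show ?thesis
    by (rule that[OF graphon u0 u_mono second_order])
qed

end

lemma (in prob_space) esssup_abs_nonneg: "0 \<le> esssup M (\<lambda>p. ereal \<bar>f p\<bar>)"
proof (rule ccontr)
  assume "\<not> 0 \<le> esssup M (\<lambda>p. ereal \<bar>f p\<bar>)"
  with esssup_AE[of "\<lambda>p. ereal \<bar>f p\<bar>" M] have "AE p in M. False"
    by (elim eventually_mono) (metis abs_ge_zero ereal_less_eq(5) order_trans)
  then show False by simp
qed

context removal_process
begin

lemma sup_norm_nonneg: "0 \<le> sup_norm M f"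
  unfolding sup_norm_def by (rule prob_space.esssup_abs_nonneg[OF prob_space_square])

lemma AE_sup_norm:
  assumes "sup_norm M f < \<infinity>"
  shows "AE p in square. \<bar>f p\<bar> \<le> real_of_ereal (sup_norm M f)"
proof -
  have "ereal (real_of_ereal (sup_norm M f)) = sup_norm M f"
    using assms sup_norm_nonneg[of f] by (cases "sup_norm M f") auto
  then have "AE p in square. ereal \<bar>f p\<bar> \<le> ereal (real_of_ereal (sup_norm M f))"
    using esssup_AE[of "\<lambda>p. ereal \<bar>f p\<bar>" "square"] by (simp add: sup_norm_def)
  then show ?thesis by simp
qed

lemma kernel_bounded:
  assumes "kernel M U"
  obtains B where "B \<ge> 0" "\<And>p. p \<in> space square \<Longrightarrow> \<bar>U p\<bar> \<le> B"
proof -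
  from assms obtain B where "\<forall>x\<in>space M. \<forall>y\<in>space M. \<bar>U (x, y)\<bar> \<le> B"
    by (auto simp: kernel_def)
  then have B: "\<bar>U p\<bar> \<le> B" if "p \<in> space square" for p
    using that by (auto simp: space_pair_measure)
  show ?thesis
    by (rule that[of "\<bar>B\<bar>"]) (use B in \<open>auto intro: order_trans[OF _ abs_ge_self]\<close>)
qed

lemma drift_bounded:
  fixes B :: real
  assumes U: "U \<in> borel_measurable square" "\<And>p. p \<in> space square \<Longrightarrow> \<bar>U p\<bar> \<le> B" and "B \<ge> 0"
    and p: "p \<in> space square"
  shows "\<bar>drift U p\<bar> \<le> card arcs * B ^ card edges"
proof -
  have "\<bar>rooted_density U ab p\<bar> \<le> B ^ card edges" if ab: "ab \<in> arcs" for ab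
  proof -
    interpret Q: prob_space "root_complement ab" by (rule prob_space_power_space)
    have bound: "\<bar>rooted_product U ab p z\<bar> \<le> B ^ card edges" if z: "z \<in> space (root_complement ab)" for z
    proof -
      have "\<bar>rooted_product U ab p z\<bar> \<le> (\<Prod>e\<in>edges. B)"
        unfolding Let_def abs_prod
        by (intro prod_mono conjI abs_ge_zero U(2) rooted_pair_in_square[OF ab z p])
      then show ?thesis by simp
    qed
    have int: "integrable (root_complement ab) (rooted_product U ab p)"
      by (rule Q.integrable_bounded[OF rooted_product_measurable[OF ab p U(1)] bound])
    have "\<bar>rooted_density U ab p\<bar> \<le> (LINT z|root_complement ab. \<bar>rooted_product U ab p z\<bar>)"
      unfolding rooted_density_def by (rule integral_abs_bound)
    also have "\<dots> \<le> B ^ card edges"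
      by (rule Q.integral_le_const[OF integrable_abs[OF int]]) (rule AE_I2, rule bound)
    finally show ?thesis .
  qed
  note each = this
  have "\<bar>drift U p\<bar> \<le> (\<Sum>ab\<in>arcs. \<bar>rooted_density U ab p\<bar>)"
    unfolding drift_def by (rule sum_abs)
  also have "\<dots> \<le> card arcs * B ^ card edges"
    by (rule sum_bounded_above[OF each])
  finally show ?thesis .
qed

lemma velocity_kernel:
  assumes "kernel M U" "p \<in> space square"
  shows "velocity M k (removal_rule F) U p = - drift U p"
proof -
  obtain B where "\<And>p. p \<in> space square \<Longrightarrow> \<bar>U p\<bar> \<le> B"
    using kernel_bounded[OF assms(1)] by blast
  then show ?thesis
    using assms by (intro velocity_removal_rule) (auto simp: kernel_def)
qed

lemma velocity_measurable:
  assumes "kernel M U"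
  shows "velocity M k (removal_rule F) U \<in> borel_measurable square"
proof -
  have "(\<lambda>p. - drift U p) \<in> borel_measurable square"
    using drift_measurable assms by (auto simp: kernel_def)
  then show ?thesis
    by (rule measurable_cong[THEN iffD1, rotated]) (use velocity_kernel[OF assms] in simp)
qed

definition removal_flow :: "('a \<times> 'a \<Rightarrow> real) \<Rightarrow> real \<Rightarrow> (real \<Rightarrow> 'a \<times> 'a \<Rightarrow> real) \<Rightarrow> bool" where
  "removal_flow W K u \<longleftrightarrow> (\<forall>t\<ge>0. graphon M (u t)) \<and> (\<forall>p\<in>space square. u 0 p = W p) \<and>
    (\<forall>s t p. 0 \<le> s \<longrightarrow> s \<le> t \<longrightarrow> p \<in> space square \<longrightarrow> u t p \<le> u s p) \<and>
    (\<forall>s t p. 0 \<le> s \<longrightarrow> 0 \<le> t \<longrightarrow> p \<in> space square \<longrightarrow>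
      \<bar>u s p - u t p + (s - t) * drift (u t) p\<bar> \<le> K * (s - t)\<^sup>2)"

lemma removal_flowD:
  assumes "removal_flow W K u"
  shows "0 \<le> t \<Longrightarrow> graphon M (u t)"
    and "p \<in> space square \<Longrightarrow> u 0 p = W p"
    and "0 \<le> s \<Longrightarrow> s \<le> t \<Longrightarrow> p \<in> space square \<Longrightarrow> u t p \<le> u s p"
    and "0 \<le> s \<Longrightarrow> 0 \<le> t \<Longrightarrow> p \<in> space square \<Longrightarrow>
      \<bar>u s p - u t p + (s - t) * drift (u t) p\<bar> \<le> K * (s - t)\<^sup>2"
  using assms unfolding removal_flow_def by blast+

lemma ex_removal_flow:
  assumes "graphon M W"
  shows "\<exists>K u. removal_flow W K u"
proof (rule removal_flow_exists[OF assms])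
  fix u :: "real \<Rightarrow> 'a \<times> 'a \<Rightarrow> real" and K :: real
  assume "\<And>t. 0 \<le> t \<Longrightarrow> graphon M (u t)" "\<And>p. p \<in> space square \<Longrightarrow> u 0 p = W p"
    "\<And>s t p. 0 \<le> s \<Longrightarrow> s \<le> t \<Longrightarrow> p \<in> space square \<Longrightarrow> u t p \<le> u s p"
    "\<And>s t p. 0 \<le> s \<Longrightarrow> 0 \<le> t \<Longrightarrow> p \<in> space square \<Longrightarrow>
      \<bar>u s p - u t p + (s - t) * drift (u t) p\<bar> \<le> K * (s - t)\<^sup>2"
  then have "removal_flow W K u" unfolding removal_flow_def by blast
  then show ?thesis by blast
qed

lemma graphon_kernel: "graphon M U \<Longrightarrow> kernel M U"
  by (simp add: graphon_def)

lemma graphon_unit_valued: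
  assumes "graphon M U"
  shows "unit_valued U"
  using assms by (auto simp: graphon_def kernel_def unit_valued_def)

lemma removal_flow_quotient:
  assumes "removal_flow W K u" "0 \<le> s" "0 \<le> t" "s \<noteq> t" "p \<in> space square"
  shows "\<bar>(u s p - u t p) / (s - t) - (- drift (u t) p)\<bar> \<le> K * \<bar>s - t\<bar>"
proof -
  have "(u s p - u t p) / (s - t) - (- drift (u t) p) = (u s p - u t p + (s - t) * drift (u t) p) / (s - t)"
    using assms(4) by (simp add: add_divide_distrib)
  moreover have "\<bar>u s p - u t p + (s - t) * drift (u t) p\<bar> \<le> K * \<bar>s - t\<bar> * \<bar>s - t\<bar>"
    using removal_flowD(4)[OF assms(1-3,5)] by (simp add: power2_eq_square mult.assoc)
  ultimately show ?thesis
    using assms(4) by (simp add: abs_divide pos_divide_le_eq)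
qed

lemma removal_flow_is_trajectory:
  assumes u: "removal_flow W K u"
  shows "is_trajectory M k (removal_rule F) W u"
  unfolding is_trajectory_def
proof (intro conjI allI impI)
  show "kernel M (u t)" if "0 \<le> t" for t
    using removal_flowD(1)[OF u that] by (rule graphon_kernel)
  show "AE p in square. u 0 p = W p"
    by (intro AE_I2 removal_flowD(2)[OF u])
  fix t :: real assume t: "0 \<le> t"
  let ?f = "\<lambda>s p. (u s p - u t p) / (s - t) - velocity M k (removal_rule F) (u t) p"
  have k: "kernel M (u s)" if "0 \<le> s" for s
    using removal_flowD(1)[OF u that] by (rule graphon_kernel)
  have bound: "\<forall>\<^sub>F s in at t within {0..}. sup_norm M (?f s) \<le> ereal (K * \<bar>s - t\<bar>)"
    unfolding eventually_at_filter
  proof (rule always_eventually, intro allI impI)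
    fix s assume s: "s \<noteq> t" "s \<in> {0..}"
    show "sup_norm M (?f s) \<le> ereal (K * \<bar>s - t\<bar>)"
    proof (rule kernel_sup_norm_le)
      show "?f s \<in> borel_measurable square"
        using k[of s] k[OF t] velocity_measurable[OF k[OF t]] s(2) by (auto simp: kernel_def)
      show "AE p in square. \<bar>?f s p\<bar> \<le> K * \<bar>s - t\<bar>"
        using removal_flow_quotient[OF u _ t s(1)] velocity_kernel[OF k[OF t]] s(2)
        by (intro AE_I2) auto
    qed
  qed
  have lim: "((\<lambda>s. ereal (K * \<bar>s - t\<bar>)) \<longlongrightarrow> 0) (at t within {0..})"
    unfolding zero_ereal_def by (intro tendsto_ereal) (auto intro!: tendsto_eq_intros)
  show "((\<lambda>s. sup_norm M (?f s)) \<longlongrightarrow> 0) (at t within {0..})"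
    by (rule tendsto_sandwich[OF _ bound tendsto_const lim]) (simp add: sup_norm_nonneg)
qed

end

section \<open>Uniqueness of trajectories\<close>

context removal_process
begin

lemma AE_pair_component:
  assumes "AE p in square. P p" "i \<in> {1..k}" "j \<in> {1..k}" "i \<noteq> j"
  shows "AE z in power_space {1..k}. P (z i, z j)"
proof (rule AE_distrD[where M' = "square"])
  show "(\<lambda>z. (z i, z j)) \<in> power_space {1..k} \<rightarrow>\<^sub>M square"
    using assms by (intro measurable_Pair measurable_component_singleton)
  show "AE p in distr (power_space {1..k}) square (\<lambda>z. (z i, z j)). P p"
    using assms by (subst distr_two_components) auto
qed

lemma integral_pair_component:
  fixes f :: "'a \<times> 'a \<Rightarrow> real"
  assumes f: "integrable square f" and ij: "i \<in> {1..k}" "j \<in> {1..k}" "i \<noteq> j"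
  shows "integrable (power_space {1..k}) (\<lambda>z. f (z i, z j))"
    and "(LINT z|power_space {1..k}. f (z i, z j)) = (LINT p|square. f p)"
proof -
  have meas: "(\<lambda>z. (z i, z j)) \<in> power_space {1..k} \<rightarrow>\<^sub>M square"
    using ij by (intro measurable_Pair measurable_component_singleton)
  have distr: "distr (power_space {1..k}) square (\<lambda>z. (z i, z j)) = square"
    by (rule distr_two_components[OF _ ij]) simp
  show "integrable (power_space {1..k}) (\<lambda>z. f (z i, z j))"
    using integrable_distr[OF meas, of f] f unfolding distr by simp
  show "(LINT z|power_space {1..k}. f (z i, z j)) = (LINT p|square. f p)"
    using integral_distr[OF meas, of f] borel_measurable_integrable[OF f] unfolding distr by simp
qed

lemma prod_diff_bound:
  fixes B :: real and f g :: "'i \<Rightarrow> real"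
  assumes B: "1 \<le> B" and f: "\<And>i. i \<in> A \<Longrightarrow> \<bar>f i\<bar> \<le> B" and g: "\<And>i. i \<in> A \<Longrightarrow> \<bar>g i\<bar> \<le> B"
  shows "\<bar>(\<Prod>i\<in>A. f i) - (\<Prod>i\<in>A. g i)\<bar> \<le> B ^ card A * (\<Sum>i\<in>A. \<bar>f i - g i\<bar>)"
proof -
  have scale: "(\<Prod>i\<in>A. h i) = B ^ card A * (\<Prod>i\<in>A. h i / B)" for h :: "'i \<Rightarrow> real"
    using B by (simp add: prod_dividef)
  have "norm ((\<Prod>i\<in>A. f i / B) - (\<Prod>i\<in>A. g i / B)) \<le> (\<Sum>i\<in>A. norm (f i / B - g i / B))"
    using B f g by (intro norm_prod_diff) (auto simp: divide_le_eq_1)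
  also have "\<dots> \<le> (\<Sum>i\<in>A. \<bar>f i - g i\<bar>)"
  proof (rule sum_mono)
    fix i
    have "norm (f i / B - g i / B) = \<bar>f i - g i\<bar> / B"
      using B by (simp add: diff_divide_distrib[symmetric])
    also have "\<dots> \<le> \<bar>f i - g i\<bar> / 1"
      using B by (intro divide_left_mono) auto
    finally show "norm (f i / B - g i / B) \<le> \<bar>f i - g i\<bar>" by simp
  qed
  finally have "\<bar>(\<Prod>i\<in>A. f i / B) - (\<Prod>i\<in>A. g i / B)\<bar> \<le> (\<Sum>i\<in>A. \<bar>f i - g i\<bar>)" by simp
  then have "B ^ card A * \<bar>(\<Prod>i\<in>A. f i / B) - (\<Prod>i\<in>A. g i / B)\<bar> \<le> B ^ card A * (\<Sum>i\<in>A. \<bar>f i - g i\<bar>)"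
    using B by (intro mult_left_mono) auto
  moreover have "\<bar>(\<Prod>i\<in>A. f i) - (\<Prod>i\<in>A. g i)\<bar> = B ^ card A * \<bar>(\<Prod>i\<in>A. f i / B) - (\<Prod>i\<in>A. g i / B)\<bar>"
    unfolding scale[of f] scale[of g] right_diff_distrib[symmetric] abs_mult using B by simp
  ultimately show ?thesis by simp
qed

lemma drift_L2_lipschitz:
  fixes B :: real
  assumes U: "kernel M U" and V: "kernel M V" and B: "1 \<le> B"
    and UB: "AE p in square. \<bar>U p\<bar> \<le> B" and VB: "AE p in square. \<bar>V p\<bar> \<le> B"
  shows "\<bar>LINT p|square. (U p - V p) * (drift U p - drift V p)\<bar>
    \<le> card arcs * (card edges * B ^ card edges) * (LINT p|square. (U p - V p)\<^sup>2)"
proof -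
  interpret S: prob_space "square" by (rule prob_space_square)
  let ?P = "power_space {1..k}"
  let ?f = "\<lambda>p. U p - V p"
  let ?I = "LINT p|square. (?f p)\<^sup>2"
  let ?\<Pi> = "\<lambda>Y z. \<Prod>e\<in>edges. Y (z (fst e), z (snd e))"
  obtain b where b: "b \<ge> 0" "\<And>p. p \<in> space square \<Longrightarrow> \<bar>U p\<bar> \<le> b" using kernel_bounded[OF U] by blast
  obtain c where c: "c \<ge> 0" "\<And>p. p \<in> space square \<Longrightarrow> \<bar>V p\<bar> \<le> c" using kernel_bounded[OF V] by blast
  have meas: "U \<in> borel_measurable square" "V \<in> borel_measurable square"
    using U V by (auto simp: kernel_def)
  have f: "?f \<in> borel_measurable square" using meas by simp
  have fb: "\<bar>?f p\<bar> \<le> b + c" if "p \<in> space square" for p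
    using b(2)[OF that] c(2)[OF that] by linarith
  have f2: "integrable square (\<lambda>p. (?f p)\<^sup>2)"
  proof (rule S.integrable_bounded[where B = "(b + c)\<^sup>2"])
    show "(\<lambda>p. (?f p)\<^sup>2) \<in> borel_measurable square" using f by simp
    show "\<bar>(?f p)\<^sup>2\<bar> \<le> (b + c)\<^sup>2" if "p \<in> space square" for p
      using fb[OF that] b(1) c(1) by (simp add: abs_le_square_iff[symmetric])
  qed
  note dU = drift_duality[OF meas(1) b(2) f fb]
  note dV = drift_duality[OF meas(2) c(2) f fb]
  have each: "\<bar>(LINT z|?P. ?f (z (fst ab), z (snd ab)) * ?\<Pi> U z) - (LINT z|?P. ?f (z (fst ab), z (snd ab)) * ?\<Pi> V z)\<bar>
      \<le> card edges * B ^ card edges * ?I" if ab: "ab \<in> arcs" for ab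
  proof -
    let ?g = "\<lambda>z. B ^ card edges * (\<Sum>e\<in>edges.
      ((?f (z (fst ab), z (snd ab)))\<^sup>2 + (?f (z (fst e), z (snd e)))\<^sup>2) / 2)"
    have abI: "fst ab \<in> {1..k}" "snd ab \<in> {1..k}" "fst ab \<noteq> snd ab" using arcD[OF ab] by auto
    have eI: "fst e \<in> {1..k}" "snd e \<in> {1..k}" "fst e \<noteq> snd e" if "e \<in> edges" for e
      using edgeD[OF that] by auto
    have iU: "integrable ?P (\<lambda>z. ?f (z (fst ab), z (snd ab)) * ?\<Pi> U z)"
      by (rule dU(3)[OF _ _ ab])
    have iV: "integrable ?P (\<lambda>z. ?f (z (fst ab), z (snd ab)) * ?\<Pi> V z)"
      by (rule dV(3)[OF _ _ ab])
    have eq: "(LINT z|?P. ?f (z (fst ab), z (snd ab)) * ?\<Pi> U z) - (LINT z|?P. ?f (z (fst ab), z (snd ab)) * ?\<Pi> V z)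
        = (LINT z|?P. ?f (z (fst ab), z (snd ab)) * ?\<Pi> U z - ?f (z (fst ab), z (snd ab)) * ?\<Pi> V z)"
      by (rule Bochner_Integration.integral_diff[OF iU iV, symmetric])
    have int_half: "integrable ?P (\<lambda>z. ((?f (z (fst ab), z (snd ab)))\<^sup>2 + (?f (z (fst e), z (snd e)))\<^sup>2) / 2)"
      if "e \<in> edges" for e
      by (intro integrable_divide Bochner_Integration.integrable_add
          integral_pair_component(1)[OF f2, of "fst ab" "snd ab"] integral_pair_component(1)[OF f2, of "fst e" "snd e"]
          abI eI that)
    have "AE z in ?P. \<forall>e\<in>edges. \<bar>U (z (fst e), z (snd e))\<bar> \<le> B \<and> \<bar>V (z (fst e), z (snd e))\<bar> \<le> B"
    proof (rule AE_finite_allI[OF finite_edges])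
      fix e assume "e \<in> edges"
      note e = eI[OF this]
      show "AE z in ?P. \<bar>U (z (fst e), z (snd e))\<bar> \<le> B \<and> \<bar>V (z (fst e), z (snd e))\<bar> \<le> B"
        using AE_pair_component[OF UB e] AE_pair_component[OF VB e] by eventually_elim simp
    qed
    then have "AE z in ?P. \<bar>?f (z (fst ab), z (snd ab)) * ?\<Pi> U z - ?f (z (fst ab), z (snd ab)) * ?\<Pi> V z\<bar> \<le> ?g z"
    proof eventually_elim
      case (elim z)
      let ?x = "\<bar>?f (z (fst ab), z (snd ab))\<bar>" and ?y = "\<lambda>e. \<bar>?f (z (fst e), z (snd e))\<bar>"
      have "\<bar>?f (z (fst ab), z (snd ab)) * ?\<Pi> U z - ?f (z (fst ab), z (snd ab)) * ?\<Pi> V z\<bar>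
          = ?x * \<bar>?\<Pi> U z - ?\<Pi> V z\<bar>"
        by (simp add: right_diff_distrib[symmetric] abs_mult)
      also have "\<dots> \<le> ?x * (B ^ card edges * (\<Sum>e\<in>edges. ?y e))"
        using elim by (intro mult_left_mono prod_diff_bound[OF B]) auto
      also have "\<dots> = B ^ card edges * (\<Sum>e\<in>edges. ?x * ?y e)"
        by (simp only: sum_distrib_left mult.left_commute)
      also have "\<dots> \<le> ?g z"
      proof (intro mult_left_mono sum_mono)
        fix e
        have "\<bar>r\<bar> * \<bar>r'\<bar> \<le> (r\<^sup>2 + r'\<^sup>2) / 2" for r r' :: real
          using zero_le_power2[of "\<bar>r\<bar> - \<bar>r'\<bar>"] unfolding power2_diff by simp
        then show "?x * ?y e \<le> ((?f (z (fst ab), z (snd ab)))\<^sup>2 + (?f (z (fst e), z (snd e)))\<^sup>2) / 2" .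
      qed (use B in simp)
      finally show ?case .
    qed
    moreover have "integrable ?P ?g"
      by (intro integrable_mult_right Bochner_Integration.integrable_sum int_half)
    ultimately have "\<bar>LINT z|?P. ?f (z (fst ab), z (snd ab)) * ?\<Pi> U z - ?f (z (fst ab), z (snd ab)) * ?\<Pi> V z\<bar>
        \<le> (LINT z|?P. ?g z)"
      by (intro order_trans[OF integral_abs_bound] integral_mono_AE integrable_abs Bochner_Integration.integrable_diff
          iU iV)
    also have "(LINT z|?P. ?g z) = B ^ card edges * (\<Sum>e\<in>edges. (?I + ?I) / 2)"
      unfolding integral_mult_right_zero
      using int_half integral_pair_component[OF f2 abI] integral_pair_component[OF f2 eI]
      by (subst Bochner_Integration.integral_sum) simp_all
    also have "\<dots> = card edges * B ^ card edges * ?I" by simp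
    finally show ?thesis unfolding eq .
  qed
  have "(LINT p|square. ?f p * (drift U p - drift V p))
      = (LINT p|square. ?f p * drift U p - ?f p * drift V p)"
    by (simp only: right_diff_distrib)
  also have "\<dots> = (LINT p|square. ?f p * drift U p) - (LINT p|square. ?f p * drift V p)"
    by (rule Bochner_Integration.integral_diff[OF dU(2) dV(2)])
  also have "\<dots> = (\<Sum>ab\<in>arcs. (LINT z|?P. ?f (z (fst ab), z (snd ab)) * ?\<Pi> U z)
      - (LINT z|?P. ?f (z (fst ab), z (snd ab)) * ?\<Pi> V z))"
    unfolding sum_subtractf by (intro arg_cong2[where f = "(-)"] dU(1) dV(1))
  finally have eq: "(LINT p|square. ?f p * (drift U p - drift V p)) = \<dots>" .
  have "\<bar>LINT p|square. ?f p * (drift U p - drift V p)\<bar>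
      \<le> (\<Sum>ab\<in>arcs. \<bar>(LINT z|?P. ?f (z (fst ab), z (snd ab)) * ?\<Pi> U z)
        - (LINT z|?P. ?f (z (fst ab), z (snd ab)) * ?\<Pi> V z)\<bar>)"
    unfolding eq by (rule sum_abs)
  also have "\<dots> \<le> card arcs * (card edges * B ^ card edges * ?I)"
    by (rule sum_bounded_above[OF each])
  finally show ?thesis by (simp only: mult.assoc)
qed

lemma trajectory_quotient_bound:
  assumes \<Phi>: "is_trajectory M k (removal_rule F) W \<Phi>" and t: "t \<ge> 0"
  obtains \<rho> where "(\<rho> \<longlongrightarrow> 0) (at t within {0..})"
    "\<forall>\<^sub>F s in at t within {0..}. s \<ge> 0 \<and> s \<noteq> t \<and>
      (AE p in square. \<bar>(\<Phi> s p - \<Phi> t p) / (s - t) - (- drift (\<Phi> t) p)\<bar> \<le> \<rho> s)"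
proof -
  have k: "kernel M (\<Phi> t)" using \<Phi> t by (simp add: is_trajectory_def)
  let ?n = "\<lambda>s. sup_norm M (\<lambda>p. (\<Phi> s p - \<Phi> t p) / (s - t) - velocity M k (removal_rule F) (\<Phi> t) p)"
  have lim: "(?n \<longlongrightarrow> 0) (at t within {0..})"
    using \<Phi> t by (simp add: is_trajectory_def)
  then have "\<forall>\<^sub>F s in at t within {0..}. ?n s < \<infinity>"
    by (rule order_tendstoD) simp
  moreover have "\<forall>\<^sub>F s in at t within {0..}. s \<ge> 0 \<and> s \<noteq> t"
    by (simp add: eventually_at_filter)
  ultimately have "\<forall>\<^sub>F s in at t within {0..}. s \<ge> 0 \<and> s \<noteq> t \<and>
      (AE p in square. \<bar>(\<Phi> s p - \<Phi> t p) / (s - t) - (- drift (\<Phi> t) p)\<bar> \<le> real_of_ereal (?n s))"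
  proof eventually_elim
    case (elim s)
    have "AE p in square. p \<in> space square" by (rule AE_space)
    with AE_sup_norm[OF elim(1)]
    have "AE p in square. \<bar>(\<Phi> s p - \<Phi> t p) / (s - t) - (- drift (\<Phi> t) p)\<bar> \<le> real_of_ereal (?n s)"
      by eventually_elim (simp only: velocity_kernel[OF k])
    then show ?case using elim(2) by blast
  qed
  moreover have "((\<lambda>s. real_of_ereal (?n s)) \<longlongrightarrow> 0) (at t within {0..})"
    using lim by (intro lim_real_of_ereal) (simp add: zero_ereal_def)
  ultimately show ?thesis using that by blast
qed

lemma trajectory_locally_bounded:
  assumes \<Phi>: "is_trajectory M k (removal_rule F) W \<Phi>" and \<tau>: "\<tau> \<ge> 0"
  shows "\<exists>B\<ge>1. \<forall>t. 0 \<le> t \<longrightarrow> t \<le> \<tau> \<longrightarrow> (AE p in square. \<bar>\<Phi> t p\<bar> \<le> B)"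
proof -
  have "\<exists>B\<ge>1. \<forall>t. 0 \<le> t \<longrightarrow> t \<in> {0..\<tau>} \<longrightarrow> (AE p in square. \<bar>\<Phi> t p\<bar> \<le> B)"
  proof (rule Bolzano[where P = "\<lambda>a b. \<exists>B\<ge>1. \<forall>t. 0 \<le> t \<longrightarrow> t \<in> {a..b} \<longrightarrow> (AE p in square. \<bar>\<Phi> t p\<bar> \<le> B)", OF \<tau>])
    fix a b c :: real
    assume "\<exists>B\<ge>1. \<forall>t. 0 \<le> t \<longrightarrow> t \<in> {a..b} \<longrightarrow> (AE p in square. \<bar>\<Phi> t p\<bar> \<le> B)"
      "\<exists>B\<ge>1. \<forall>t. 0 \<le> t \<longrightarrow> t \<in> {b..c} \<longrightarrow> (AE p in square. \<bar>\<Phi> t p\<bar> \<le> B)"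
    then obtain B C where B: "B \<ge> 1" "\<And>t. 0 \<le> t \<Longrightarrow> t \<in> {a..b} \<Longrightarrow> AE p in square. \<bar>\<Phi> t p\<bar> \<le> B"
      and C: "\<And>t. 0 \<le> t \<Longrightarrow> t \<in> {b..c} \<Longrightarrow> AE p in square. \<bar>\<Phi> t p\<bar> \<le> C" by blast
    show "\<exists>B\<ge>1. \<forall>t. 0 \<le> t \<longrightarrow> t \<in> {a..c} \<longrightarrow> (AE p in square. \<bar>\<Phi> t p\<bar> \<le> B)"
    proof (intro exI[of _ "max B C"] conjI allI impI)
      fix t assume t: "0 \<le> t" "t \<in> {a..c}"
      show "AE p in square. \<bar>\<Phi> t p\<bar> \<le> max B C"
      proof (cases "t \<le> b")
        case True
        with B(2)[OF t(1)] t(2) have "AE p in square. \<bar>\<Phi> t p\<bar> \<le> B" by simp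
        then show ?thesis by eventually_elim simp
      next
        case False
        with C[OF t(1)] t(2) have "AE p in square. \<bar>\<Phi> t p\<bar> \<le> C" by simp
        then show ?thesis by eventually_elim simp
      qed
    qed (use B(1) in simp)
  next
    fix x :: real assume x: "0 \<le> x" "x \<le> \<tau>"
    have kx: "kernel M (\<Phi> x)" using \<Phi> x by (simp add: is_trajectory_def)
    obtain b where b: "b \<ge> 0" "\<And>p. p \<in> space square \<Longrightarrow> \<bar>\<Phi> x p\<bar> \<le> b"
      using kernel_bounded[OF kx] by blast
    define V where "V = card arcs * b ^ card edges"
    have V: "\<bar>drift (\<Phi> x) p\<bar> \<le> V" if "p \<in> space square" for p
      unfolding V_def using kx by (intro drift_bounded b that) (simp_all add: kernel_def)
    obtain \<rho> where \<rho>: "(\<rho> \<longlongrightarrow> 0) (at x within {0..})"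
      and ev: "\<forall>\<^sub>F s in at x within {0..}. s \<ge> 0 \<and> s \<noteq> x \<and>
        (AE p in square. \<bar>(\<Phi> s p - \<Phi> x p) / (s - x) - (- drift (\<Phi> x) p)\<bar> \<le> \<rho> s)"
      by (rule trajectory_quotient_bound[OF \<Phi> x(1)])
    have "\<forall>\<^sub>F s in at x within {0..}. \<rho> s < 1"
      using \<rho> by (rule order_tendstoD) simp
    with ev have "\<forall>\<^sub>F s in at x within {0..}. \<rho> s < 1 \<and> s \<noteq> x \<and>
        (AE p in square. \<bar>(\<Phi> s p - \<Phi> x p) / (s - x) - (- drift (\<Phi> x) p)\<bar> \<le> \<rho> s)"
      by eventually_elim blast
    then obtain d where d: "d > 0" "\<And>s. s \<ge> 0 \<Longrightarrow> s \<noteq> x \<Longrightarrow> dist s x < d \<Longrightarrow> \<rho> s < 1 \<and>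
        (AE p in square. \<bar>(\<Phi> s p - \<Phi> x p) / (s - x) - (- drift (\<Phi> x) p)\<bar> \<le> \<rho> s)"
      unfolding eventually_at by auto
    let ?B = "1 + b + (V + 1)"
    have V0: "0 \<le> V" unfolding V_def using b(1) by simp
    show "\<exists>d>0. \<forall>a b. a \<le> x \<and> x \<le> b \<and> b - a < d \<longrightarrow>
      (\<exists>B\<ge>1. \<forall>t. 0 \<le> t \<longrightarrow> t \<in> {a..b} \<longrightarrow> (AE p in square. \<bar>\<Phi> t p\<bar> \<le> B))"
    proof (rule exI[of _ "min d 1"], intro conjI allI impI)
      fix a b' assume ab: "a \<le> x \<and> x \<le> b' \<and> b' - a < min d 1"
      show "\<exists>B\<ge>1. \<forall>t. 0 \<le> t \<longrightarrow> t \<in> {a..b'} \<longrightarrow> (AE p in square. \<bar>\<Phi> t p\<bar> \<le> B)"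
      proof (intro exI[of _ ?B] conjI allI impI)
        fix s assume s: "0 \<le> s" "s \<in> {a..b'}"
        have dist: "dist s x < d" "\<bar>s - x\<bar> < 1" using ab s by (auto simp: dist_real_def)
        show "AE p in square. \<bar>\<Phi> s p\<bar> \<le> ?B"
        proof (cases "s = x")
          case True
          show ?thesis
          proof (rule AE_I2)
            fix p assume "p \<in> space square"
            from b(2)[OF this] V0 show "\<bar>\<Phi> s p\<bar> \<le> ?B" by (simp add: True)
          qed
        next
          case False
          from d(2)[OF s(1) False dist(1)] have \<rho>s: "\<rho> s < 1"
            and ae: "AE p in square. \<bar>(\<Phi> s p - \<Phi> x p) / (s - x) - (- drift (\<Phi> x) p)\<bar> \<le> \<rho> s" by auto
          from ae AE_space[of "square"] show ?thesis
          proof eventually_elim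
            case (elim p)
            let ?q = "(\<Phi> s p - \<Phi> x p) / (s - x)"
            have "\<bar>?q\<bar> \<le> V + 1" using elim(1) V[OF elim(2)] \<rho>s by linarith
            moreover have "\<bar>s - x\<bar> * \<bar>?q\<bar> = \<bar>\<Phi> s p - \<Phi> x p\<bar>"
              using False by (simp add: abs_divide)
            moreover have "\<bar>s - x\<bar> * \<bar>?q\<bar> \<le> 1 * \<bar>?q\<bar>" using dist(2) by (intro mult_right_mono) auto
            ultimately have "\<bar>\<Phi> s p - \<Phi> x p\<bar> \<le> V + 1" by simp
            with b(2)[OF elim(2)] show ?case by linarith
          qed
        qed
      qed (use b(1) V0 in simp)
    qed (use d(1) in simp)
  qed
  then show ?thesis by auto
qed

end

lemma (in prob_space) integral_power2_has_derivative:
  fixes D :: "real \<Rightarrow> 'a \<Rightarrow> real"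
  assumes D: "\<And>s. 0 \<le> s \<Longrightarrow> D s \<in> borel_measurable M" "\<And>s. 0 \<le> s \<Longrightarrow> \<exists>b. \<forall>p\<in>space M. \<bar>D s p\<bar> \<le> b"
    and q: "q \<in> borel_measurable M" "\<And>p. p \<in> space M \<Longrightarrow> \<bar>q p\<bar> \<le> c"
    and t: "0 \<le> t"
    and \<rho>: "(\<rho> \<longlongrightarrow> 0) (at t within {0..})"
    and quot: "\<forall>\<^sub>F s in at t within {0..}. 0 \<le> s \<and> s \<noteq> t \<and> (AE p in M. \<bar>(D s p - D t p) / (s - t) - q p\<bar> \<le> \<rho> s)"
  shows "((\<lambda>s. LINT p|M. (D s p)\<^sup>2) has_real_derivative 2 * (LINT p|M. D t p * q p)) (at t within {0..})"
proof -
  obtain b where b: "\<And>p. p \<in> space M \<Longrightarrow> \<bar>D t p\<bar> \<le> b" using D(2)[OF t] by blast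
  have c0: "0 \<le> c" "0 \<le> b"
    using q(2) b not_empty by force+
  let ?E = "\<lambda>s. LINT p|M. (D s p)\<^sup>2"
  let ?err = "\<lambda>s. 2 * b * \<rho> s + \<bar>s - t\<bar> * (c + \<rho> s)\<^sup>2"
  have int_mult: "integrable M (\<lambda>p. f p * g p)"
    if "f \<in> borel_measurable M" "g \<in> borel_measurable M" "\<And>p. p \<in> space M \<Longrightarrow> \<bar>f p\<bar> \<le> x"
      "\<And>p. p \<in> space M \<Longrightarrow> \<bar>g p\<bar> \<le> y" for f g :: "'a \<Rightarrow> real" and x y
  proof (rule integrable_bounded[where B = "x * y"])
    show "(\<lambda>p. f p * g p) \<in> borel_measurable M" using that(1,2) by (rule borel_measurable_times)
    show "\<bar>f p * g p\<bar> \<le> x * y" if p: "p \<in> space M" for p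
      unfolding abs_mult by (rule mult_mono) (use \<open>p \<in> space M \<Longrightarrow> \<bar>f p\<bar> \<le> x\<close> \<open>p \<in> space M \<Longrightarrow> \<bar>g p\<bar> \<le> y\<close> p in \<open>auto intro: order_trans[OF abs_ge_zero]\<close>)
  qed
  have int_sq: "integrable M (\<lambda>p. (D s p)\<^sup>2)" if "0 \<le> s" for s
    using D(2)[OF that] int_mult[OF D(1)[OF that] D(1)[OF that]] unfolding power2_eq_square by blast
  have int_q: "integrable M (\<lambda>p. D t p * q p)"
    by (rule int_mult[OF D(1)[OF t] q(1) b q(2)])
  have bound: "\<forall>\<^sub>F s in at t within {0..}. norm ((?E s - ?E t) / (s - t) - 2 * (LINT p|M. D t p * q p)) \<le> ?err s"
    using quot
  proof eventually_elim
    case (elim s)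
    then have s: "0 \<le> s" "s \<noteq> t" and ae: "AE p in M. \<bar>(D s p - D t p) / (s - t) - q p\<bar> \<le> \<rho> s" by auto
    let ?F = "\<lambda>p. (D s p)\<^sup>2 / (s - t) - (D t p)\<^sup>2 / (s - t) - 2 * (D t p * q p)"
    have int_F: "integrable M ?F"
      by (intro Bochner_Integration.integrable_diff integrable_divide integrable_mult_right int_sq s t int_q)
    have eq: "(?E s - ?E t) / (s - t) - 2 * (LINT p|M. D t p * q p) = (LINT p|M. ?F p)"
      using int_sq[OF s(1)] int_sq[OF t] int_q by (simp add: diff_divide_distrib)
    have ae_F: "AE p in M. \<bar>?F p\<bar> \<le> ?err s"
      using ae AE_space
    proof eventually_elim
      case (elim p)
      define r where "r = (D s p - D t p) / (s - t) - q p"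
      have r: "\<bar>r\<bar> \<le> \<rho> s" using elim(1) by (simp add: r_def)
      have Ds: "D s p = D t p + (s - t) * (q p + r)"
        using s(2) by (simp add: r_def)
      have sq: "(D s p)\<^sup>2 - (D t p)\<^sup>2 = (s - t) * ((q p + r) * (2 * D t p + (s - t) * (q p + r)))"
        unfolding Ds by (simp add: algebra_simps power2_eq_square)
      have "?F p = (q p + r) * (2 * D t p + (s - t) * (q p + r)) - 2 * (D t p * q p)"
        unfolding diff_divide_distrib[symmetric] sq using s(2) by simp
      then have F: "?F p = 2 * D t p * r + (s - t) * (q p + r)\<^sup>2"
        by (simp add: algebra_simps power2_eq_square)
      have "\<bar>?F p\<bar> \<le> 2 * (\<bar>D t p\<bar> * \<bar>r\<bar>) + \<bar>s - t\<bar> * \<bar>q p + r\<bar>\<^sup>2"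
        unfolding F by (rule order_trans[OF abs_triangle_ineq]) (simp add: abs_mult)
      also have "\<dots> \<le> 2 * (b * \<rho> s) + \<bar>s - t\<bar> * (c + \<rho> s)\<^sup>2"
      proof (intro add_mono mult_left_mono mult_mono power_mono)
        show "\<bar>q p + r\<bar> \<le> c + \<rho> s" using q(2)[OF elim(2)] r by linarith
      qed (use b[OF elim(2)] r c0 in auto)
      finally show ?case by (simp add: mult.assoc)
    qed
    have "\<bar>LINT p|M. ?F p\<bar> \<le> (LINT p|M. \<bar>?F p\<bar>)"
      by (rule integral_abs_bound)
    also have "\<dots> \<le> ?err s"
      by (rule integral_le_const[OF integrable_abs[OF int_F] ae_F])
    finally show ?case unfolding eq by simp
  qed
  have "(?err \<longlongrightarrow> 2 * b * 0 + \<bar>t - t\<bar> * (c + 0)\<^sup>2) (at t within {0..})"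
    by (intro tendsto_intros \<rho>)
  then have "(?err \<longlongrightarrow> 0) (at t within {0..})" by simp
  from Lim_null_comparison[OF bound this]
  have "((\<lambda>s. (?E s - ?E t) / (s - t)) \<longlongrightarrow> 2 * (LINT p|M. D t p * q p)) (at t within {0..})"
    by (simp add: LIM_zero_iff)
  then show ?thesis
    unfolding has_field_derivative_iff .
qed

lemma gronwall_zero:
  fixes E E' :: "real \<Rightarrow> real"
  assumes deriv: "\<And>t. 0 \<le> t \<Longrightarrow> t \<le> \<tau> \<Longrightarrow> (E has_real_derivative E' t) (at t within {0..})"
    and le: "\<And>t. 0 \<le> t \<Longrightarrow> t \<le> \<tau> \<Longrightarrow> E' t \<le> C * E t"
    and "E 0 = 0" "0 \<le> \<tau>"
  shows "E \<tau> \<le> 0"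
proof (cases "\<tau> = 0")
  case False
  then have \<tau>: "0 < \<tau>" using assms(4) by simp
  let ?G = "\<lambda>t. E t * exp (- C * t)"
  have G: "(?G has_real_derivative (E' t - C * E t) * exp (- C * t)) (at t within {0..})" if "0 \<le> t" "t \<le> \<tau>" for t
    by (rule derivative_eq_intros deriv[OF that] refl)+ (simp add: algebra_simps)
  have "?G \<tau> \<le> ?G 0"
  proof (rule DERIV_nonpos_imp_decreasing_open[OF assms(4)])
    fix t assume t: "0 < t" "t < \<tau>"
    have "(?G has_real_derivative (E' t - C * E t) * exp (- C * t)) (at t)"
      using G[of t] t at_within_interior[of t "{0..}"] by simp
    moreover have "(E' t - C * E t) * exp (- C * t) \<le> 0"
      using le[of t] t by (intro mult_nonpos_nonneg) auto
    ultimately show "\<exists>y. (?G has_real_derivative y) (at t) \<and> y \<le> 0" by blast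
  next
    show "continuous_on {0..\<tau>} ?G"
    proof (rule DERIV_continuous_on)
      fix t assume "t \<in> {0..\<tau>}"
      then show "(?G has_real_derivative (E' t - C * E t) * exp (- C * t)) (at t within {0..\<tau>})"
        by (intro DERIV_subset[OF G]) auto
    qed
  qed
  then show ?thesis using assms(3) by (simp add: mult_le_0_iff)
qed (use assms in simp)

context removal_process
begin

lemma trajectory_unique:
  assumes \<Phi>: "is_trajectory M k (removal_rule F) W \<Phi>" and u: "removal_flow W K u" and \<tau>: "0 \<le> \<tau>"
  shows "AE p in square. \<Phi> \<tau> p = u \<tau> p"
proof -
  interpret S: prob_space "square" by (rule prob_space_square)
  have k\<Phi>: "kernel M (\<Phi> t)" if "0 \<le> t" for t using \<Phi> that by (simp add: is_trajectory_def)
  have ku: "kernel M (u t)" if "0 \<le> t" for t using graphon_kernel[OF removal_flowD(1)[OF u that]] .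
  obtain B where B: "1 \<le> B" "\<And>t. 0 \<le> t \<Longrightarrow> t \<le> \<tau> \<Longrightarrow> AE p in square. \<bar>\<Phi> t p\<bar> \<le> B"
    using trajectory_locally_bounded[OF \<Phi> \<tau>] by blast
  let ?D = "\<lambda>t p. \<Phi> t p - u t p" and ?q = "\<lambda>t p. - drift (\<Phi> t) p - (- drift (u t) p)"
  let ?E = "\<lambda>t. LINT p|square. (?D t p)\<^sup>2" and ?E' = "\<lambda>t. 2 * (LINT p|square. ?D t p * ?q t p)"
  let ?C = "2 * (card arcs * (card edges * B ^ card edges))"
  have D_meas: "?D s \<in> borel_measurable square" if "0 \<le> s" for s
    using k\<Phi>[OF that] ku[OF that] by (auto simp: kernel_def intro: borel_measurable_diff)
  have D_bounded: "\<exists>b. \<forall>p\<in>space square. \<bar>?D s p\<bar> \<le> b" if s: "0 \<le> s" for s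
  proof -
    obtain b where b: "\<And>p. p \<in> space square \<Longrightarrow> \<bar>\<Phi> s p\<bar> \<le> b" using kernel_bounded[OF k\<Phi>[OF s]] by blast
    obtain c where c: "\<And>p. p \<in> space square \<Longrightarrow> \<bar>u s p\<bar> \<le> c" using kernel_bounded[OF ku[OF s]] by blast
    show ?thesis
    proof (intro exI[of _ "b + c"] ballI)
      fix p assume "p \<in> space square"
      from b[OF this] c[OF this] show "\<bar>?D s p\<bar> \<le> b + c" by linarith
    qed
  qed
  have deriv: "(?E has_real_derivative ?E' t) (at t within {0..})" if t: "0 \<le> t" for t
  proof -
    obtain b where b: "b \<ge> 0" "\<And>p. p \<in> space square \<Longrightarrow> \<bar>\<Phi> t p\<bar> \<le> b" using kernel_bounded[OF k\<Phi>[OF t]] by blast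
    obtain c where c: "c \<ge> 0" "\<And>p. p \<in> space square \<Longrightarrow> \<bar>u t p\<bar> \<le> c" using kernel_bounded[OF ku[OF t]] by blast
    have meas: "\<Phi> t \<in> borel_measurable square" "u t \<in> borel_measurable square"
      using k\<Phi>[OF t] ku[OF t] by (auto simp: kernel_def)
    have q: "?q t \<in> borel_measurable square"
      using drift_measurable[OF meas(1)] drift_measurable[OF meas(2)] by simp
    have qb: "\<bar>?q t p\<bar> \<le> card arcs * b ^ card edges + card arcs * c ^ card edges"
      if p: "p \<in> space square" for p
      using drift_bounded[OF meas(1) b(2) b(1) p] drift_bounded[OF meas(2) c(2) c(1) p] by linarith
    obtain \<rho> where \<rho>: "(\<rho> \<longlongrightarrow> 0) (at t within {0..})"
      and ev: "\<forall>\<^sub>F s in at t within {0..}. s \<ge> 0 \<and> s \<noteq> t \<and>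
        (AE p in square. \<bar>(\<Phi> s p - \<Phi> t p) / (s - t) - (- drift (\<Phi> t) p)\<bar> \<le> \<rho> s)"
      by (rule trajectory_quotient_bound[OF \<Phi> t])
    have "((\<lambda>s. \<rho> s + K * \<bar>s - t\<bar>) \<longlongrightarrow> 0 + K * \<bar>t - t\<bar>) (at t within {0..})"
      by (intro tendsto_intros \<rho>)
    then have \<rho>': "((\<lambda>s. \<rho> s + K * \<bar>s - t\<bar>) \<longlongrightarrow> 0) (at t within {0..})" by simp
    have "\<forall>\<^sub>F s in at t within {0..}. 0 \<le> s \<and> s \<noteq> t \<and>
        (AE p in square. \<bar>(?D s p - ?D t p) / (s - t) - ?q t p\<bar> \<le> \<rho> s + K * \<bar>s - t\<bar>)"
      using ev
    proof eventually_elim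
      case (elim s)
      then have s: "0 \<le> s" "s \<noteq> t"
        and ae: "AE p in square. \<bar>(\<Phi> s p - \<Phi> t p) / (s - t) - (- drift (\<Phi> t) p)\<bar> \<le> \<rho> s" by auto
      have "AE p in square. \<bar>(?D s p - ?D t p) / (s - t) - ?q t p\<bar> \<le> \<rho> s + K * \<bar>s - t\<bar>"
        using ae AE_space
      proof eventually_elim
        case (elim p)
        have "(?D s p - ?D t p) / (s - t) - ?q t p
            = ((\<Phi> s p - \<Phi> t p) / (s - t) - (- drift (\<Phi> t) p)) - ((u s p - u t p) / (s - t) - (- drift (u t) p))"
          by (simp add: diff_divide_distrib)
        then show ?case
          using elim(1) removal_flow_quotient[OF u s(1) t s(2) elim(2)] by linarith
      qed
      then show ?case using s by blast
    qed
    from S.integral_power2_has_derivative[OF D_meas D_bounded q qb t \<rho>' this] show ?thesis .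
  qed
  have le: "?E' t \<le> ?C * ?E t" if t: "0 \<le> t" "t \<le> \<tau>" for t
  proof -
    have "AE p in square. \<bar>u t p\<bar> \<le> B"
    proof (rule AE_I2)
      fix p assume "p \<in> space square"
      with unit_valuedD(2)[OF graphon_unit_valued[OF removal_flowD(1)[OF u t(1)]] this] B(1)
      show "\<bar>u t p\<bar> \<le> B" by auto
    qed
    from drift_L2_lipschitz[OF k\<Phi>[OF t(1)] ku[OF t(1)] B(1) B(2)[OF t] this]
    have "\<bar>LINT p|square. ?D t p * (drift (\<Phi> t) p - drift (u t) p)\<bar> * 2 \<le> ?C * ?E t" by simp
    moreover have "(LINT p|square. ?D t p * ?q t p)
        = - (LINT p|square. ?D t p * (drift (\<Phi> t) p - drift (u t) p))"
      by (subst Bochner_Integration.integral_minus[symmetric]) (simp add: algebra_simps)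
    ultimately show ?thesis by linarith
  qed
  have "AE p in square. \<Phi> 0 p = W p"
    using \<Phi> by (simp add: is_trajectory_def)
  then have "AE p in square. (?D 0 p)\<^sup>2 = 0"
    using AE_space by eventually_elim (simp add: removal_flowD(2)[OF u])
  then have "?E 0 = 0" by (rule integral_eq_zero_AE)
  from gronwall_zero[of \<tau> ?E ?E' ?C, OF deriv le this \<tau>]
  have "?E \<tau> \<le> 0" by simp
  moreover have "0 \<le> ?E \<tau>" by simp
  ultimately have "?E \<tau> = 0" by simp
  moreover have "integrable square (\<lambda>p. (?D \<tau> p)\<^sup>2)"
  proof -
    obtain b where b: "\<forall>p\<in>space square. \<bar>?D \<tau> p\<bar> \<le> b" using D_bounded[OF \<tau>] by blast
    show ?thesis
    proof (rule S.integrable_bounded[where B = "b\<^sup>2"])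
      show "(\<lambda>p. (?D \<tau> p)\<^sup>2) \<in> borel_measurable square" using D_meas[OF \<tau>] by simp
      show "\<bar>(?D \<tau> p)\<^sup>2\<bar> \<le> b\<^sup>2" if "p \<in> space square" for p
        using power_mono[of "\<bar>?D \<tau> p\<bar>" b 2] b that by simp
    qed
  qed
  ultimately have "AE p in square. (?D \<tau> p)\<^sup>2 = 0"
    by (subst (asm) integral_nonneg_eq_0_iff_AE) auto
  then show ?thesis by eventually_elim simp
qed

end

section \<open>Destinations and uniform convergence\<close>

context prob_space
begin

lemma rectangle_integrals_determine:
  assumes U: "unit_valued U" and V: "unit_valued V"
    and rect: "\<And>A B. A \<in> sets M \<Longrightarrow> B \<in> sets M \<Longrightarrow>
      (LINT p|square. indicator (A \<times> B) p * U p) = (LINT p|square. indicator (A \<times> B) p * V p)"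
  shows "AE p in square. U p = V p"
proof -
  interpret S: prob_space "square" by (rule prob_space_square)
  let ?N = "square"
  have dens: "emeasure (density ?N (\<lambda>p. ennreal (Y p))) X = ennreal (LINT p|?N. indicator X p * Y p)"
    if Y: "unit_valued Y" and X: "X \<in> sets ?N" for Y X
  proof -
    have "emeasure (density ?N (\<lambda>p. ennreal (Y p))) X = (\<integral>\<^sup>+p. ennreal (Y p) * indicator X p \<partial>?N)"
      using unit_valuedD(1)[OF Y] X by (intro emeasure_density) auto
    also have "\<dots> = (\<integral>\<^sup>+p. ennreal (indicator X p * Y p) \<partial>?N)"
      by (intro nn_integral_cong) (auto split: split_indicator)
    also have "\<dots> = ennreal (LINT p|?N. indicator X p * Y p)"
    proof (rule nn_integral_eq_integral)
      show "integrable ?N (\<lambda>p. indicator X p * Y p)"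
        using integrable_real_mult_indicator[OF X unit_valued_integrable[OF Y]] by (simp add: mult.commute)
      show "AE p in ?N. 0 \<le> indicator X p * Y p"
        using unit_valuedD(2)[OF Y] by (intro AE_I2) auto
    qed
    finally show ?thesis .
  qed
  have "density ?N (\<lambda>p. ennreal (U p)) = density ?N (\<lambda>p. ennreal (V p))"
  proof (rule measure_eqI_generator_eq)
    let ?G = "{a \<times> b |a b. a \<in> sets M \<and> b \<in> sets M}"
    show "Int_stable ?G" by (rule Int_stable_pair_measure_generator)
    show "?G \<subseteq> Pow (space M \<times> space M)" by (rule pair_measure_closed)
    show "sets (density ?N (\<lambda>p. ennreal (U p))) = sigma_sets (space M \<times> space M) ?G"
      "sets (density ?N (\<lambda>p. ennreal (V p))) = sigma_sets (space M \<times> space M) ?G"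
      by (simp_all add: sets_pair_measure)
    show "range (\<lambda>_ :: nat. space M \<times> space M) \<subseteq> ?G" by blast
    show "(\<Union>i :: nat. space M \<times> space M) = space M \<times> space M" by simp
    show "emeasure (density ?N (\<lambda>p. ennreal (U p))) (space M \<times> space M) \<noteq> \<infinity>"
      by (subst dens[OF U]) (auto simp: sets.top)
    fix X assume "X \<in> ?G"
    then obtain A B where AB: "X = A \<times> B" "A \<in> sets M" "B \<in> sets M" by blast
    then have X: "X \<in> sets ?N" by simp
    show "emeasure (density ?N (\<lambda>p. ennreal (U p))) X = emeasure (density ?N (\<lambda>p. ennreal (V p))) X"
      unfolding dens[OF U X] dens[OF V X] unfolding AB(1) rect[OF AB(2,3)] ..
  qed
  then have "AE p in ?N. ennreal (U p) = ennreal (V p)"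
    using unit_valuedD(1)[OF U] unit_valuedD(1)[OF V] by (subst (asm) S.density_unique_iff) auto
  then show ?thesis
    using AE_space
  proof eventually_elim
    case (elim p)
    then show ?case using unit_valuedD(2)[OF U, of p] unit_valuedD(2)[OF V, of p] by auto
  qed
qed

lemma cut_dist_rectangle:
  assumes "integrable square (\<lambda>p. U p - V p)" "A \<in> sets M" "B \<in> sets M"
  shows "\<bar>LINT p|square. indicator (A \<times> B) p * (U p - V p)\<bar> \<le> (LINT p|square. \<bar>U p - V p\<bar>)"
    and "\<bar>LINT p|square. indicator (A \<times> B) p * (U p - V p)\<bar> \<le> cut_dist M U V"
proof -
  let ?r = "\<lambda>A B. \<bar>LINT p|square. indicator (A \<times> B) p * (U p - V p)\<bar>"
  have le: "?r A B \<le> (LINT p|square. \<bar>U p - V p\<bar>)" if "A \<in> sets M" "B \<in> sets M" for A B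
  proof -
    have "integrable square (\<lambda>p. indicator (A \<times> B) p * (U p - V p))"
      using that integrable_real_mult_indicator[OF _ assms(1), of "A \<times> B"] by (simp add: mult.commute)
    then show ?thesis
      by (intro order_trans[OF integral_abs_bound] integral_mono integrable_abs assms(1))
        (auto split: split_indicator)
  qed
  show "?r A B \<le> (LINT p|square. \<bar>U p - V p\<bar>)" by (rule le[OF assms(2,3)])
  have "(\<lambda>(S, T). \<bar>LINT p:S \<times> T|square. U p - V p\<bar>) (A, B) \<le> cut_dist M U V"
    unfolding cut_dist_def
  proof (rule cSUP_upper)
    show "bdd_above ((\<lambda>(S, T). \<bar>LINT p:S \<times> T|square. U p - V p\<bar>) ` (sets M \<times> sets M))"
      using le by (intro bdd_aboveI2[where M = "LINT p|square. \<bar>U p - V p\<bar>"])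
        (auto simp: set_lebesgue_integral_def)
  qed (use assms in auto)
  then show "?r A B \<le> cut_dist M U V"
    by (simp add: set_lebesgue_integral_def)
qed

lemma cut_dist_le_L1:
  assumes "integrable square (\<lambda>p. U p - V p)"
  shows "cut_dist M U V \<le> (LINT p|square. \<bar>U p - V p\<bar>)"
  unfolding cut_dist_def
  using cut_dist_rectangle(1)[OF assms]
  by (intro cSUP_least) (auto simp: set_lebesgue_integral_def)

lemma cut_dist_nonneg:
  assumes "integrable square (\<lambda>p. U p - V p)"
  shows "0 \<le> cut_dist M U V"
  using cut_dist_rectangle(2)[OF assms, of "{}" "{}"] by simp

end

lemma nonpos_derivative_antimono:
  fixes G G' :: "real \<Rightarrow> real"
  assumes deriv: "\<And>t. 0 \<le> t \<Longrightarrow> (G has_real_derivative G' t) (at t within {0..})"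
    and le: "\<And>t. a < t \<Longrightarrow> t < b \<Longrightarrow> G' t \<le> 0" and ab: "0 \<le> a" "a \<le> b"
  shows "G b \<le> G a"
proof (rule DERIV_nonpos_imp_decreasing_open[OF ab(2)])
  fix t assume t: "a < t" "t < b"
  then have "(G has_real_derivative G' t) (at t)"
    using deriv[of t] ab at_within_interior[of t "{0..}"] by simp
  then show "\<exists>y. (G has_real_derivative y) (at t) \<and> y \<le> 0" using le[OF t] by blast
next
  show "continuous_on {a..b} G"
  proof (rule DERIV_continuous_on)
    fix t assume "t \<in> {a..b}"
    then show "(G has_real_derivative G' t) (at t within {a..b})"
      using ab by (intro DERIV_subset[OF deriv]) auto
  qed
qed

context removal_process
begin

lemma edges_subset_arcs: "edges \<subseteq> arcs"
  by (auto simp: edges_def arcs_def)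

lemma removal_flow_unit_valued:
  assumes "removal_flow W K u" "0 \<le> t"
  shows "unit_valued (u t)"
  by (rule graphon_unit_valued[OF removal_flowD(1)[OF assms]])

lemma flow_mass_derivative:
  assumes u: "removal_flow W K u" and t: "0 \<le> t"
    and f: "f \<in> borel_measurable square" "\<And>p. p \<in> space square \<Longrightarrow> f p \<in> {0..1}"
  shows "((\<lambda>s. LINT p|square. f p * u s p) has_real_derivative
    - (LINT p|square. f p * drift (u t) p)) (at t within {0..})"
proof -
  interpret S: prob_space "square" by (rule prob_space_square)
  let ?m = "\<lambda>s. LINT p|square. f p * u s p" and ?d = "LINT p|square. f p * drift (u t) p"
  have int_u: "integrable square (\<lambda>p. f p * u s p)" if "0 \<le> s" for s
  proof (rule S.integrable_bounded[where B = 1])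
    note us = unit_valuedD[OF removal_flow_unit_valued[OF u that]]
    show "(\<lambda>p. f p * u s p) \<in> borel_measurable square"
      by (intro borel_measurable_times f(1) us(1))
    show "\<bar>f p * u s p\<bar> \<le> 1" if "p \<in> space square" for p
      using f(2)[OF that] us(2)[OF that] by (auto simp: abs_mult intro: mult_le_one)
  qed
  have int_d: "integrable square (\<lambda>p. f p * drift (u t) p)"
  proof (rule drift_duality(2)[where B = 1 and C = 1])
    note ut = unit_valuedD[OF removal_flow_unit_valued[OF u t]]
    show "u t \<in> borel_measurable square" by (rule ut(1))
    show "\<bar>u t p\<bar> \<le> 1" if "p \<in> space square" for p using ut(2)[OF that] by auto
    show "\<bar>f p\<bar> \<le> 1" if "p \<in> space square" for p using f(2)[OF that] by auto
  qed (rule f(1))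
  have quot: "\<forall>\<^sub>F s in at t within {0..}. norm ((?m s - ?m t) / (s - t) - - ?d) \<le> K * \<bar>s - t\<bar>"
    unfolding eventually_at_filter
  proof (rule always_eventually, intro allI impI)
    fix s assume s: "s \<noteq> t" "s \<in> {0..}"
    then have s0: "0 \<le> s" by simp
    let ?F = "\<lambda>p. f p * u s p / (s - t) - f p * u t p / (s - t) + f p * drift (u t) p"
    have int_F: "integrable square ?F"
      by (intro Bochner_Integration.integrable_diff Bochner_Integration.integrable_add integrable_divide int_u s0 t int_d)
    have eq: "(?m s - ?m t) / (s - t) - - ?d = (LINT p|square. ?F p)"
      using int_u[OF s0] int_u[OF t] int_d by (simp add: diff_divide_distrib)
    have "\<bar>LINT p|square. ?F p\<bar> \<le> (LINT p|square. \<bar>?F p\<bar>)"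
      by (rule integral_abs_bound)
    also have "\<dots> \<le> K * \<bar>s - t\<bar>"
    proof (rule S.integral_le_const[OF integrable_abs[OF int_F]], rule AE_I2)
      fix p assume p: "p \<in> space square"
      have "?F p = f p * ((u s p - u t p) / (s - t) - (- drift (u t) p))"
        by (simp add: diff_divide_distrib algebra_simps)
      then have "\<bar>?F p\<bar> = f p * \<bar>(u s p - u t p) / (s - t) - (- drift (u t) p)\<bar>"
        using f(2)[OF p] by (simp add: abs_mult)
      also have "\<dots> \<le> 1 * \<bar>(u s p - u t p) / (s - t) - (- drift (u t) p)\<bar>"
        using f(2)[OF p] by (intro mult_right_mono) auto
      also have "\<dots> \<le> K * \<bar>s - t\<bar>"
        using removal_flow_quotient[OF u s0 t s(1) p] by simp
      finally show "\<bar>?F p\<bar> \<le> K * \<bar>s - t\<bar>" .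
    qed
    finally show "norm ((?m s - ?m t) / (s - t) - - ?d) \<le> K * \<bar>s - t\<bar>" unfolding eq by simp
  qed
  have "((\<lambda>s. K * \<bar>s - t\<bar>) \<longlongrightarrow> K * \<bar>t - t\<bar>) (at t within {0..})"
    by (intro tendsto_intros)
  then have "((\<lambda>s. K * \<bar>s - t\<bar>) \<longlongrightarrow> 0) (at t within {0..})" by simp
  from Lim_null_comparison[OF quot this]
  have "((\<lambda>s. (?m s - ?m t) / (s - t)) \<longlongrightarrow> - ?d) (at t within {0..})"
    by (simp only: LIM_zero_iff)
  then show ?thesis unfolding has_field_derivative_iff .
qed

lemma integral_drift_unit:
  assumes U: "unit_valued U"
    and f: "f \<in> borel_measurable square" "\<And>p. p \<in> space square \<Longrightarrow> f p \<in> {0..1}"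
  shows "(LINT p|square. f p * drift U p) = (\<Sum>ab\<in>arcs. LINT z|power_space {1..k}.
      f (z (fst ab), z (snd ab)) * (\<Prod>e\<in>edges. U (z (fst e), z (snd e))))"
    and "ab \<in> arcs \<Longrightarrow> integrable (power_space {1..k})
      (\<lambda>z. f (z (fst ab), z (snd ab)) * (\<Prod>e\<in>edges. U (z (fst e), z (snd e))))"
proof -
  have b: "\<bar>U p\<bar> \<le> 1" "\<bar>f p\<bar> \<le> 1" if "p \<in> space square" for p
    using unit_valuedD(2)[OF U that] f(2)[OF that] by auto
  show "(LINT p|square. f p * drift U p) = (\<Sum>ab\<in>arcs. LINT z|power_space {1..k}.
      f (z (fst ab), z (snd ab)) * (\<Prod>e\<in>edges. U (z (fst e), z (snd e))))"
    by (rule drift_duality(1)[OF unit_valuedD(1)[OF U] b(1) f(1) b(2)])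
  show "ab \<in> arcs \<Longrightarrow> integrable (power_space {1..k})
      (\<lambda>z. f (z (fst ab), z (snd ab)) * (\<Prod>e\<in>edges. U (z (fst e), z (snd e))))"
    by (rule drift_duality(3)[OF unit_valuedD(1)[OF U] b(1) f(1) b(2)])
qed

lemma integral_drift:
  assumes "unit_valued U"
  shows "(LINT p|square. drift U p) = card arcs * hom_density {1..k} edges U"
  using integral_drift_unit(1)[OF assms, of "\<lambda>_. 1"] by (simp add: hom_density_def)

lemma integrable_hom_product:
  assumes "unit_valued U"
  shows "integrable (power_space {1..k}) (\<lambda>z. \<Prod>e\<in>edges. U (z (fst e), z (snd e)))"
proof -
  interpret P: prob_space "power_space {1..k}" by (rule prob_space_power_space)
  show ?thesis
  proof (rule P.integrable_bounded[where B = 1])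
    show "(\<lambda>z. \<Prod>e\<in>edges. U (z (fst e), z (snd e))) \<in> borel_measurable (power_space {1..k})"
      by (rule hom_product_measurable[OF edges_subset unit_valuedD(1)[OF assms]])
    fix z assume z: "z \<in> space (power_space {1..k})"
    have "(\<Prod>e\<in>edges. U (z (fst e), z (snd e))) \<in> {0..1}"
      using edges_subset by (intro prod_unit_interval unit_valuedD(2)[OF assms] pair_in_square[OF z]) auto
    then show "\<bar>\<Prod>e\<in>edges. U (z (fst e), z (snd e))\<bar> \<le> 1" by simp
  qed
qed

lemma hom_density_flow_antimono:
  assumes u: "removal_flow W K u" and st: "0 \<le> s" "s \<le> t"
  shows "hom_density {1..k} edges (u t) \<le> hom_density {1..k} edges (u s)"
  unfolding hom_density_def
proof (rule integral_mono)
  show "integrable (power_space {1..k}) (\<lambda>z. \<Prod>e\<in>edges. u t (z (fst e), z (snd e)))"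
    "integrable (power_space {1..k}) (\<lambda>z. \<Prod>e\<in>edges. u s (z (fst e), z (snd e)))"
    using st by (intro integrable_hom_product removal_flow_unit_valued[OF u]; simp)+
  fix z assume z: "z \<in> space (power_space {1..k})"
  show "(\<Prod>e\<in>edges. u t (z (fst e), z (snd e))) \<le> (\<Prod>e\<in>edges. u s (z (fst e), z (snd e)))"
  proof (rule prod_mono)
    fix e assume "e \<in> edges"
    then have "(z (fst e), z (snd e)) \<in> space square"
      using edges_subset by (intro pair_in_square[OF z]) auto
    then show "0 \<le> u t (z (fst e), z (snd e)) \<and> u t (z (fst e), z (snd e)) \<le> u s (z (fst e), z (snd e))"
      using removal_flowD(3)[OF u st] unit_valuedD(2)[OF removal_flow_unit_valued[OF u], of t] st by auto
  qed
qed

lemma flow_eventually_sparse: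
  fixes T \<delta> :: real
  assumes u: "removal_flow W K u" and T: "0 \<le> T" "1 < card arcs * \<delta> * T"
  shows "hom_density {1..k} edges (u T) < \<delta>"
proof (rule ccontr)
  interpret S: prob_space "square" by (rule prob_space_square)
  assume "\<not> hom_density {1..k} edges (u T) < \<delta>"
  then have dense: "\<delta> \<le> hom_density {1..k} edges (u t)" if "0 \<le> t" "t \<le> T" for t
    using hom_density_flow_antimono[OF u that] by linarith
  let ?m = "\<lambda>t. LINT p|square. 1 * u t p"
  have m: "?m t \<in> {0..1}" if "0 \<le> t" for t
    using unit_valuedD[OF removal_flow_unit_valued[OF u that]] by (intro S.integral_in_unit_interval) auto
  have deriv: "((\<lambda>t. ?m t + card arcs * \<delta> * t) has_real_derivative
      - (LINT p|square. 1 * drift (u t) p) + card arcs * \<delta>) (at t within {0..})" if "0 \<le> t" for t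
  proof (rule DERIV_add[OF flow_mass_derivative[OF u that]])
    show "((\<lambda>t. card arcs * \<delta> * t) has_real_derivative card arcs * \<delta>) (at t within {0..})"
      by (auto intro!: derivative_eq_intros)
  qed auto
  have "?m T + card arcs * \<delta> * T \<le> ?m 0 + card arcs * \<delta> * 0"
  proof (rule nonpos_derivative_antimono[OF deriv])
    fix t assume t: "0 < t" "t < T"
    have "card arcs * \<delta> \<le> card arcs * hom_density {1..k} edges (u t)"
      using dense[of t] t by (intro mult_left_mono) auto
    then show "- (LINT p|square. 1 * drift (u t) p) + card arcs * \<delta> \<le> 0"
      using integral_drift[OF removal_flow_unit_valued[OF u], of t] t by simp
  qed (use T in auto)
  then show False using m[of 0] m[OF T(1)] T(2) by auto
qed

text \<open>Every copy of \<open>F\<close> uses a pair of \<open>A\<close>. Hence each unit of mass that a copy removes from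
  \<open>A\<close> is accompanied by the removal of at most \<open>card arcs\<close> units in total.\<close>

lemma flow_total_loss:
  assumes u: "removal_flow W K u" and T: "0 \<le> T" "T \<le> t"
    and A: "A \<in> sets square"
    and cover: "\<And>z. z \<in> space (power_space {1..k}) \<Longrightarrow> \<exists>e\<in>edges. (z (fst e), z (snd e)) \<in> A"
  shows "(LINT p|square. u T p) - (LINT p|square. u t p)
    \<le> card arcs * (LINT p|square. of_bool (p \<in> A) * u T p)"
proof -
  let ?N = "real (card arcs)" and ?f = "\<lambda>p. of_bool (p \<in> A) :: real"
  let ?m = "\<lambda>t. LINT p|square. 1 * u t p" and ?a = "\<lambda>t. LINT p|square. ?f p * u t p"
  have f: "?f \<in> borel_measurable square"
    using borel_measurable_indicator[OF A, where ?'b = real] by (simp add: indicator_def[abs_def] of_bool_def)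
  have deriv: "((\<lambda>t. ?N * ?a t - ?m t) has_real_derivative
      ?N * (- (LINT p|square. ?f p * drift (u t) p)) - (- (LINT p|square. 1 * drift (u t) p)))
      (at t within {0..})" if "0 \<le> t" for t
    by (intro DERIV_diff DERIV_cmult flow_mass_derivative[OF u that]) (use f in auto)
  have "?N * ?a t - ?m t \<le> ?N * ?a T - ?m T"
  proof (rule nonpos_derivative_antimono[OF deriv])
    fix s assume s: "T < s" "s < t"
    then have U: "unit_valued (u s)" using T by (intro removal_flow_unit_valued[OF u]) simp
    let ?\<Pi> = "\<lambda>z. \<Prod>e\<in>edges. u s (z (fst e), z (snd e))"
    have int: "integrable (power_space {1..k}) (\<lambda>z. ?f (z (fst ab), z (snd ab)) * ?\<Pi> z)" if "ab \<in> arcs" for ab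
      by (rule integral_drift_unit(2)[OF U f _ that]) auto
    have "hom_density {1..k} edges (u s)
        \<le> (LINT z|power_space {1..k}. (\<Sum>ab\<in>arcs. ?f (z (fst ab), z (snd ab)) * ?\<Pi> z))"
      unfolding hom_density_def
    proof (rule integral_mono[OF integrable_hom_product[OF U]])
      show "integrable (power_space {1..k}) (\<lambda>z. \<Sum>ab\<in>arcs. ?f (z (fst ab), z (snd ab)) * ?\<Pi> z)"
        by (intro Bochner_Integration.integrable_sum int)
      fix z assume z: "z \<in> space (power_space {1..k})"
      obtain e where e: "e \<in> edges" "(z (fst e), z (snd e)) \<in> A" using cover[OF z] by blast
      have "?\<Pi> z \<in> {0..1}"
        using edges_subset by (intro prod_unit_interval unit_valuedD(2)[OF U] pair_in_square[OF z]) auto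
      then have "0 \<le> ?f (z (fst ab), z (snd ab)) * ?\<Pi> z" for ab by simp
      then have "?f (z (fst e), z (snd e)) * ?\<Pi> z \<le> (\<Sum>ab\<in>arcs. ?f (z (fst ab), z (snd ab)) * ?\<Pi> z)"
        using e(1) edges_subset_arcs finite_arcs
        by (intro member_le_sum[of e arcs "\<lambda>ab. ?f (z (fst ab), z (snd ab)) * ?\<Pi> z"]) auto
      then show "?\<Pi> z \<le> (\<Sum>ab\<in>arcs. ?f (z (fst ab), z (snd ab)) * ?\<Pi> z)"
        using e(2) by simp
    qed
    also have "\<dots> = (\<Sum>ab\<in>arcs. LINT z|power_space {1..k}. ?f (z (fst ab), z (snd ab)) * ?\<Pi> z)"
      by (rule Bochner_Integration.integral_sum[OF int])
    also have "\<dots> = (LINT p|square. ?f p * drift (u s) p)"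
      by (rule integral_drift_unit(1)[OF U f, symmetric]) auto
    finally have "?N * hom_density {1..k} edges (u s) \<le> ?N * (LINT p|square. ?f p * drift (u s) p)"
      by (intro mult_left_mono) auto
    then show "?N * (- (LINT p|square. ?f p * drift (u s) p)) - (- (LINT p|square. 1 * drift (u s) p)) \<le> 0"
      using integral_drift[OF U] by simp
  qed (use T in auto)
  moreover have "0 \<le> ?a t"
    using unit_valuedD(2)[OF removal_flow_unit_valued[OF u, of t]] T
    by (intro integral_nonneg_AE AE_I2) auto
  then have "0 \<le> ?N * ?a t" by simp
  ultimately show ?thesis by simp
qed

definition flow_limit :: "(real \<Rightarrow> 'a \<times> 'a \<Rightarrow> real) \<Rightarrow> 'a \<times> 'a \<Rightarrow> real" where
  "flow_limit u p = lim (\<lambda>n. u (real n) p)"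

lemma flow_limit:
  assumes u: "removal_flow W K u"
  shows "p \<in> space square \<Longrightarrow> (\<lambda>n. u (real n) p) \<longlonglongrightarrow> flow_limit u p"
    and "p \<in> space square \<Longrightarrow> 0 \<le> t \<Longrightarrow> flow_limit u p \<le> u t p"
    and "graphon M (flow_limit u)"
proof -
  note unit = unit_valuedD[OF removal_flow_unit_valued[OF u]]
  have lim: "(\<lambda>n. u (real n) p) \<longlonglongrightarrow> flow_limit u p" if p: "p \<in> space square" for p
  proof -
    have "decseq (\<lambda>n. u (real n) p)"
      by (rule decseq_SucI) (rule removal_flowD(3)[OF u _ _ p], auto)
    moreover have "\<forall>n. 0 \<le> u (real n) p" using unit(2)[OF _ p] by auto
    ultimately obtain L where "(\<lambda>n. u (real n) p) \<longlonglongrightarrow> L"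
      by (rule decseq_convergent)
    then have "convergent (\<lambda>n. u (real n) p)"
      by (rule convergentI)
    then show ?thesis unfolding flow_limit_def by (simp add: convergent_LIMSEQ_iff)
  qed
  then show "p \<in> space square \<Longrightarrow> (\<lambda>n. u (real n) p) \<longlonglongrightarrow> flow_limit u p" .
  show "flow_limit u p \<le> u t p" if p: "p \<in> space square" and t: "0 \<le> t"
  proof (rule LIMSEQ_le_const2[OF lim[OF p]])
    show "\<exists>N. \<forall>n\<ge>N. u (real n) p \<le> u t p"
    proof (intro exI[of _ "nat \<lceil>t\<rceil>"] allI impI)
      fix n assume "nat \<lceil>t\<rceil> \<le> n"
      then show "u (real n) p \<le> u t p" by (intro removal_flowD(3)[OF u t _ p]) linarith
    qed
  qed
  have range: "flow_limit u p \<in> {0..1}" if p: "p \<in> space square" for p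
    using LIMSEQ_le_const[OF lim[OF p], of 0] LIMSEQ_le_const2[OF lim[OF p], of 1] unit(2)[OF _ p] by auto
  show "graphon M (flow_limit u)"
    unfolding graphon_def kernel_def
  proof (intro conjI ballI exI[of _ 1])
    show "flow_limit u \<in> borel_measurable square"
      unfolding flow_limit_def[abs_def] by (rule borel_measurable_lim_metric) (rule unit(1), simp)
    fix x y assume xy: "x \<in> space M" "y \<in> space M"
    then have sq: "(x, y) \<in> space square" by (simp add: space_pair_measure)
    have "u (real n) (x, y) = u (real n) (y, x)" for n
      using removal_flowD(1)[OF u, of "real n"] xy by (simp add: graphon_def kernel_def)
    then show "flow_limit u (x, y) = flow_limit u (y, x)" by (simp add: flow_limit_def)
    show "0 \<le> flow_limit u (x, y)" "flow_limit u (x, y) \<le> 1" "\<bar>flow_limit u (x, y)\<bar> \<le> 1"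
      using range[OF sq] by auto
  qed
qed

lemma flow_limit_L1:
  assumes u: "removal_flow W K u"
  shows "(\<lambda>n. LINT p|square. u (real n) p) \<longlonglongrightarrow> (LINT p|square. flow_limit u p)"
proof -
  interpret S: prob_space "square" by (rule prob_space_square)
  note unit = unit_valuedD[OF removal_flow_unit_valued[OF u]]
  show ?thesis
  proof (rule integral_dominated_convergence[where w = "\<lambda>_. 1"])
    show "flow_limit u \<in> borel_measurable square"
      by (rule unit_valuedD(1)[OF graphon_unit_valued[OF flow_limit(3)[OF u]]])
    show "integrable square (\<lambda>_. 1 :: real)" by (rule S.integrable_const)
    show "u (real n) \<in> borel_measurable square" for n by (rule unit(1)) simp
    show "AE p in square. (\<lambda>n. u (real n) p) \<longlonglongrightarrow> flow_limit u p"
      by (intro AE_I2 flow_limit(1)[OF u])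
    show "AE p in square. norm (u (real n) p) \<le> 1" for n
      using unit(2)[of "real n"] by (intro AE_I2) auto
  qed
qed

lemma integral_flow_diff:
  assumes u: "removal_flow W K u" and t: "0 \<le> t"
  shows "(LINT p|square. \<bar>u t p - flow_limit u p\<bar>)
    = (LINT p|square. u t p) - (LINT p|square. flow_limit u p)"
proof -
  have "(LINT p|square. \<bar>u t p - flow_limit u p\<bar>) = (LINT p|square. u t p - flow_limit u p)"
    using flow_limit(2)[OF u _ t] by (intro Bochner_Integration.integral_cong) auto
  also have "\<dots> = (LINT p|square. u t p) - (LINT p|square. flow_limit u p)"
    by (intro Bochner_Integration.integral_diff unit_valued_integrable removal_flow_unit_valued[OF u t]
        graphon_unit_valued[OF flow_limit(3)[OF u]])
  finally show ?thesis .
qed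

lemma flow_tends_to_limit:
  assumes u: "removal_flow W K u"
  shows "((\<lambda>t. LINT p|square. \<bar>u t p - flow_limit u p\<bar>) \<longlongrightarrow> 0) at_top"
proof (rule tendsto_sandwich)
  let ?L = "LINT p|square. flow_limit u p"
  let ?m = "\<lambda>n. LINT p|square. u (real n) p"
  show "\<forall>\<^sub>F t in at_top. 0 \<le> (LINT p|square. \<bar>u t p - flow_limit u p\<bar>)"
    by (intro always_eventually allI integral_nonneg_AE) simp
  show "\<forall>\<^sub>F t in at_top. (LINT p|square. \<bar>u t p - flow_limit u p\<bar>) \<le> ?m (nat \<lfloor>t\<rfloor>) - ?L"
    using eventually_ge_at_top[of 0]
  proof eventually_elim
    case (elim t)
    have "(LINT p|square. u t p) \<le> ?m (nat \<lfloor>t\<rfloor>)"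
      using elim
      by (intro integral_mono unit_valued_integrable removal_flow_unit_valued[OF u] removal_flowD(3)[OF u]) auto
    then show ?case using integral_flow_diff[OF u elim] by simp
  qed
  have "filterlim (\<lambda>t :: real. nat \<lfloor>t\<rfloor>) sequentially at_top"
    by (rule filterlim_compose[OF filterlim_nat_sequentially filterlim_floor_sequentially])
  from filterlim_compose[OF flow_limit_L1[OF u] this]
  have "((\<lambda>t :: real. ?m (nat \<lfloor>t\<rfloor>) - ?L) \<longlongrightarrow> ?L - ?L) at_top"
    by (intro tendsto_intros)
  then show "((\<lambda>t :: real. ?m (nat \<lfloor>t\<rfloor>) - ?L) \<longlongrightarrow> 0) at_top" by simp
qed (rule tendsto_const)

lemma trajectory_AE_flow:
  assumes u: "removal_flow W K u" and t: "0 \<le> t"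
  shows "AE p in square. trajectory M k (removal_rule F) W t p = u t p"
proof -
  have "is_trajectory M k (removal_rule F) W (trajectory M k (removal_rule F) W)"
    unfolding trajectory_def by (rule someI[of "is_trajectory M k (removal_rule F) W", OF removal_flow_is_trajectory[OF u]])
  from trajectory_unique[OF this u t] show ?thesis .
qed

lemma trajectory_kernel:
  assumes u: "removal_flow W K u" and t: "0 \<le> t"
  shows "kernel M (trajectory M k (removal_rule F) W t)"
proof -
  have "is_trajectory M k (removal_rule F) W (trajectory M k (removal_rule F) W)"
    unfolding trajectory_def by (rule someI[of "is_trajectory M k (removal_rule F) W", OF removal_flow_is_trajectory[OF u]])
  then show ?thesis using t by (simp add: is_trajectory_def)
qed

lemma kernel_integrable:
  assumes "kernel M U"
  shows "integrable square U"
proof -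
  interpret S: prob_space "square" by (rule prob_space_square)
  obtain B where "\<And>p. p \<in> space square \<Longrightarrow> \<bar>U p\<bar> \<le> B" using kernel_bounded[OF assms] by blast
  then show ?thesis using assms by (intro S.integrable_bounded[where B = B]) (auto simp: kernel_def)
qed

lemma trajectory_cut_convergence:
  assumes u: "removal_flow W K u"
  shows "((\<lambda>t. cut_dist M (trajectory M k (removal_rule F) W t) (flow_limit u)) \<longlongrightarrow> 0) at_top"
proof (rule tendsto_sandwich[OF _ _ tendsto_const flow_tends_to_limit[OF u]])
  let ?\<Phi> = "trajectory M k (removal_rule F) W"
  have int: "integrable square (\<lambda>p. ?\<Phi> t p - flow_limit u p)" if "0 \<le> t" for t
    by (intro Bochner_Integration.integrable_diff kernel_integrable trajectory_kernel[OF u that]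
        graphon_kernel[OF flow_limit(3)[OF u]])
  show "\<forall>\<^sub>F t in at_top. 0 \<le> cut_dist M (?\<Phi> t) (flow_limit u)"
    using eventually_ge_at_top[of 0] by eventually_elim (rule cut_dist_nonneg[OF int])
  show "\<forall>\<^sub>F t in at_top. cut_dist M (?\<Phi> t) (flow_limit u) \<le> (LINT p|square. \<bar>u t p - flow_limit u p\<bar>)"
    using eventually_ge_at_top[of 0]
  proof eventually_elim
    case (elim t)
    have "(LINT p|square. \<bar>?\<Phi> t p - flow_limit u p\<bar>) = (LINT p|square. \<bar>u t p - flow_limit u p\<bar>)"
    proof (rule integral_cong_AE)
      show "AE p in square. \<bar>?\<Phi> t p - flow_limit u p\<bar> = \<bar>u t p - flow_limit u p\<bar>"
        using trajectory_AE_flow[OF u elim] by eventually_elim simp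
      show "(\<lambda>p. \<bar>?\<Phi> t p - flow_limit u p\<bar>) \<in> borel_measurable square"
        using int[OF elim] by auto
      have "integrable square (\<lambda>p. u t p - flow_limit u p)"
        by (intro Bochner_Integration.integrable_diff kernel_integrable graphon_kernel removal_flowD(1)[OF u elim]
            flow_limit(3)[OF u])
      then show "(\<lambda>p. \<bar>u t p - flow_limit u p\<bar>) \<in> borel_measurable square" by auto
    qed
    then show ?case using cut_dist_le_L1[OF int[OF elim]] by simp
  qed
qed

lemma dest_AE_flow_limit:
  assumes u: "removal_flow W K u"
  shows "AE p in square. dest M k (removal_rule F) W p = flow_limit u p"
    and "graphon M (dest M k (removal_rule F) W)"
proof -
  let ?\<Phi> = "trajectory M k (removal_rule F) W" and ?S = "dest M k (removal_rule F) W"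
  have S: "graphon M ?S \<and> ((\<lambda>t. cut_dist M (?\<Phi> t) ?S) \<longlongrightarrow> 0) at_top"
    unfolding dest_def
    by (rule someI[of "\<lambda>S. graphon M S \<and> ((\<lambda>t. cut_dist M (?\<Phi> t) S) \<longlongrightarrow> 0) at_top" "flow_limit u"])
      (use flow_limit(3)[OF u] trajectory_cut_convergence[OF u] in blast)
  then show graphon_S: "graphon M ?S" by blast
  note graphon_L = flow_limit(3)[OF u]
  show "AE p in square. ?S p = flow_limit u p"
  proof (rule rectangle_integrals_determine[OF graphon_unit_valued[OF graphon_S] graphon_unit_valued[OF graphon_L]])
    fix A B assume AB: "A \<in> sets M" "B \<in> sets M"
    let ?r = "\<lambda>Y. LINT p|square. indicator (A \<times> B) p * Y p"
    have int: "integrable square (\<lambda>p. indicator (A \<times> B) p * Y p)" if "kernel M Y" for Y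
      using integrable_real_mult_indicator[OF _ kernel_integrable[OF that], of "A \<times> B"] AB
      by (simp add: mult.commute)
    have diff: "\<bar>?r (?\<Phi> t) - ?r Y\<bar> \<le> cut_dist M (?\<Phi> t) Y" if "0 \<le> t" "kernel M Y" for t Y
    proof -
      note k = trajectory_kernel[OF u that(1)]
      have "?r (?\<Phi> t) - ?r Y = (LINT p|square. indicator (A \<times> B) p * (?\<Phi> t p - Y p))"
        by (subst Bochner_Integration.integral_diff[OF int[OF k] int[OF that(2)], symmetric])
          (simp add: right_diff_distrib)
      then show ?thesis
        using cut_dist_rectangle(2)[OF Bochner_Integration.integrable_diff[OF kernel_integrable[OF k]
              kernel_integrable[OF that(2)]] AB] by simp
    qed
    have lim: "((\<lambda>t. ?r (?\<Phi> t)) \<longlongrightarrow> ?r Y) at_top"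
      if "kernel M Y" "((\<lambda>t. cut_dist M (?\<Phi> t) Y) \<longlongrightarrow> 0) at_top" for Y
    proof (rule LIM_zero_cancel, rule Lim_null_comparison[OF _ that(2)])
      show "\<forall>\<^sub>F t in at_top. norm (?r (?\<Phi> t) - ?r Y) \<le> cut_dist M (?\<Phi> t) Y"
        using eventually_ge_at_top[of 0] by eventually_elim (simp add: diff[OF _ that(1)])
    qed
    show "?r ?S = ?r (flow_limit u)"
      by (rule tendsto_unique[OF _ lim lim])
        (use S trajectory_cut_convergence[OF u] graphon_kernel[OF graphon_S] graphon_kernel[OF graphon_L] in auto)
  qed
qed

lemma L1_trajectory_dest:
  assumes u: "removal_flow W K u" and t: "0 \<le> t"
  shows "L1_norm M (\<lambda>p. trajectory M k (removal_rule F) W t p - dest M k (removal_rule F) W p)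
    = (LINT p|square. u t p) - (LINT p|square. flow_limit u p)"
  unfolding L1_norm_def integral_flow_diff[OF assms, symmetric]
proof (rule integral_cong_AE)
  show "AE p in square. \<bar>trajectory M k (removal_rule F) W t p - dest M k (removal_rule F) W p\<bar>
      = \<bar>u t p - flow_limit u p\<bar>"
    using trajectory_AE_flow[OF assms] dest_AE_flow_limit(1)[OF u] by eventually_elim simp
  have "integrable square (\<lambda>p. trajectory M k (removal_rule F) W t p - dest M k (removal_rule F) W p)"
    "integrable square (\<lambda>p. u t p - flow_limit u p)"
    by (intro Bochner_Integration.integrable_diff kernel_integrable trajectory_kernel[OF assms]
        graphon_kernel dest_AE_flow_limit(2)[OF u] removal_flowD(1)[OF assms] flow_limit(3)[OF u])+
  then show "(\<lambda>p. \<bar>trajectory M k (removal_rule F) W t p - dest M k (removal_rule F) W p\<bar>) \<in> borel_measurable square"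
    "(\<lambda>p. \<bar>u t p - flow_limit u p\<bar>) \<in> borel_measurable square"
    by auto
qed

lemma uniform_L1_convergence:
  assumes "F \<noteq> {}" and \<epsilon>: "\<epsilon> > 0"
  obtains T where "T \<ge> 0" "\<And>W. graphon M W \<Longrightarrow>
    L1_norm M (\<lambda>p. trajectory M k (removal_rule F) W T p - dest M k (removal_rule F) W p) < \<epsilon>"
proof -
  let ?N = "real (card arcs)"
  have "arcs \<noteq> {}"
  proof -
    obtain s where s: "s \<in> F" using assms(1) by blast
    then have "s \<subseteq> {1..k}" "card s = 2" using F by (auto simp: labelled_graphs_def)
    then obtain a b where "s = {a, b}" "a \<noteq> b" by (auto simp: card_2_iff)
    with s \<open>s \<subseteq> {1..k}\<close> have "(a, b) \<in> arcs" by (auto simp: arcs_def)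
    then show ?thesis by blast
  qed
  then have N: "0 < ?N" using finite_arcs by (simp add: card_gt_0_iff)
  have \<epsilon>N: "0 < \<epsilon> / (2 * ?N)" using \<epsilon> N by simp
  show ?thesis
  proof (rule graphon_removal_lemma[of "{1..k}" edges, OF _ finite_edges edgeD \<epsilon>N])
    fix \<delta> :: real
    assume \<delta>: "0 < \<delta>" and removal: "\<And>W. unit_valued W \<Longrightarrow> hom_density {1..k} edges W < \<delta> \<Longrightarrow>
      \<exists>A\<in>sets square. (LINT p|square. of_bool (p \<in> A) * W p) \<le> \<epsilon> / (2 * ?N)
        \<and> (\<forall>z\<in>space (power_space {1..k}). \<exists>e\<in>edges. (z (fst e), z (snd e)) \<in> A)"
    define T where "T = 2 / (?N * \<delta>)"
    have T: "0 \<le> T" "1 < ?N * \<delta> * T" using N \<delta> by (auto simp: T_def)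
    show ?thesis
    proof (rule that[OF T(1)])
      fix W assume "graphon M W"
      then obtain K u where u: "removal_flow W K u" using ex_removal_flow by blast
      obtain A where A: "A \<in> sets square"
        and light: "(LINT p|square. of_bool (p \<in> A) * u T p) \<le> \<epsilon> / (2 * ?N)"
        and cover: "\<And>z. z \<in> space (power_space {1..k}) \<Longrightarrow> \<exists>e\<in>edges. (z (fst e), z (snd e)) \<in> A"
        using removal[OF removal_flow_unit_valued[OF u T(1)] flow_eventually_sparse[OF u T]] by blast
      let ?m = "\<lambda>t. LINT p|square. u t p"
      have "?N * (LINT p|square. of_bool (p \<in> A) * u T p) \<le> ?N * (\<epsilon> / (2 * ?N))"
        using light by (intro mult_left_mono) auto
      also have "\<dots> = \<epsilon> / 2" using N by simp
      finally have loss: "?m T - \<epsilon> / 2 \<le> ?m t" if "T \<le> t" for t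
        using flow_total_loss[OF u T(1) that A cover] by simp
      have "?m T - \<epsilon> / 2 \<le> (LINT p|square. flow_limit u p)"
      proof (rule LIMSEQ_le_const[OF flow_limit_L1[OF u]])
        show "\<exists>N. \<forall>n\<ge>N. ?m T - \<epsilon> / 2 \<le> ?m (real n)"
        proof (intro exI[of _ "nat \<lceil>T\<rceil>"] allI impI loss)
          fix n assume "nat \<lceil>T\<rceil> \<le> n"
          then show "T \<le> real n" by linarith
        qed
      qed
      then show "L1_norm M (\<lambda>p. trajectory M k (removal_rule F) W T p - dest M k (removal_rule F) W p) < \<epsilon>"
        unfolding L1_trajectory_dest[OF u T(1)] using \<epsilon> by linarith
    qed
  qed auto
qed

end

theorem theorem10p9:
  fixes M :: "'a measure" and k :: nat and F :: edge_set and R :: "edge_set \<Rightarrow> edge_set \<Rightarrow> real"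
  assumes "prob_space M" and "atomless M" and "separable_sigma_algebra M"
    and "F \<in> labelled_graphs k" and "card F > 0"
    and "R = removal_rule F"
  shows "\<forall>\<epsilon>>0. \<exists>T\<ge>0. \<forall>W. graphon M W \<longrightarrow>
    L1_norm M (\<lambda>p. trajectory M k R W T p - dest M k R W p) < \<epsilon>"
proof (intro allI impI)
  fix \<epsilon> :: real assume \<epsilon>: "\<epsilon> > 0"
  interpret prob_space M by fact
  interpret removal_process M k F by unfold_locales fact
  have "F \<noteq> {}" using assms(5) by auto
  from uniform_L1_convergence[OF this \<epsilon>] show "\<exists>T\<ge>0. \<forall>W. graphon M W \<longrightarrow>
      L1_norm M (\<lambda>p. trajectory M k R W T p - dest M k R W p) < \<epsilon>"
    unfolding assms(6) by blast
qed

end
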